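(* Let $$\alpha^*=\frac1{x_1-x_3}\begin{pmatrix} (x_2-x_3)\left(1-\frac{2h_4}{h_3}\right) & -(x_3-x_4)\left(1-\frac{2h_2}{h_3}\right) \\ (x_1-x_2)\left(1-\frac{2h_2}{h_3}\right) & (x_1-x_4)\left(1-\frac{2h_4}{h_3}\right) \end{pmatrix},\qquad \tilde\alpha=\frac{x_1-x_3}{x_2-x_4}\,\hat{\bar{\alpha^*}},$$ and let coordinates $w_i$ be defined by $$\begin{pmatrix} z_1 \\ z_3 \end{pmatrix}=\begin{pmatrix} w_1 \\ w_3 \end{pmatrix}+\overline{\alpha^*}\begin{pmatrix} \bar w_2 \\ \bar w_4 \end{pmatrix},\qquad \begin{pmatrix} z_2 \\ z_4 \end{pmatrix}=\begin{pmatrix} w_2 \\ w_4 \end{pmatrix}+\bar{\tilde\alpha}\begin{pmatrix} \bar w_1 \\ \bar w_3 \end{pmatrix}.$$ Write $x_{ij}=x_i-x_j$, and (products of one-forms being wedge products) $$p=x_{12}^2x_{23}^2x_{14}^2x_{34},\quad q=x_{12}^2x_{23}^2x_{14}x_{34}^2,\quad r=x_{12}x_{23}^2x_{14}^2x_{34}^2,\quad s=x_{12}^2x_{23}x_{14}^2x_{34}^2 .$$ Then $$\frac{(x_1x_3+x_2x_4)^2}{4}A_1=p\,dw_1d\bar w_2-q\,dw_2d\bar w_3+r\,dw_3d\bar w_4+s\,dw_4d\bar w_1+p\,d\bar w_1dw_2-q\,d\bar w_2dw_3+r\,d\bar w_3dw_4+s\,d\bar w_4dw_1,$$ $$\frac{(x_1x_3+x_2x_4)^2}{4ic\mathbb{D}}A_2=p\,dw_1d\bar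 w_2+q\,dw_2d\bar w_3+r\,dw_3d\bar w_4-s\,dw_4d\bar w_1-p\,d\bar w_1dw_2-q\,d\bar w_2dw_3-r\,d\bar w_3dw_4+s\,d\bar w_4dw_1,$$ $$\frac{\Delta(x_1x_3+x_2x_4)^2}{4i\mathbb{D}}\,\omega=-\bigl\{x_{12}^2x_{13}x_{23}x_{14}^2x_{34}\,dw_1d\bar w_1+x_{12}^2x_{23}^2x_{14}x_{24}x_{34}\,dw_2d\bar w_2+x_{12}x_{13}x_{23}^2x_{14}x_{34}^2\,dw_3d\bar w_3+x_{12}x_{23}x_{14}^2x_{24}x_{34}^2\,dw_4d\bar w_4\bigr\}.$$ In particular, $-\omega$ is a K\"ahler form for the complex structure with holomorphic coordinates $w_i$, and this complex structure makes $X_r=V/\Lambda$ an abelian variety.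
   Context: Setting. Let $P(x)=p_4x^4+p_2x^2+p_1x+p_0\in\mathbb{Q}[x]$ be irreducible with four real roots $x_1>x_2>x_3>x_4$, such that the splitting field $\mathbb{Q}(x_1,\dots,x_4)\subset\mathbb{R}$ has Galois group $S_4$. Put $\mathbb{D}=\prod_{i<j}(x_i-x_j)>0$, $\Delta=\mathbb{D}^2\in\mathbb{Q}$; it is assumed (after scaling the roots if necessary) that $\Delta$ is an integer. Let $F=\mathbb{Q}(x_1,i\mathbb{D})$, a field of degree 8. Its embeddings in $\mathbb{C}$ are $\varphi_j,\varphi_{\bar j}$ ($j=1,2,3,4$), where $\varphi_j(x_1)=x_j$, $\varphi_j(i\mathbb{D})=(-1)^{j+1}i\mathbb{D}$, and $\varphi_{\bar j}$ is the complex conjugate of $\varphi_j$. Let $V=\mathbb{R}\otimes_{\mathbb{Q}}F$, let $\Lambda=\mathfrak{o}_F\subset V$ be the lattice given by the ring of integers, and let $z_j:V\to\mathbb{C}$ be the $\mathbb{R}$-linear extension of $\varphi_j$; $(z_1,z_2,z_3,z_4):V\to\mathbb{C}^4$ is an isomorphism of real vector spaces. Forms below are translation-invariant forms on the real torus $X_r=V/\Lambda$. Let $\mu_j=\prod_{k\ne j}(x_j-x_k)$ and $\omega=\frac{i\mathbb{D}}{\Delta}(\mu_1dz_1d\bar z_1-\mu_2dz_2d\bar z_2+\mu_3dz_3d\bar z_3-\mu_4dz_4d\bar z_4)$. Let $h_2=x_1x_2+x_3x_4$, $h_3=x_1x_3+x_2x_4$, $h_4=x_1x_4+x_2x_3$,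 and set $h_{12}=h_{34}=h_2$, $h_{13}=h_{24}=h_3$, $h_{14}=h_{23}=h_4$. Put $e_1=dz_1$, $e_2=d\bar z_2$, $e_3=dz_3$, $e_4=d\bar z_4$ and $A_+=\sum_{1\le i<j\le 4}h_{ij}(x_i-x_j)\,e_i\wedge e_j$. Then $A_1=A_++\overline{A_+}$ and $A_2=ic\mathbb{D}\,(A_+-\overline{A_+})$, where $c$ is a nonzero integer. For a $2\times2$ matrix $A=\begin{pmatrix} a_{11} & a_{12} \\ a_{21} & a_{22} \end{pmatrix}$, $\hat A=\begin{pmatrix} a_{22} & -a_{12} \\ -a_{21} & a_{11} \end{pmatrix}$; a bar over a matrix is entrywise complex conjugation. *)

theory Defs
  imports
    "HOL-Analysis.Analysis"
    "HOL-Algebra.Bij"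
    "HOL-Algebra.Sym_Groups"
    "HOL-Algebra.Generated_Fields"
    "HOL-Algebra.Algebraic_Closure_Type"
begin

section \<open>Field theory inside the reals and the complex numbers\<close>

definition rat_adjoin :: "'a::field_char_0 set \<Rightarrow> 'a set" where
  "rat_adjoin S = generate_field (ring_of_type_algebra :: 'a ring) S"

text \<open>The group of field automorphisms of \<open>K\<close> over \<open>\<rat>\<close>. As in the library's permutation group
  \<open>BijGroup K\<close>, its elements are the functions extensional on \<open>K\<close>.\<close>

definition galois_group :: "'a::field_char_0 set \<Rightarrow> ('a \<Rightarrow> 'a) monoid" where
  "galois_group K = (BijGroup K) \<lparr> carrier := {\<sigma> \<in> Bij K.
     (\<forall>a\<in>K. \<forall>b\<in>K. \<sigma> (a + b) = \<sigma> a + \<sigma> b \<and> \<sigma> (a * b) = \<sigma> a * \<sigma> b) \<and>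
     (\<forall>q\<in>\<rat>. \<sigma> q = q)} \<rparr>"

definition field_embedding :: "complex set \<Rightarrow> (complex \<Rightarrow> complex) \<Rightarrow> bool" where
  "field_embedding F \<phi> \<longleftrightarrow> \<phi> 1 = 1 \<and>
     (\<forall>a\<in>F. \<forall>b\<in>F. \<phi> (a + b) = \<phi> a + \<phi> b \<and> \<phi> (a * b) = \<phi> a * \<phi> b)"

definition ring_of_integers :: "complex set \<Rightarrow> complex set" where
  "ring_of_integers F = {a \<in> F. algebraic_int a}"

text \<open>\<open>is_real_extension F \<iota>\<close>: the real vector space \<open>'v\<close> together with \<open>\<iota>(a) = 1 \<otimes> a\<close> is
  \<open>\<real> \<otimes>\<^sub>\<rat> F\<close>. This is expressed by: \<open>\<iota>\<close> is \<open>\<rat>\<close>-linear on \<open>F\<close> and carries bases of \<open>F\<close> over \<open>\<rat>\<close>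
  to bases of \<open>'v\<close> over \<open>\<real>\<close>, which determines the pair up to a unique isomorphism.\<close>

definition is_real_extension :: "complex set \<Rightarrow> (complex \<Rightarrow> 'v::real_vector) \<Rightarrow> bool" where
  "is_real_extension F \<iota> \<longleftrightarrow>
     (\<forall>a\<in>F. \<forall>b\<in>F. \<iota> (a + b) = \<iota> a + \<iota> b) \<and>
     (\<forall>q::rat. \<forall>a\<in>F. \<iota> (of_rat q * a) = of_rat q *\<^sub>R \<iota> a) \<and>
     span (\<iota> ` F) = UNIV \<and>
     (\<forall>B\<subseteq>F. \<not> Modules.module.dependent (\<lambda>q::rat. \<lambda>a. of_rat q * a) B \<longrightarrow>
        inj_on \<iota> B \<and> independent (\<iota> ` B))"


section \<open>Translation-invariant forms and complex structures on a real torus\<close>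

text \<open>A translation-invariant form on the torus \<open>V/\<Lambda>\<close> is the same as an alternating
  multilinear form on \<open>V\<close>; a complex-valued one-form \<open>dz\<close> with constant coefficients is the
  linear map \<open>z : V \<rightarrow> \<complex>\<close> itself.\<close>

definition conj_form :: "('v \<Rightarrow> complex) \<Rightarrow> 'v \<Rightarrow> complex" where
  "conj_form a = (\<lambda>v. cnj (a v))"

definition wedge :: "('v \<Rightarrow> complex) \<Rightarrow> ('v \<Rightarrow> complex) \<Rightarrow> 'v \<Rightarrow> 'v \<Rightarrow> complex" where
  "wedge a b = (\<lambda>u v. a u * b v - a v * b u)"

definition is_complex_structure :: "('v::real_vector \<Rightarrow> 'v) \<Rightarrow> bool" where
  "is_complex_structure J \<longleftrightarrow> linear J \<and> (\<forall>v. J (J v) = - v)"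

text \<open>A Kaehler form is a closed, real, positive form of type \<open>(1,1)\<close>. Translation-invariant
  forms are automatically closed; the \<open>J\<close>-invariance is type \<open>(1,1)\<close>, and the sign convention
  for positivity makes \<open>\<i> dw \<and> d(cnj w)\<close> a Kaehler form.\<close>

definition is_invariant_kaehler_form ::
    "('v::real_vector \<Rightarrow> 'v) \<Rightarrow> ('v \<Rightarrow> 'v \<Rightarrow> complex) \<Rightarrow> bool" where
  "is_invariant_kaehler_form J \<Omega> \<longleftrightarrow>
     is_complex_structure J \<and>
     (\<forall>v. linear (\<lambda>u. \<Omega> u v)) \<and> (\<forall>u v. \<Omega> u v = - \<Omega> v u) \<and>
     (\<forall>u v. \<Omega> u v \<in> \<real>) \<and>
     (\<forall>u v. \<Omega> (J u) (J v) = \<Omega> u v) \<and>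
     (\<forall>v. v \<noteq> 0 \<longrightarrow> Re (\<Omega> v (J v)) > 0)"

definition is_lattice :: "'v::real_vector set \<Rightarrow> bool" where
  "is_lattice \<Lambda> \<longleftrightarrow> (\<exists>B. finite B \<and> independent B \<and> span B = UNIV \<and>
     \<Lambda> = range (\<lambda>n :: 'v \<Rightarrow> int. \<Sum>b\<in>B. of_int (n b) *\<^sub>R b))"

text \<open>A polarization of the complex torus \<open>(V, J)/\<Lambda>\<close> is a positive definite Hermitian form on
  \<open>(V, J)\<close>, linear in the first argument, with imaginary part integral on \<open>\<Lambda>\<close>; an abelian variety
  is a complex torus that admits a polarization.\<close>

definition is_polarization ::
    "('v::real_vector \<Rightarrow> 'v) \<Rightarrow> 'v set \<Rightarrow> ('v \<Rightarrow> 'v \<Rightarrow> complex) \<Rightarrow> bool" where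
  "is_polarization J \<Lambda> H \<longleftrightarrow>
     (\<forall>v. linear (\<lambda>u. H u v)) \<and> (\<forall>u v. H (J u) v = \<i> * H u v) \<and>
     (\<forall>u v. H v u = cnj (H u v)) \<and>
     (\<forall>v. v \<noteq> 0 \<longrightarrow> Re (H v v) > 0) \<and>
     (\<forall>a\<in>\<Lambda>. \<forall>b\<in>\<Lambda>. Im (H a b) \<in> \<int>)"

definition is_abelian_variety :: "('v::real_vector \<Rightarrow> 'v) \<Rightarrow> 'v set \<Rightarrow> bool" where
  "is_abelian_variety J \<Lambda> \<longleftrightarrow>
     is_complex_structure J \<and> is_lattice \<Lambda> \<and> (\<exists>H. is_polarization J \<Lambda> H)"


section \<open>Quantities attached to the roots\<close>

text \<open>The roots and the coordinate functions are families over \<open>nat\<close> of which only the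
  indices 1, 2, 3, 4 are used.\<close>

definition disc_sqrt :: "(nat \<Rightarrow> real) \<Rightarrow> real" where
  "disc_sqrt x = (\<Prod>i\<in>{1..4}. \<Prod>j\<in>{i<..4}. x i - x j)"

definition disc :: "(nat \<Rightarrow> real) \<Rightarrow> real" where
  "disc x = (disc_sqrt x)\<^sup>2"

definition octic_field :: "(nat \<Rightarrow> real) \<Rightarrow> complex set" where
  "octic_field x = rat_adjoin {of_real (x 1), \<i> * of_real (disc_sqrt x)}"

definition mu :: "(nat \<Rightarrow> real) \<Rightarrow> nat \<Rightarrow> real" where
  "mu x j = (\<Prod>k\<in>{1..4} - {j}. x j - x k)"

definition omega_form ::
    "(nat \<Rightarrow> real) \<Rightarrow> (nat \<Rightarrow> 'v \<Rightarrow> complex) \<Rightarrow> 'v \<Rightarrow> 'v \<Rightarrow> complex" where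
  "omega_form x z = (\<lambda>u v. \<i> * of_real (disc_sqrt x) / of_real (disc x) *
     (\<Sum>j\<in>{1..4}. (- 1) ^ (j + 1) * of_real (mu x j) * wedge (z j) (conj_form (z j)) u v))"

definition h2 :: "(nat \<Rightarrow> real) \<Rightarrow> real" where "h2 x = x 1 * x 2 + x 3 * x 4"
definition h3 :: "(nat \<Rightarrow> real) \<Rightarrow> real" where "h3 x = x 1 * x 3 + x 2 * x 4"
definition h4 :: "(nat \<Rightarrow> real) \<Rightarrow> real" where "h4 x = x 1 * x 4 + x 2 * x 3"

text \<open>\<open>hh x i j\<close> is \<open>h\<^sub>i\<^sub>j\<close>, to be used for \<open>1 \<le> i < j \<le> 4\<close> only.\<close>

definition hh :: "(nat \<Rightarrow> real) \<Rightarrow> nat \<Rightarrow> nat \<Rightarrow> real" where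
  "hh x i j = (if (i, j) \<in> {(1, 2), (3, 4)} then h2 x
               else if (i, j) \<in> {(1, 3), (2, 4)} then h3 x else h4 x)"

definition e_form :: "(nat \<Rightarrow> 'v \<Rightarrow> complex) \<Rightarrow> nat \<Rightarrow> 'v \<Rightarrow> complex" where
  "e_form z j = (if odd j then z j else conj_form (z j))"

definition A_plus ::
    "(nat \<Rightarrow> real) \<Rightarrow> (nat \<Rightarrow> 'v \<Rightarrow> complex) \<Rightarrow> 'v \<Rightarrow> 'v \<Rightarrow> complex" where
  "A_plus x z = (\<lambda>u v. \<Sum>i\<in>{1..4}. \<Sum>j\<in>{i<..4}.
     of_real (hh x i j * (x i - x j)) * wedge (e_form z i) (e_form z j) u v)"

definition A_1 ::
    "(nat \<Rightarrow> real) \<Rightarrow> (nat \<Rightarrow> 'v \<Rightarrow> complex) \<Rightarrow> 'v \<Rightarrow> 'v \<Rightarrow> complex" where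
  "A_1 x z = (\<lambda>u v. A_plus x z u v + cnj (A_plus x z u v))"

definition A_2 ::
    "int \<Rightarrow> (nat \<Rightarrow> real) \<Rightarrow> (nat \<Rightarrow> 'v \<Rightarrow> complex) \<Rightarrow> 'v \<Rightarrow> 'v \<Rightarrow> complex" where
  "A_2 c x z = (\<lambda>u v. \<i> * of_int c * of_real (disc_sqrt x) *
     (A_plus x z u v - cnj (A_plus x z u v)))"


section \<open>The coordinates \<open>w\<close>\<close>

definition hat_matrix :: "complex^2^2 \<Rightarrow> complex^2^2" where
  "hat_matrix A = vector [vector [A $ 2 $ 2, - A $ 1 $ 2], vector [- A $ 2 $ 1, A $ 1 $ 1]]"

definition alpha_star :: "(nat \<Rightarrow> real) \<Rightarrow> complex^2^2" where
  "alpha_star x = (1 / (x 1 - x 3)) *\<^sub>R vector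
     [vector [of_real ((x 2 - x 3) * (1 - 2 * h4 x / h3 x)),
              of_real (- (x 3 - x 4) * (1 - 2 * h2 x / h3 x))],
      vector [of_real ((x 1 - x 2) * (1 - 2 * h2 x / h3 x)),
              of_real ((x 1 - x 4) * (1 - 2 * h4 x / h3 x))]]"

definition alpha_tilde :: "(nat \<Rightarrow> real) \<Rightarrow> complex^2^2" where
  "alpha_tilde x = ((x 1 - x 3) / (x 2 - x 4)) *\<^sub>R hat_matrix (map_matrix cnj (alpha_star x))"

definition w_relation ::
    "(nat \<Rightarrow> real) \<Rightarrow> (nat \<Rightarrow> 'v \<Rightarrow> complex) \<Rightarrow> (nat \<Rightarrow> 'v \<Rightarrow> complex) \<Rightarrow> bool" where
  "w_relation x z w \<longleftrightarrow> (\<forall>v.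
     (vector [z 1 v, z 3 v] :: complex^2) =
       vector [w 1 v, w 3 v] + map_matrix cnj (alpha_star x) *v vector [cnj (w 2 v), cnj (w 4 v)] \<and>
     (vector [z 2 v, z 4 v] :: complex^2) =
       vector [w 2 v, w 4 v] + map_matrix cnj (alpha_tilde x) *v vector [cnj (w 1 v), cnj (w 3 v)])"

text \<open>\<open>dwdwbar w i j\<close> is \<open>dw\<^sub>i \<and> d(cnj w\<^sub>j)\<close> and \<open>dwbardw w i j\<close> is \<open>d(cnj w\<^sub>i) \<and> dw\<^sub>j\<close>.\<close>

definition dwdwbar :: "(nat \<Rightarrow> 'v \<Rightarrow> complex) \<Rightarrow> nat \<Rightarrow> nat \<Rightarrow> 'v \<Rightarrow> 'v \<Rightarrow> complex" where
  "dwdwbar w i j = wedge (w i) (conj_form (w j))"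

definition dwbardw :: "(nat \<Rightarrow> 'v \<Rightarrow> complex) \<Rightarrow> nat \<Rightarrow> nat \<Rightarrow> 'v \<Rightarrow> 'v \<Rightarrow> complex" where
  "dwbardw w i j = wedge (conj_form (w i)) (w j)"

end

theory Submission
  imports Defs "Jordan_Normal_Form.Char_Poly"
begin

text \<open>Write \<open>e\<^sub>j\<close> for \<open>dz\<^sub>j\<close> or its conjugate, according to the parity of \<open>j\<close>, and \<open>f\<^sub>j\<close> for the same
  form built from \<open>w\<close>. Conjugating half of the equations that define \<open>w\<close> turns them into a
  complex-linear change of basis \<open>e = (1 + T) f\<close>, where \<open>T\<close> has real entries and only links indices of
  different parity. All eight entries of \<open>T\<close> are one function \<open>\<tau>\<close> of the roots, taken in different orders.

  \<^item> \<open>T\<^sup>2\<close> is a scalar \<open>1 - \<delta>\<close>, and \<open>h\<^sub>3\<^sup>2 \<delta> = - 4 x\<^sub>1\<^sub>2 x\<^sub>3\<^sub>4 x\<^sub>1\<^sub>4 x\<^sub>2\<^sub>3\<close>. Hence \<open>1 + T\<close> has the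
    inverse \<open>(1 - T) / \<delta>\<close>, so that \<open>w\<close> exists and is unique, provided that \<open>h\<^sub>3 \<noteq> 0\<close>. This is where the
    Galois group enters: an automorphism that exchanges \<open>x\<^sub>3\<close> and \<open>x\<^sub>4\<close> would carry \<open>h\<^sub>3 = 0\<close> to
    \<open>h\<^sub>4 = 0\<close>, while \<open>h\<^sub>3 - h\<^sub>4 = x\<^sub>1\<^sub>2 x\<^sub>3\<^sub>4\<close>.

  \<^item> \<open>A\<^sub>+\<close> is an alternating form in the \<open>e\<^sub>j\<close>, and \<open>\<omega>\<close> is up to a constant the Hermitian form
    \<open>\<Sum>\<mu>\<^sub>j e\<^sub>j \<and> cnj e\<^sub>j\<close>. The displayed formulas are the congruences of these two forms by \<open>1 + T\<close>;
    since \<open>\<tau>\<close> is compatible with relabelling the roots, only five coefficients have to be computed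
    (\<open>mixed_coefficient\<close>, \<open>equal_parity_coefficient\<close>, \<open>hermitian_diag\<close>, \<open>hermitian_equal_parity\<close>,
    \<open>hermitian_mixed\<close>). The formulas for \<open>A\<^sub>1\<close> and \<open>A\<^sub>2\<close> are the sum and the difference
    of the one for \<open>A\<^sub>+\<close> and its conjugate.

  In the coordinates \<open>w\<close> the form \<open>- \<omega>\<close> is diagonal with positive coefficients, which makes it a Kaehler
  form for the complex structure given by multiplication by \<open>\<i>\<close>. The \<open>w\<close> are coordinates on \<open>V\<close>
  because the \<open>z\<close> are: the values at the four roots of a real cubic polynomial determine it and are
  arbitrary, once for the real parts and once for the imaginary parts of the \<open>z\<^sub>j\<close>.

  For the polarization it remains to see that a multiple of \<open>\<omega>\<close> is integral on the image of the ring of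
  integers. On the field \<open>F\<close> the form \<open>\<omega>\<close> is a trace, hence rational: it is a sum over the roots
  of a rational polynomial (\<open>omega_rational\<close>). After multiplication by a fixed integer it
  takes algebraic integers to algebraic integers (\<open>omega_integral\<close>). The same
  computation shows that the ring of integers gives a lattice: pairing with
  an integral basis of \<open>F\<close> yields integer-valued functionals without common zero, and a subgroup with such
  functionals has a basis (\<open>subgroup_basis_exists\<close>).\<close>

section \<open>Sums and products of algebraic integers\<close>

definition int_span :: "complex set \<Rightarrow> complex set" where
  "int_span B = range (\<lambda>c :: complex \<Rightarrow> int. \<Sum>b\<in>B. of_int (c b) * b)"

lemma int_span_add: "u \<in> int_span B \<Longrightarrow> v \<in> int_span B \<Longrightarrow> u + v \<in> int_span B"
proof -
  assume "u \<in> int_span B" "v \<in> int_span B"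
  then obtain c d where "u = (\<Sum>b\<in>B. of_int (c b) * b)" "v = (\<Sum>b\<in>B. of_int (d b) * b)"
    by (auto simp: int_span_def)
  then have "u + v = (\<Sum>b\<in>B. of_int (c b + d b) * b)"
    by (simp add: sum.distrib algebra_simps)
  then show ?thesis unfolding int_span_def by (intro range_eqI[where x = "\<lambda>b. c b + d b"])
qed

lemma int_span_scale: "u \<in> int_span B \<Longrightarrow> of_int k * u \<in> int_span B"
proof -
  assume "u \<in> int_span B"
  then obtain c where "u = (\<Sum>b\<in>B. of_int (c b) * b)"
    by (auto simp: int_span_def)
  then have "of_int k * u = (\<Sum>b\<in>B. of_int (k * c b) * b)"
    by (simp add: sum_distrib_left algebra_simps)
  then show ?thesis unfolding int_span_def by (intro range_eqI[where x = "\<lambda>b. k * c b"])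
qed

lemma int_span_0: "0 \<in> int_span B"
  unfolding int_span_def by (rule image_eqI[where x = "\<lambda>_. 0"]) auto

lemma int_span_sum: "(\<And>i. i \<in> I \<Longrightarrow> f i \<in> int_span B) \<Longrightarrow> (\<Sum>i\<in>I. f i) \<in> int_span B"
  by (induction I rule: infinite_finite_induct) (auto intro: int_span_add int_span_0)

lemma int_span_incl:
  assumes "finite B" "b \<in> B"
  shows "b \<in> int_span B"
proof -
  have "b = (\<Sum>b'\<in>B. of_int (if b' = b then 1 else 0) * b')"
    using assms by (simp add: if_distrib if_distribR cong: if_cong)
  then show ?thesis unfolding int_span_def
    by (intro range_eqI[where x = "\<lambda>b'. if b' = b then 1 else 0"])
qed

text \<open>Expanding the products \<open>a * b\<close> with \<open>b \<in> B\<close> in \<open>B\<close> gives an integer matrix that has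
  the vector of the elements of \<open>B\<close> as an eigenvector for the eigenvalue \<open>a\<close>; its characteristic
  polynomial is monic with integer coefficients.\<close>
lemma algebraic_int_if_stable_int_span:
  fixes a :: complex
  assumes "finite B" "\<exists>b\<in>B. b \<noteq> 0" and stable: "\<And>b. b \<in> B \<Longrightarrow> a * b \<in> int_span B"
  shows "algebraic_int a"
proof -
  obtain bs where bs: "set bs = B" "distinct bs"
    using finite_distinct_list[OF assms(1)] by blast
  define n where "n = length bs"
  have "\<forall>b\<in>B. \<exists>c. a * b = (\<Sum>b'\<in>B. of_int (c b') * b')"
    using stable by (auto simp: int_span_def)
  from bchoice[OF this] obtain c where c: "\<And>b. b \<in> B \<Longrightarrow> a * b = (\<Sum>b'\<in>B. of_int (c b b') * b')"
    by blast
  define A where "A = Matrix.mat n n (\<lambda>(i, j). c (bs ! i) (bs ! j))"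
  have A: "A \<in> carrier_mat n n" by (simp add: A_def)
  let ?A = "map_mat (of_int :: int \<Rightarrow> complex) A"
  have A': "?A \<in> carrier_mat n n" using A by simp
  define v where "v = Matrix.vec n (\<lambda>i. bs ! i)"
  have sum_bs: "(\<Sum>b'\<in>B. f b') = (\<Sum>j<n. f (bs ! j))" for f :: "complex \<Rightarrow> complex"
    by (rule sum.reindex_bij_betw[symmetric], rule bij_betw_nth) (auto simp: bs n_def)
  have "?A *\<^sub>v v = a \<cdot>\<^sub>v v"
  proof (rule eq_vecI)
    fix i assume i: "i < dim_vec (a \<cdot>\<^sub>v v)"
    then have i': "i < n" by (simp add: v_def)
    then have "bs ! i \<in> B" using bs by (auto simp: n_def)
    have "vec_index (?A *\<^sub>v v) i = (\<Sum>j = 0..<n. of_int (c (bs ! i) (bs ! j)) * bs ! j)"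
      using i' A by (simp add: A_def v_def scalar_prod_def)
    also have "\<dots> = a * bs ! i"
      by (simp add: c[OF \<open>bs ! i \<in> B\<close>] sum_bs lessThan_atLeast0)
    finally show "vec_index (?A *\<^sub>v v) i = vec_index (a \<cdot>\<^sub>v v) i" using i' by (simp add: v_def)
  qed (use A in \<open>auto simp: v_def\<close>)
  moreover have "v \<noteq> 0\<^sub>v n"
  proof -
    obtain i where "i < n" "bs ! i \<noteq> 0" using assms(2) bs by (metis n_def in_set_conv_nth)
    then have "vec_index v i \<noteq> vec_index (0\<^sub>v n) i" by (simp add: v_def)
    then show ?thesis by metis
  qed
  ultimately have "eigenvalue ?A a"
    unfolding eigenvalue_def eigenvector_def using A by (intro exI[of _ v]) (auto simp: v_def)
  then have "poly (char_poly ?A) a = 0"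
    using eigenvalue_root_char_poly[OF A'] by simp
  then have "poly (map_poly of_int (char_poly A)) a = 0"
    by (simp add: of_int_hom.char_poly_hom[OF A])
  moreover have "Polynomial.lead_coeff (char_poly A) = 1"
    using degree_monic_char_poly[OF A] by (auto)
  ultimately show ?thesis by (auto simp: algebraic_int_altdef_ipoly)
qed

lemma algebraic_int_power_reduction:
  fixes a :: complex
  assumes "algebraic_int a"
  obtains n and c :: "nat \<Rightarrow> int" where "n > 0" "a ^ n = (\<Sum>i<n. of_int (c i) * a ^ i)"
proof -
  from assms obtain p where p: "poly (map_poly of_int p) a = 0" "Polynomial.lead_coeff p = 1"
    by (auto simp: algebraic_int_altdef_ipoly)
  have deg: "Polynomial.degree p > 0"
  proof (rule Nat.gr0I)
    assume "Polynomial.degree p = 0"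
    then obtain k where "p = [:k:]" by (rule degree_eq_zeroE)
    with p show False by (simp add: map_poly_pCons)
  qed
  define S where "S = (\<Sum>i<Polynomial.degree p. of_int (Polynomial.coeff p i) * a ^ i)"
  have "0 = (\<Sum>i<Suc (Polynomial.degree p). of_int (Polynomial.coeff p i) * a ^ i)"
    using p(1) unfolding lessThan_Suc_atMost by (simp add: poly_altdef degree_map_poly coeff_map_poly)
  also have "\<dots> = S + a ^ Polynomial.degree p"
    by (simp only: sum.lessThan_Suc S_def p(2) of_int_1 mult_1_left)
  finally have 1: "S + a ^ Polynomial.degree p = 0" ..
  have "a ^ Polynomial.degree p = - S"
    by (rule minus_unique[OF 1, symmetric])
  also have "\<dots> = (\<Sum>i<Polynomial.degree p. of_int (- Polynomial.coeff p i) * a ^ i)"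
    by (simp only: S_def sum_negf of_int_minus mult_minus_left)
  finally have eq: "a ^ Polynomial.degree p =
      (\<Sum>i<Polynomial.degree p. of_int (- Polynomial.coeff p i) * a ^ i)" .
  show ?thesis by (rule that[OF deg eq])
qed

lemma int_span_stable:
  assumes "\<And>b. b \<in> B \<Longrightarrow> a * b \<in> int_span B" "u \<in> int_span B"
  shows "a * u \<in> int_span B"
proof -
  from assms(2) obtain c where u: "u = (\<Sum>b\<in>B. of_int (c b) * b)" by (auto simp: int_span_def)
  have "a * u = (\<Sum>b\<in>B. of_int (c b) * (a * b))" by (simp add: u sum_distrib_left algebra_simps)
  also have "\<dots> \<in> int_span B" by (intro int_span_sum int_span_scale assms)
  finally show ?thesis .
qed

text \<open>The products \<open>a\<^sup>i b\<^sup>j\<close> with exponents below the degrees of \<open>a\<close> and \<open>b\<close> serve as generators.\<close>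
lemma common_stable_int_span:
  fixes a b :: complex
  assumes "algebraic_int a" "algebraic_int b"
  obtains B where "finite B" "1 \<in> B"
    "\<And>u. u \<in> B \<Longrightarrow> a * u \<in> int_span B" "\<And>u. u \<in> B \<Longrightarrow> b * u \<in> int_span B"
proof -
  obtain n c where n: "n > 0" "a ^ n = (\<Sum>i<n. of_int (c i) * a ^ i)"
    using algebraic_int_power_reduction[OF assms(1)] .
  obtain m d where m: "m > 0" "b ^ m = (\<Sum>i<m. of_int (d i) * b ^ i)"
    using algebraic_int_power_reduction[OF assms(2)] .
  define B where "B = (\<lambda>(i, j). a ^ i * b ^ j) ` ({..<n} \<times> {..<m})"
  have fin: "finite B" by (simp add: B_def)
  have mem: "a ^ i * b ^ j \<in> int_span B" if "i < n" "j < m" for i j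
    using that by (intro int_span_incl[OF fin]) (auto simp: B_def)
  have "1 \<in> B" using n m unfolding B_def by (intro image_eqI[of _ _ "(0, 0)"]) auto
  moreover have "a * u \<in> int_span B" if u: "u \<in> B" for u
  proof -
    from u obtain i j where ij: "i < n" "j < m" "u = a ^ i * b ^ j" by (auto simp: B_def)
    show ?thesis
    proof (cases "Suc i < n")
      case True
      then show ?thesis using mem[OF True ij(2)] ij by (simp add: mult_ac)
    next
      case False
      then have "Suc i = n" using ij by simp
      then have "a * u = (\<Sum>k<n. of_int (c k) * a ^ k) * b ^ j"
        by (simp add: ij(3) flip: n(2)) (simp flip: \<open>Suc i = n\<close>)
      also have "\<dots> = (\<Sum>k<n. of_int (c k) * (a ^ k * b ^ j))"
        by (simp add: sum_distrib_right mult.assoc)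
      also have "\<dots> \<in> int_span B" using ij by (intro int_span_sum int_span_scale mem) auto
      finally show ?thesis .
    qed
  qed
  moreover have "b * u \<in> int_span B" if u: "u \<in> B" for u
  proof -
    from u obtain i j where ij: "i < n" "j < m" "u = a ^ i * b ^ j" by (auto simp: B_def)
    show ?thesis
    proof (cases "Suc j < m")
      case True
      then show ?thesis using mem[OF ij(1) True] ij by (simp add: mult_ac)
    next
      case False
      then have "Suc j = m" using ij by simp
      then have "b * u = a ^ i * (\<Sum>k<m. of_int (d k) * b ^ k)"
        by (simp add: ij(3) flip: m(2)) (simp flip: \<open>Suc j = m\<close>)
      also have "\<dots> = (\<Sum>k<m. of_int (d k) * (a ^ i * b ^ k))"
        by (simp add: sum_distrib_left mult_ac)
      also have "\<dots> \<in> int_span B" using ij by (intro int_span_sum int_span_scale mem) auto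
      finally show ?thesis .
    qed
  qed
  ultimately show ?thesis using that fin by blast
qed

lemma algebraic_int_add:
  fixes a b :: complex
  assumes "algebraic_int a" "algebraic_int b"
  shows "algebraic_int (a + b)"
proof -
  obtain B where B: "finite B" "1 \<in> B"
    "\<And>u. u \<in> B \<Longrightarrow> a * u \<in> int_span B" "\<And>u. u \<in> B \<Longrightarrow> b * u \<in> int_span B"
    using common_stable_int_span[OF assms] by blast
  show ?thesis
    by (rule algebraic_int_if_stable_int_span[OF B(1)])
       (use B in \<open>auto simp: distrib_right intro: int_span_add\<close>)
qed

lemma algebraic_int_mult:
  fixes a b :: complex
  assumes "algebraic_int a" "algebraic_int b"
  shows "algebraic_int (a * b)"
proof -
  obtain B where B: "finite B" "1 \<in> B"
    "\<And>u. u \<in> B \<Longrightarrow> a * u \<in> int_span B" "\<And>u. u \<in> B \<Longrightarrow> b * u \<in> int_span B"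
    using common_stable_int_span[OF assms] by blast
  show ?thesis
    by (rule algebraic_int_if_stable_int_span[OF B(1)])
       (use B in \<open>auto simp: mult.assoc intro: int_span_stable\<close>)
qed

lemma algebraic_int_diff:
  fixes a b :: complex
  shows "algebraic_int a \<Longrightarrow> algebraic_int b \<Longrightarrow> algebraic_int (a - b)"
  using algebraic_int_add[of a "- b"] by simp

lemma algebraic_int_power:
  fixes a :: complex
  shows "algebraic_int a \<Longrightarrow> algebraic_int (a ^ n)"
  by (induction n) (auto intro: algebraic_int_mult int_imp_algebraic_int)

lemma algebraic_int_sum:
  fixes f :: "'i \<Rightarrow> complex"
  shows "(\<And>i. i \<in> I \<Longrightarrow> algebraic_int (f i)) \<Longrightarrow> algebraic_int (\<Sum>i\<in>I. f i)"
  by (induction I rule: infinite_finite_induct) (auto intro: algebraic_int_add)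

lemma algebraic_int_prod:
  fixes f :: "'i \<Rightarrow> complex"
  shows "(\<And>i. i \<in> I \<Longrightarrow> algebraic_int (f i)) \<Longrightarrow> algebraic_int (\<Prod>i\<in>I. f i)"
  by (induction I rule: infinite_finite_induct)
     (auto intro: algebraic_int_mult int_imp_algebraic_int)


section \<open>Lattices from integer-valued functionals\<close>

lemma int_subgroup_cyclic:
  fixes S :: "int set"
  assumes "0 \<in> S" and diff: "\<And>a b. a \<in> S \<Longrightarrow> b \<in> S \<Longrightarrow> a - b \<in> S"
  obtains d where "d \<in> S" "\<And>a. a \<in> S \<Longrightarrow> d dvd a"
proof (cases "S = {0}")
  case True
  then show ?thesis using that[of 0] by auto
next
  case False
  with assms(1) obtain a where a: "a \<in> S" "a \<noteq> 0" by auto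
  have neg: "- b \<in> S" if "b \<in> S" for b using diff[OF assms(1) that] by simp
  have mult: "of_nat n * b \<in> S" if "b \<in> S" for n b
  proof (induction n)
    case (Suc n)
    then show ?case using diff[OF Suc neg[OF that]] by (simp add: algebra_simps)
  qed (use assms in auto)
  have mult': "k * b \<in> S" if "b \<in> S" for k b
    using mult[OF that, of "nat k"] mult[OF neg[OF that], of "nat (- k)"]
    by (cases "k \<ge> 0") auto
  define P where "P n \<longleftrightarrow> n > 0 \<and> int n \<in> S" for n
  have "P (nat \<bar>a\<bar>)" using a neg by (auto simp: P_def abs_if)
  then have P: "P (Least P)" and least: "\<And>n. P n \<Longrightarrow> Least P \<le> n" by (auto intro: LeastI Least_le)
  define d where "d = int (Least P)"
  have d: "d \<in> S" "d > 0" using P by (auto simp: P_def d_def)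
  have "d dvd b" if "b \<in> S" for b
  proof (rule ccontr)
    assume "\<not> d dvd b"
    then have "b mod d > 0" using d by (simp add: dvd_eq_mod_eq_0 order_less_le)
    have "b mod d = b - (b div d) * d" by (simp add: minus_div_mult_eq_mod)
    then have "b mod d \<in> S" using diff[OF that mult'[OF d(1)]] by simp
    then have "P (nat (b mod d))" using \<open>b mod d > 0\<close> by (simp add: P_def)
    then have "d \<le> b mod d" using least \<open>b mod d > 0\<close> by (force simp: d_def)
    then show False using d(2) by (metis not_less pos_mod_bound)
  qed
  then show ?thesis using that d by blast
qed

definition subgroup_basis :: "'v::real_vector set \<Rightarrow> 'v set \<Rightarrow> bool" where
  "subgroup_basis B G \<longleftrightarrow> finite B \<and> independent B \<and>
     G = range (\<lambda>n :: 'v \<Rightarrow> int. \<Sum>b\<in>B. of_int (n b) *\<^sub>R b)"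

text \<open>Induction on the number of functionals. The values of the last one on \<open>G\<close> form a group
  \<open>d \<int>\<close>, and any \<open>g \<in> G\<close> with value \<open>d\<close> completes a basis of the kernel: the last functional
  vanishes on the real span of the kernel but not at \<open>g\<close>, which gives independence over the reals.
  Injectivity is demanded on \<open>span G\<close> only, so that it passes to the kernel with one functional fewer.\<close>
lemma subgroup_basis_exists:
  fixes G :: "'v::real_vector set" and f :: "nat \<Rightarrow> 'v \<Rightarrow> real"
  assumes "0 \<in> G" "\<And>a b. a \<in> G \<Longrightarrow> b \<in> G \<Longrightarrow> a - b \<in> G"
    and "\<And>k. k < m \<Longrightarrow> linear (f k)" "\<And>k a. k < m \<Longrightarrow> a \<in> G \<Longrightarrow> f k a \<in> \<int>"
    and "\<And>v. v \<in> span G \<Longrightarrow> (\<And>k. k < m \<Longrightarrow> f k v = 0) \<Longrightarrow> v = 0"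
  shows "\<exists>B. subgroup_basis B G"
  using assms
proof (induction m arbitrary: G)
  case 0
  then have "x = 0" if "x \<in> G" for x
    using span_base[OF that] by simp
  with 0(1) have "G = {0}" by auto
  then have "subgroup_basis {} G" by (auto simp: subgroup_basis_def real_vector.dependent_def)
  then show ?case by blast
next
  case (Suc m)
  have lin: "linear (f m)" using Suc.prems(3) by simp
  define G' where "G' = {a \<in> G. f m a = 0}"
  have vanish: "f m v = 0" if "v \<in> span G'" for v
    using linear_eq_0_on_span[OF lin _ that] by (auto simp: G'_def)
  have "\<exists>B. subgroup_basis B G'"
  proof (rule Suc.IH)
    show "0 \<in> G'" using Suc.prems(1) lin by (simp add: G'_def linear_0)
    show "a - b \<in> G'" if "a \<in> G'" "b \<in> G'" for a b
      using that Suc.prems(2) lin by (simp add: G'_def linear_diff)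
    show "v = 0" if v: "v \<in> span G'" "\<And>k. k < m \<Longrightarrow> f k v = 0" for v
    proof (rule Suc.prems(5))
      show "v \<in> span G" using v(1) span_mono[of G' G] by (auto simp: G'_def)
      show "f k v = 0" if "k < Suc m" for k
        using that v(2) vanish[OF v(1)] by (auto simp: less_Suc_eq)
    qed
  qed (use Suc.prems in \<open>auto simp: G'_def\<close>)
  then obtain B where fin: "finite B" and ind: "independent B"
    and B: "G' = range (\<lambda>n :: 'v \<Rightarrow> int. \<Sum>b\<in>B. of_int (n b) *\<^sub>R b)"
    by (auto simp: subgroup_basis_def)
  have B_sub: "B \<subseteq> G'"
  proof
    fix b assume b: "b \<in> B"
    have "b = (\<Sum>b'\<in>B. of_int (if b' = b then 1 else 0) *\<^sub>R b')"
      using fin b by (simp add: if_distrib if_distribR cong: if_cong)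
    then show "b \<in> G'" unfolding B by (intro range_eqI[where x = "\<lambda>b'. if b' = b then 1 else 0"])
  qed
  let ?S = "{k :: int. \<exists>a\<in>G. f m a = of_int k}"
  have "0 \<in> ?S" using Suc.prems(1) lin by (auto simp: linear_0 intro!: bexI[of _ 0])
  moreover have "j - k \<in> ?S" if "j \<in> ?S" "k \<in> ?S" for j k
  proof -
    from that obtain a b where "a \<in> G" "f m a = of_int j" "b \<in> G" "f m b = of_int k" by auto
    then show ?thesis using Suc.prems(2)[of a b] lin
      by (auto simp: linear_diff intro!: bexI[of _ "a - b"])
  qed
  ultimately obtain d where d: "d \<in> ?S" "\<And>k. k \<in> ?S \<Longrightarrow> d dvd k"
    using int_subgroup_cyclic[of ?S] by blast
  then obtain g where g: "g \<in> G" "f m g = of_int d" by auto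
  have divisible: "\<exists>k. f m a = of_int (k * d)" if "a \<in> G" for a
  proof -
    obtain j where "f m a = of_int j" using Suc.prems(4)[OF lessI \<open>a \<in> G\<close>] by (auto elim: Ints_cases)
    with that d(2)[of j] have "d dvd j" by blast
    then have "j = (j div d) * d" by simp
    with \<open>f m a = of_int j\<close> show ?thesis by metis
  qed
  show ?case
  proof (cases "d = 0")
    case True
    then have "G' = G" using divisible by (fastforce simp: G'_def)
    then show ?thesis using fin ind B by (auto simp: subgroup_basis_def)
  next
    case False
    then have "g \<notin> span B"
      using vanish span_mono[OF B_sub] g(2) by fastforce
    have g_B: "g \<notin> B" using \<open>g \<notin> span B\<close> span_base by blast
    have mult: "of_int k *\<^sub>R g \<in> G" for k
    proof -
      have neg: "- a \<in> G" if "a \<in> G" for a using Suc.prems(2)[OF Suc.prems(1) that] by simp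
      have add: "a + b \<in> G" if "a \<in> G" "b \<in> G" for a b using
          Suc.prems(2)[OF that(1) neg[OF that(2)]] by simp
      have nat: "of_nat n *\<^sub>R g \<in> G" for n
        by (induction n) (use Suc.prems(1) g(1) in \<open>auto simp: scaleR_add_left intro: add\<close>)
      show ?thesis using nat[of "nat k"] neg[OF nat[of "nat (- k)"]] by (cases "k \<ge> 0") auto
    qed
    have "G = range (\<lambda>n :: 'v \<Rightarrow> int. \<Sum>b\<in>insert g B. of_int (n b) *\<^sub>R b)" (is "_ = range ?L")
    proof
      show "G \<subseteq> range ?L"
      proof
        fix a assume a: "a \<in> G"
        then obtain k where k: "f m a = of_int (k * d)" using divisible by blast
        have "a - of_int k *\<^sub>R g \<in> G'"
          using Suc.prems(2)[OF a mult[of k]] lin k g by (simp add: G'_def linear_diff linear_scale)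
        then obtain n :: "'v \<Rightarrow> int" where n: "a - of_int k *\<^sub>R g = (\<Sum>b\<in>B. of_int (n b) *\<^sub>R b)"
          unfolding B by blast
        have "(\<Sum>b\<in>B. of_int (n b) *\<^sub>R b) = (\<Sum>b\<in>B. of_int ((n(g := k)) b) *\<^sub>R b)"
          using g_B by (intro sum.cong) auto
        then have "a = ?L (n(g := k))"
          using n g_B fin by (simp add: algebra_simps)
        then show "a \<in> range ?L" by (intro range_eqI[where x = "n(g := k)"])
      qed
      show "range ?L \<subseteq> G"
      proof
        fix a assume "a \<in> range ?L"
        then obtain n :: "'v \<Rightarrow> int" where n: "a = of_int (n g) *\<^sub>R g + (\<Sum>b\<in>B. of_int (n b) *\<^sub>R b)"
          using fin g_B by auto
        have "(\<Sum>b\<in>B. of_int (n b) *\<^sub>R b) \<in> G'" unfolding B by blast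
        then have *: "(\<Sum>b\<in>B. of_int (n b) *\<^sub>R b) \<in> G" by (simp add: G'_def)
        have "- of_int (n g) *\<^sub>R g \<in> G" using mult[of "- n g"] by simp
        from Suc.prems(2)[OF * this] show "a \<in> G" by (simp add: n add.commute)
      qed
    qed
    moreover have "independent (insert g B)" using ind \<open>g \<notin> span B\<close> by (simp add: independent_insertI)
    ultimately show ?thesis using fin by (auto simp: subgroup_basis_def)
  qed
qed

lemma is_lattice_if_integer_functionals:
  fixes G :: "'v::real_vector set" and f :: "nat \<Rightarrow> 'v \<Rightarrow> real"
  assumes "0 \<in> G" "\<And>a b. a \<in> G \<Longrightarrow> b \<in> G \<Longrightarrow> a - b \<in> G" and span: "span G = UNIV"
    and "\<And>k. k < m \<Longrightarrow> linear (f k)" "\<And>k a. k < m \<Longrightarrow> a \<in> G \<Longrightarrow> f k a \<in> \<int>"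
    and "\<And>v. (\<And>k. k < m \<Longrightarrow> f k v = 0) \<Longrightarrow> v = 0"
  shows "is_lattice G"
proof -
  have "\<exists>B. subgroup_basis B G"
    by (rule subgroup_basis_exists[of G m f]) (use assms in auto)
  then obtain B where B: "finite B" "independent B"
      "G = range (\<lambda>n :: 'v \<Rightarrow> int. \<Sum>b\<in>B. of_int (n b) *\<^sub>R b)"
    by (auto simp: subgroup_basis_def)
  have "G \<subseteq> span B" unfolding B(3) by (auto intro: span_sum span_scale span_base)
  then have "span G \<subseteq> span B" by (rule span_minimal) simp
  then have "span B = UNIV" using span by auto
  then show ?thesis unfolding is_lattice_def using B by blast
qed


section \<open>Adjunction and Galois groups\<close>

lemma a_inv_ring_of_type_algebra:
  "a_inv (ring_of_type_algebra :: 'a::Fields.field ring) a = - a"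
proof -
  interpret R: field "ring_of_type_algebra :: 'a ring" by (rule field_from_type_algebra)
  show ?thesis
    by (rule R.minus_equality) (auto simp: ring_of_type_algebra_def)
qed

lemma m_inv_ring_of_type_algebra:
  "a \<noteq> 0 \<Longrightarrow> m_inv (ring_of_type_algebra :: 'a::Fields.field ring) a = inverse a"
proof -
  assume "a \<noteq> 0"
  interpret R: field "ring_of_type_algebra :: 'a ring" by (rule field_from_type_algebra)
  show ?thesis
    by (rule R.comm_inv_char) (use \<open>a \<noteq> 0\<close> in \<open>auto simp: ring_of_type_algebra_def\<close>)
qed

lemma rat_adjoin_induct [consumes 1, case_names one incl uminus inverse add mult]:
  fixes a :: "'a :: field_char_0"
  assumes "a \<in> rat_adjoin S"
    and "P 1" "\<And>a. a \<in> S \<Longrightarrow> P a" "\<And>a. a \<in> rat_adjoin S \<Longrightarrow> P a \<Longrightarrow> P (- a)"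
    "\<And>a. a \<in> rat_adjoin S \<Longrightarrow> P a \<Longrightarrow> a \<noteq> 0 \<Longrightarrow> P (inverse a)"
    "\<And>a b. a \<in> rat_adjoin S \<Longrightarrow> b \<in> rat_adjoin S \<Longrightarrow> P a \<Longrightarrow> P b \<Longrightarrow> P (a + b)"
    "\<And>a b. a \<in> rat_adjoin S \<Longrightarrow> b \<in> rat_adjoin S \<Longrightarrow> P a \<Longrightarrow> P b \<Longrightarrow> P (a * b)"
  shows "P a"
  using assms(1) unfolding rat_adjoin_def
proof (induction rule: generate_field.induct)
  case one
  then show ?case using assms(2) by (simp add: ring_of_type_algebra_def)
next
  case (a_inv h)
  then show ?case using assms(4)[of h] by (simp add: a_inv_ring_of_type_algebra rat_adjoin_def)
next
  case (m_inv h)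
  then have "h \<noteq> 0" by (simp add: ring_of_type_algebra_def)
  with m_inv show ?case using assms(5)[of h] by (simp add: m_inv_ring_of_type_algebra rat_adjoin_def)
next
  case (eng_add a b)
  then show ?case using assms(6)[of a b] by (simp add: rat_adjoin_def)
      (simp add: ring_of_type_algebra_def)
next
  case (eng_mult a b)
  then show ?case using assms(7)[of a b] by (simp add: rat_adjoin_def)
      (simp add: ring_of_type_algebra_def)
qed (use assms in auto)

context
  fixes S :: "'a :: field_char_0 set"
begin

lemma rat_adjoin_1: "1 \<in> rat_adjoin S"
  using generate_field.one[of "ring_of_type_algebra :: 'a ring" S]
  by (simp add: rat_adjoin_def) (simp add: ring_of_type_algebra_def)

lemma rat_adjoin_incl: "a \<in> S \<Longrightarrow> a \<in> rat_adjoin S"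
  by (simp add: rat_adjoin_def generate_field.incl)

lemma rat_adjoin_uminus: "a \<in> rat_adjoin S \<Longrightarrow> - a \<in> rat_adjoin S"
  using generate_field.a_inv[of a "ring_of_type_algebra :: 'a ring" S]
  by (simp add: rat_adjoin_def a_inv_ring_of_type_algebra)

lemma rat_adjoin_add: "a \<in> rat_adjoin S \<Longrightarrow> b \<in> rat_adjoin S \<Longrightarrow> a + b \<in> rat_adjoin S"
  using generate_field.eng_add[of a "ring_of_type_algebra :: 'a ring" S b]
  by (simp add: rat_adjoin_def) (simp add: ring_of_type_algebra_def)

lemma rat_adjoin_mult: "a \<in> rat_adjoin S \<Longrightarrow> b \<in> rat_adjoin S \<Longrightarrow> a * b \<in> rat_adjoin S"
  using generate_field.eng_mult[of a "ring_of_type_algebra :: 'a ring" S b]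
  by (simp add: rat_adjoin_def) (simp add: ring_of_type_algebra_def)

lemma rat_adjoin_0: "0 \<in> rat_adjoin S"
  using rat_adjoin_add[OF rat_adjoin_1 rat_adjoin_uminus[OF rat_adjoin_1]] by simp

lemma rat_adjoin_inverse: "a \<in> rat_adjoin S \<Longrightarrow> inverse a \<in> rat_adjoin S"
  using generate_field.m_inv[of a "ring_of_type_algebra :: 'a ring" S] rat_adjoin_0
  by (cases "a = 0")
     (simp, simp add: rat_adjoin_def m_inv_ring_of_type_algebra, simp add: ring_of_type_algebra_def)

lemma rat_adjoin_of_nat: "of_nat n \<in> rat_adjoin S"
  by (induction n) (auto intro: rat_adjoin_0 rat_adjoin_1 rat_adjoin_add)

lemma rat_adjoin_of_int: "of_int k \<in> rat_adjoin S"
  using rat_adjoin_of_nat[of "nat k"] rat_adjoin_uminus[OF rat_adjoin_of_nat[of "nat (- k)"]]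
  by (cases "k \<ge> 0") auto

lemma rat_adjoin_Rats: "q \<in> \<rat> \<Longrightarrow> q \<in> rat_adjoin S"
  by (elim Rats_cases')
     (simp add: divide_inverse rat_adjoin_mult rat_adjoin_of_int rat_adjoin_inverse)

lemma rat_adjoin_power: "a \<in> rat_adjoin S \<Longrightarrow> a ^ n \<in> rat_adjoin S"
  by (induction n) (auto intro: rat_adjoin_1 rat_adjoin_mult)

end

lemma galois_groupD:
  assumes "\<sigma> \<in> carrier (galois_group K)"
  shows "\<sigma> \<in> Bij K" "\<And>a b. a \<in> K \<Longrightarrow> b \<in> K \<Longrightarrow> \<sigma> (a + b) = \<sigma> a + \<sigma> b"
    "\<And>a b. a \<in> K \<Longrightarrow> b \<in> K \<Longrightarrow> \<sigma> (a * b) = \<sigma> a * \<sigma> b" "\<And>q. q \<in> \<rat> \<Longrightarrow> \<sigma> q = q"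
  using assms by (auto simp: galois_group_def)

lemma galois_group_determined_by_generators:
  assumes \<sigma>: "\<sigma> \<in> carrier (galois_group (rat_adjoin S))" and \<tau>:
      "\<tau> \<in> carrier (galois_group (rat_adjoin S))"
    and eq: "\<And>a. a \<in> S \<Longrightarrow> \<sigma> a = \<tau> a"
  shows "\<sigma> = \<tau>"
proof
  fix a
  show "\<sigma> a = \<tau> a"
  proof (cases "a \<in> rat_adjoin S")
    case True
    then show ?thesis
    proof (induction rule: rat_adjoin_induct)
      case one
      then show ?case using galois_groupD(4)[OF \<sigma>, of 1] galois_groupD(4)[OF \<tau>, of 1] by simp
    next
      case (uminus a)
      have "\<rho> (- a) = - \<rho> a" if "\<rho> \<in> carrier (galois_group (rat_adjoin S))" for \<rho>
        using galois_groupD(2)[OF that uminus(1) rat_adjoin_uminus[OF uminus(1)]]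
            galois_groupD(4)[OF that, of 0]
        by (simp add: eq_neg_iff_add_eq_0 add.commute)
      from this[OF \<sigma>] this[OF \<tau>] show ?case using uminus(2) by simp
    next
      case (inverse a)
      have "\<rho> (inverse a) = inverse (\<rho> a)" if "\<rho> \<in> carrier (galois_group (rat_adjoin S))" for \<rho>
        using galois_groupD(3)[OF that inverse(1) rat_adjoin_inverse[OF inverse(1)]]
          galois_groupD(4)[OF that, of 1] \<open>a \<noteq> 0\<close> by (simp add: inverse_unique)
      from this[OF \<sigma>] this[OF \<tau>] show ?case using inverse by simp
    qed (use eq galois_groupD(2,3)[OF \<sigma>] galois_groupD(2,3)[OF \<tau>] in auto)
  next
    case False
    then show ?thesis
      using galois_groupD(1)[OF \<sigma>] galois_groupD(1)[OF \<tau>] by (auto simp: Bij_def extensional_def)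
  qed
qed

text \<open>Restriction to \<open>S\<close> embeds the Galois group into the permutations of \<open>S\<close>, and both are
  finite of the same size. The isomorphism serves only to count.\<close>
lemma full_galois_group_realises_permutations:
  fixes S :: "'a::field_char_0 set"
  defines "G \<equiv> galois_group (rat_adjoin S)"
  assumes "finite S" and stable: "\<And>\<sigma> a. \<sigma> \<in> carrier G \<Longrightarrow> a \<in> S \<Longrightarrow> \<sigma> a \<in> S"
    and iso: "G \<cong> sym_group (card S)" and "\<pi> permutes S"
  obtains \<sigma> where "\<sigma> \<in> carrier G" "\<And>a. a \<in> S \<Longrightarrow> \<sigma> a = \<pi> a"
proof -
  define \<Phi> where "\<Phi> \<sigma> = (\<lambda>a. if a \<in> S then \<sigma> a else a)" for \<sigma> :: "'a \<Rightarrow> 'a"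
  have "\<Phi> ` carrier G \<subseteq> {\<pi>. \<pi> permutes S}"
  proof safe
    fix \<sigma> assume \<sigma>: "\<sigma> \<in> carrier G"
    have "inj_on \<sigma> S"
      using galois_groupD(1)[of \<sigma>] \<sigma> rat_adjoin_incl[of _ S] unfolding G_def Bij_def bij_betw_def
      by (auto intro: inj_on_subset)
    then have "bij_betw \<sigma> S S"
      using stable[OF \<sigma>] endo_inj_surj[OF \<open>finite S\<close>, of \<sigma>] by (auto simp: bij_betw_def)
    then have "bij_betw (\<Phi> \<sigma>) S S" by (rule bij_betw_cong[THEN iffD1, rotated]) (simp add: \<Phi>_def)
    then show "\<Phi> \<sigma> permutes S" by (rule bij_imp_permutes) (simp add: \<Phi>_def)
  qed
  moreover have "card (\<Phi> ` carrier G) = card {\<pi>. \<pi> permutes S}"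
  proof -
    have "inj_on \<Phi> (carrier G)"
    proof (rule inj_onI)
      fix \<sigma> \<tau> assume *: "\<sigma> \<in> carrier G" "\<tau> \<in> carrier G" "\<Phi> \<sigma> = \<Phi> \<tau>"
      then have "\<sigma> a = \<tau> a" if "a \<in> S" for a using that by (metis \<Phi>_def)
      with * show "\<sigma> = \<tau>" using galois_group_determined_by_generators unfolding G_def by blast
    qed
    then have "card (\<Phi> ` carrier G) = card (carrier G)" by (rule card_image)
    also have "\<dots> = card (carrier (sym_group (card S)))"
      using iso by (auto simp: is_iso_def iso_def intro: bij_betw_same_card)
    also have "\<dots> = fact (card S)"
      by (simp add: sym_group_def card_permutations[OF refl])
    finally show ?thesis by (simp add: card_permutations[OF refl \<open>finite S\<close>])
  qed
  ultimately have "\<Phi> ` carrier G = {\<pi>. \<pi> permutes S}"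
    using finite_permutations[OF \<open>finite S\<close>] by (intro card_subset_eq) auto
  then obtain \<sigma> where "\<sigma> \<in> carrier G" "\<pi> = \<Phi> \<sigma>" using \<open>\<pi> permutes S\<close> by blast
  then show ?thesis using that by (simp add: \<Phi>_def)
qed


section \<open>Identities in four roots\<close>

text \<open>The coefficient of \<open>f\<^sub>p\<close> in \<open>e\<^sub>i\<close> for indices of different parity, where \<open>a = x\<^sub>i\<close>,
  \<open>b = x\<^sub>p\<close>, and \<open>c\<close>, \<open>d\<close> are the other roots with the parity of \<open>i\<close> and of \<open>p\<close>.\<close>
definition tau :: "'a::field \<Rightarrow> 'a \<Rightarrow> 'a \<Rightarrow> 'a \<Rightarrow> 'a" ("\<tau>")
  where "\<tau> a c b d = (b - c) * (1 - 2 * (a * d + b * c) / (a * c + b * d)) / (a - c)"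

lemma tau_times_denominator:
  assumes "a \<noteq> c" "a * c + b * d \<noteq> 0"
  shows "(a - c) * (a * c + b * d) * \<tau> a c b d = (b - c) * (a * c + b * d - 2 * (a * d + b * c))"
proof -
  have "(a * c + b * d) * (1 - 2 * (a * d + b * c) / (a * c + b * d))
      = a * c + b * d - 2 * (a * d + b * c)"
    using assms(2) by (simp add: right_diff_distrib)
  then show ?thesis using assms(1) by (simp add: tau_def mult.left_commute)
qed

text \<open>The coefficients of \<open>f\<^sub>a \<and> f\<^sub>b\<close> and of \<open>f\<^sub>a \<and> f\<^sub>c\<close> in \<open>\<Sum>h\<^sub>i\<^sub>j (x\<^sub>i - x\<^sub>j) e\<^sub>i \<and> e\<^sub>j\<close>, the indices being
  named after their roots; \<open>a, c\<close> have one parity and \<open>b, d\<close> the other.\<close>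
definition mixed_coeff :: "'a::field \<Rightarrow> 'a \<Rightarrow> 'a \<Rightarrow> 'a \<Rightarrow> 'a" where
  "mixed_coeff a c b d = (a * b + c * d) * (a - b)
      - (a * b + c * d) * (a - b) * \<tau> a c b d * \<tau> b d a c
      - (a * b + c * d) * (c - d) * \<tau> c a b d * \<tau> d b a c + (a * c + b * d) * (a - c) * \<tau> c a b d
      - (a * c + b * d) * (b - d) * \<tau> d b a c - (a * d + b * c) * (a - d) * \<tau> a c b d * \<tau> d b a c
      + (a * d + b * c) * (b - c) * \<tau> b d a c * \<tau> c a b d"

definition equal_parity_coeff :: "'a::field \<Rightarrow> 'a \<Rightarrow> 'a \<Rightarrow> 'a \<Rightarrow> 'a" where
  "equal_parity_coeff a c b d = (a * c + b * d) * (a - c) + (a * b + c * d) * (a - b) * \<tau> b d c a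
      - (a * b + c * d) * (c - d) * \<tau> d b a c + (a * c + b * d) * (b - d) * \<tau> b d a c * \<tau> d b c a
      - (a * c + b * d) * (b - d) * \<tau> b d c a * \<tau> d b a c + (a * d + b * c) * (a - d) * \<tau> d b c a
      + (a * d + b * c) * (b - c) * \<tau> b d a c"

text \<open>Each identity is proved for one order of the roots and is used for several. Multiplication
  by the denominators \<open>(a - c) t\<close> and \<open>(b - d) t\<close> replaces every \<open>\<tau>\<close> by its numerator, which is
  a difference of roots times \<open>k\<close> or \<open>l\<close>; what is left is a polynomial identity.\<close>
context
  fixes a b c d t k l :: "'a::field"
  assumes neq: "a \<noteq> c" "b \<noteq> d" and t: "t = a * c + b * d" "t \<noteq> 0"
  defines "k \<equiv> t - 2 * (a * d + b * c)" and "l \<equiv> t - 2 * (a * b + c * d)"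
begin

lemma scaled_tau:
  "(a - c) * t * \<tau> a c b d = (b - c) * k" "(c - a) * t * \<tau> c a b d = (b - a) * l"
  "(a - c) * t * \<tau> a c d b = (d - c) * l" "(c - a) * t * \<tau> c a d b = (d - a) * k"
  "(b - d) * t * \<tau> b d a c = (a - d) * k" "(d - b) * t * \<tau> d b a c = (a - b) * l"
  "(b - d) * t * \<tau> b d c a = (c - d) * l" "(d - b) * t * \<tau> d b c a = (c - b) * k"
  using tau_times_denominator[of a c b d] tau_times_denominator[of c a b d]
    tau_times_denominator[of a c d b] tau_times_denominator[of c a d b]
    tau_times_denominator[of b d a c] tau_times_denominator[of d b a c]
    tau_times_denominator[of b d c a] tau_times_denominator[of d b c a] neq t(2)
  unfolding k_def l_def t(1) by (simp_all add: mult.commute add.commute)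

text \<open>The entries of \<open>T\<^sup>2\<close>. The diagonal one is symmetric enough to be the same for all four indices.\<close>
lemma tau_square_diag:
  "t\<^sup>2 * (1 - \<tau> a c b d * \<tau> b d a c - \<tau> a c d b * \<tau> d b a c)
      = - 4 * (a - b) * (c - d) * (a - d) * (b - c)"
proof -
  have "(a - c) * (b - d) * (t\<^sup>2 * (1 - \<tau> a c b d * \<tau> b d a c - \<tau> a c d b * \<tau> d b a c))
      = ((a - c) * t) * ((b - d) * t) - ((a - c) * t * \<tau> a c b d) * ((b - d) * t * \<tau> b d a c)
      + ((a - c) * t * \<tau> a c d b) * ((d - b) * t * \<tau> d b a c)"
    by Groebner_Basis.algebra
  also have "\<dots> = ((a - c) * t) * ((b - d) * t) - ((b - c) * k) * ((a - d) * k)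
      + ((d - c) * l) * ((a - b) * l)"
    unfolding scaled_tau ..
  also have "\<dots> = (a - c) * (b - d) * (- 4 * (a - b) * (c - d) * (a - d) * (b - c))"
    unfolding k_def l_def t(1) by Groebner_Basis.algebra
  finally show ?thesis using neq t(2) by (metis mult_left_cancel mult_eq_0_iff right_minus_eq)
qed

lemma tau_square_off_diag:
  "\<tau> a c b d * \<tau> b d c a + \<tau> a c d b * \<tau> d b c a = 0"
proof -
  have "(a - c) * (b - d) * (t\<^sup>2 * (\<tau> a c b d * \<tau> b d c a + \<tau> a c d b * \<tau> d b c a))
      = ((a - c) * t * \<tau> a c b d) * ((b - d) * t * \<tau> b d c a)
      - ((a - c) * t * \<tau> a c d b) * ((d - b) * t * \<tau> d b c a)"
    by Groebner_Basis.algebra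
  also have "\<dots> = ((b - c) * k) * ((c - d) * l) - ((d - c) * l) * ((c - b) * k)"
    unfolding scaled_tau ..
  also have "\<dots> = (a - c) * (b - d) * (0)"
    unfolding k_def l_def t(1) by Groebner_Basis.algebra
  finally show ?thesis using neq t(2) by (metis mult_eq_0_iff right_minus_eq power_not_zero)
qed

lemma mixed_coefficient:
  "t\<^sup>2 * mixed_coeff a c b d = 4 * ((a - b)\<^sup>2 * (b - c)\<^sup>2 * (a - d)\<^sup>2 * (c - d))"
proof -
  have "(a - c) * (b - d) * (t\<^sup>2 * ((a * b + c * d) * (a - b)
      - (a * b + c * d) * (a - b) * \<tau> a c b d * \<tau> b d a c
      - (a * b + c * d) * (c - d) * \<tau> c a b d * \<tau> d b a c + t * (a - c) * \<tau> c a b d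
      - t * (b - d) * \<tau> d b a c - (a * d + b * c) * (a - d) * \<tau> a c b d * \<tau> d b a c
      + (a * d + b * c) * (b - c) * \<tau> b d a c * \<tau> c a b d))
      = (a * b + c * d) * (a - b) * ((a - c) * t) * ((b - d) * t)
      - (a * b + c * d) * (a - b) * ((a - c) * t * \<tau> a c b d) * ((b - d) * t * \<tau> b d a c)
      - (a * b + c * d) * (c - d) * ((c - a) * t * \<tau> c a b d) * ((d - b) * t * \<tau> d b a c)
      - t * (a - c) * ((c - a) * t * \<tau> c a b d) * ((b - d) * t)
      + t * (b - d) * ((d - b) * t * \<tau> d b a c) * ((a - c) * t)
      + (a * d + b * c) * (a - d) * ((a - c) * t * \<tau> a c b d) * ((d - b) * t * \<tau> d b a c)
      - (a * d + b * c) * (b - c) * ((b - d) * t * \<tau> b d a c) * ((c - a) * t * \<tau> c a b d)"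
    by Groebner_Basis.algebra
  also have "\<dots> = (a * b + c * d) * (a - b) * ((a - c) * t) * ((b - d) * t)
      - (a * b + c * d) * (a - b) * ((b - c) * k) * ((a - d) * k)
      - (a * b + c * d) * (c - d) * ((b - a) * l) * ((a - b) * l)
      - t * (a - c) * ((b - a) * l) * ((b - d) * t) + t * (b - d) * ((a - b) * l) * ((a - c) * t)
      + (a * d + b * c) * (a - d) * ((b - c) * k) * ((a - b) * l)
      - (a * d + b * c) * (b - c) * ((a - d) * k) * ((b - a) * l)"
    unfolding scaled_tau ..
  also have "\<dots> = (a - c) * (b - d) * (4 * ((a - b)\<^sup>2 * (b - c)\<^sup>2 * (a - d)\<^sup>2 * (c - d)))"
    unfolding k_def l_def t(1) by Groebner_Basis.algebra
  finally show ?thesis unfolding mixed_coeff_def t(1)[symmetric] using neq t(2) by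
      (metis mult_left_cancel mult_eq_0_iff right_minus_eq)
qed

lemma equal_parity_coefficient:
  "equal_parity_coeff a c b d = 0"
proof -
  have "(b - d) * (b - d) * (t\<^sup>2 * (t * (a - c) + (a * b + c * d) * (a - b) * \<tau> b d c a
      - (a * b + c * d) * (c - d) * \<tau> d b a c + t * (b - d) * \<tau> b d a c * \<tau> d b c a
      - t * (b - d) * \<tau> b d c a * \<tau> d b a c + (a * d + b * c) * (a - d) * \<tau> d b c a
      + (a * d + b * c) * (b - c) * \<tau> b d a c))
      = t * (a - c) * ((b - d) * t) * ((b - d) * t)
      + (a * b + c * d) * (a - b) * ((b - d) * t * \<tau> b d c a) * ((b - d) * t)
      + (a * b + c * d) * (c - d) * ((d - b) * t * \<tau> d b a c) * ((b - d) * t)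
      - t * (b - d) * ((b - d) * t * \<tau> b d a c) * ((d - b) * t * \<tau> d b c a)
      + t * (b - d) * ((b - d) * t * \<tau> b d c a) * ((d - b) * t * \<tau> d b a c)
      - (a * d + b * c) * (a - d) * ((d - b) * t * \<tau> d b c a) * ((b - d) * t)
      + (a * d + b * c) * (b - c) * ((b - d) * t * \<tau> b d a c) * ((b - d) * t)"
    by Groebner_Basis.algebra
  also have "\<dots> = t * (a - c) * ((b - d) * t) * ((b - d) * t)
      + (a * b + c * d) * (a - b) * ((c - d) * l) * ((b - d) * t)
      + (a * b + c * d) * (c - d) * ((a - b) * l) * ((b - d) * t)
      - t * (b - d) * ((a - d) * k) * ((c - b) * k) + t * (b - d) * ((c - d) * l) * ((a - b) * l)
      - (a * d + b * c) * (a - d) * ((c - b) * k) * ((b - d) * t)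
      + (a * d + b * c) * (b - c) * ((a - d) * k) * ((b - d) * t)"
    unfolding scaled_tau ..
  also have "\<dots> = (b - d) * (b - d) * (0)"
    unfolding k_def l_def t(1) by Groebner_Basis.algebra
  finally show ?thesis unfolding equal_parity_coeff_def t(1)[symmetric] using neq t(2) by
      (metis mult_eq_0_iff right_minus_eq power_not_zero)
qed

text \<open>The entries of the matrix of \<open>\<Sum>\<mu>\<^sub>j e\<^sub>j \<and> cnj e\<^sub>j\<close> in the basis \<open>f\<close>; the products of differences are
  the \<open>\<mu>\<^sub>j\<close>.\<close>
lemma hermitian_diag:
  "t\<^sup>2 * ((a - b) * (a - c) * (a - d) + (b - a) * (b - c) * (b - d) * \<tau> b d a c * \<tau> b d a c
      + (d - a) * (d - b) * (d - c) * \<tau> d b a c * \<tau> d b a c)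
      = - 4 * ((a - b)\<^sup>2 * (a - c) * (b - c) * (a - d)\<^sup>2 * (c - d))"
proof -
  have "(b - d) * (b - d) * (t\<^sup>2 * ((a - b) * (a - c) * (a - d)
      + (b - a) * (b - c) * (b - d) * \<tau> b d a c * \<tau> b d a c
      + (d - a) * (d - b) * (d - c) * \<tau> d b a c * \<tau> d b a c))
      = (a - b) * (a - c) * (a - d) * ((b - d) * t) * ((b - d) * t)
      + (b - a) * (b - c) * (b - d) * ((b - d) * t * \<tau> b d a c) * ((b - d) * t * \<tau> b d a c)
      + (d - a) * (d - b) * (d - c) * ((d - b) * t * \<tau> d b a c) * ((d - b) * t * \<tau> d b a c)"
    by Groebner_Basis.algebra
  also have "\<dots> = (a - b) * (a - c) * (a - d) * ((b - d) * t) * ((b - d) * t)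
      + (b - a) * (b - c) * (b - d) * ((a - d) * k) * ((a - d) * k)
      + (d - a) * (d - b) * (d - c) * ((a - b) * l) * ((a - b) * l)"
    unfolding scaled_tau ..
  also have "\<dots> = (b - d) * (b - d) * (- 4 * ((a - b)\<^sup>2 * (a - c) * (b - c) * (a - d)\<^sup>2 * (c - d)))"
    unfolding k_def l_def t(1) by Groebner_Basis.algebra
  finally show ?thesis using neq t(2) by (metis mult_left_cancel mult_eq_0_iff right_minus_eq)
qed

lemma hermitian_equal_parity:
  "(b - a) * (b - c) * (b - d) * \<tau> b d a c * \<tau> b d c a
      + (d - a) * (d - b) * (d - c) * \<tau> d b a c * \<tau> d b c a = 0"
proof -
  have "(b - d) * (b - d) * (t\<^sup>2 * ((b - a) * (b - c) * (b - d) * \<tau> b d a c * \<tau> b d c a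
      + (d - a) * (d - b) * (d - c) * \<tau> d b a c * \<tau> d b c a))
      = (b - a) * (b - c) * (b - d) * ((b - d) * t * \<tau> b d a c) * ((b - d) * t * \<tau> b d c a)
      + (d - a) * (d - b) * (d - c) * ((d - b) * t * \<tau> d b a c) * ((d - b) * t * \<tau> d b c a)"
    by Groebner_Basis.algebra
  also have "\<dots> = (b - a) * (b - c) * (b - d) * ((a - d) * k) * ((c - d) * l)
      + (d - a) * (d - b) * (d - c) * ((a - b) * l) * ((c - b) * k)"
    unfolding scaled_tau ..
  also have "\<dots> = (b - d) * (b - d) * (0)"
    unfolding k_def l_def t(1) by Groebner_Basis.algebra
  finally show ?thesis using neq t(2) by (metis mult_eq_0_iff right_minus_eq power_not_zero)
qed

lemma hermitian_mixed:
  "(a - b) * (a - c) * (a - d) * \<tau> a c b d + (b - a) * (b - c) * (b - d) * \<tau> b d a c = 0"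
proof -
  have "t * ((a - b) * (a - c) * (a - d) * \<tau> a c b d + (b - a) * (b - c) * (b - d) * \<tau> b d a c)
    = (a - b) * (a - d) * ((a - c) * t * \<tau> a c b d) + (b - a) * (b - c) * ((b - d) * t * \<tau> b d a c)"
    by Groebner_Basis.algebra
  also have "\<dots> = 0" unfolding scaled_tau by Groebner_Basis.algebra
  finally show ?thesis using t(2) by simp
qed

end


section \<open>The forms in the coordinates \<open>w\<close>\<close>

lemma mu_expand:
  "mu x 1 = (x 1 - x 2) * (x 1 - x 3) * (x 1 - x 4)"
  "mu x 2 = (x 2 - x 1) * (x 2 - x 3) * (x 2 - x 4)"
  "mu x 3 = (x 3 - x 1) * (x 3 - x 2) * (x 3 - x 4)"
  "mu x 4 = (x 4 - x 1) * (x 4 - x 2) * (x 4 - x 3)"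
proof -
  have I: "{1..4::nat} - {1} = {2, 3, 4}" "{1..4::nat} - {2} = {1, 3, 4}"
      "{1..4::nat} - {3} = {1, 2, 4}"
    "{1..4::nat} - {4} = {1, 2, 3}" by auto
  show "mu x 1 = (x 1 - x 2) * (x 1 - x 3) * (x 1 - x 4)"
    "mu x 2 = (x 2 - x 1) * (x 2 - x 3) * (x 2 - x 4)"
    "mu x 3 = (x 3 - x 1) * (x 3 - x 2) * (x 3 - x 4)"
    "mu x 4 = (x 4 - x 1) * (x 4 - x 2) * (x 4 - x 3)"
    unfolding mu_def I by simp_all
qed

text \<open>This is \<open>(1 + T) (1 - T) = (1 - T) (1 + T) = 1 - T\<^sup>2 = \<delta>\<close>.\<close>
lemma block_system:
  fixes \<delta> :: "'a::field"
  assumes diag: "m12 * m21 + m14 * m41 = 1 - \<delta>" "m21 * m12 + m23 * m32 = 1 - \<delta>"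
      "m32 * m23 + m34 * m43 = 1 - \<delta>" "m41 * m14 + m43 * m34 = 1 - \<delta>"
    and off: "m12 * m23 + m14 * m43 = 0" "m32 * m21 + m34 * m41 = 0"
      "m21 * m14 + m23 * m34 = 0" "m41 * m12 + m43 * m32 = 0"
    and "\<delta> \<noteq> 0"
  shows "(E1 = f1 + m12 * f2 + m14 * f4 \<and> E2 = f2 + m21 * f1 + m23 * f3 \<and>
          E3 = f3 + m32 * f2 + m34 * f4 \<and> E4 = f4 + m41 * f1 + m43 * f3) \<longleftrightarrow>
         (f1 = (E1 - m12 * E2 - m14 * E4) / \<delta> \<and> f2 = (E2 - m21 * E1 - m23 * E3) / \<delta> \<and>
          f3 = (E3 - m32 * E2 - m34 * E4) / \<delta> \<and> f4 = (E4 - m41 * E1 - m43 * E3) / \<delta>)"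
    (is "?L \<longleftrightarrow> ?R")
proof
  assume L: ?L
  have "f1 * \<delta> = E1 - m12 * E2 - m14 * E4" "f2 * \<delta> = E2 - m21 * E1 - m23 * E3"
    "f3 * \<delta> = E3 - m32 * E2 - m34 * E4" "f4 * \<delta> = E4 - m41 * E1 - m43 * E3"
    using L diag off by Groebner_Basis.algebra+
  then show ?R using \<open>\<delta> \<noteq> 0\<close> by (simp add: nonzero_eq_divide_eq)
next
  assume ?R
  then have R: "f1 * \<delta> = E1 - m12 * E2 - m14 * E4" "f2 * \<delta> = E2 - m21 * E1 - m23 * E3"
    "f3 * \<delta> = E3 - m32 * E2 - m34 * E4" "f4 * \<delta> = E4 - m41 * E1 - m43 * E3"
    using \<open>\<delta> \<noteq> 0\<close> by (simp_all add: nonzero_eq_divide_eq)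
  have "\<delta> * E1 = \<delta> * (f1 + m12 * f2 + m14 * f4)" "\<delta> * E2 = \<delta> * (f2 + m21 * f1 + m23 * f3)"
    "\<delta> * E3 = \<delta> * (f3 + m32 * f2 + m34 * f4)" "\<delta> * E4 = \<delta> * (f4 + m41 * f1 + m43 * f3)"
    using R diag off by Groebner_Basis.algebra+
  then show ?L using \<open>\<delta> \<noteq> 0\<close> by simp
qed

text \<open>The scalar \<open>\<delta> = 1 - T\<^sup>2\<close>.\<close>
definition transition_scalar :: "(nat \<Rightarrow> real) \<Rightarrow> complex" where
  "transition_scalar x = of_real (- 4 * (x 1 - x 2) * (x 3 - x 4) * (x 1 - x 4) * (x 2
      - x 3) / (h3 x)\<^sup>2)"

lemma tau_eq_ratio:
  "k = 1 - 2 * (a * d + b * c) / (a * c + b * d) \<Longrightarrow> \<tau> a c b d = (b - c) * k / (a - c)"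
  by (simp add: tau_def)

context
  fixes x :: "nat \<Rightarrow> real" and \<xi> :: "nat \<Rightarrow> complex"
  assumes ordered: "x 1 > x 2" "x 2 > x 3" "x 3 > x 4" and h3: "h3 x \<noteq> 0"
  defines xi_def: "\<xi> \<equiv> \<lambda>i. of_real (x i)"
begin

lemma xi_neq: "\<xi> 1 \<noteq> \<xi> 3" "\<xi> 3 \<noteq> \<xi> 1" "\<xi> 2 \<noteq> \<xi> 4" "\<xi> 4 \<noteq> \<xi> 2"
  using ordered by (auto simp: xi_def)

text \<open>The equations for \<open>z\<^sub>2\<close> and \<open>z\<^sub>4\<close> are conjugated, so that the system becomes complex-linear in
  \<open>w\<^sub>1\<close>, \<open>w\<^sub>3\<close> and the conjugates of \<open>w\<^sub>2\<close>, \<open>w\<^sub>4\<close>.\<close>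
lemma w_relation_iff:
  "w_relation x z w \<longleftrightarrow> (\<forall>v.
     e_form z 1 v = e_form w 1 v + \<tau> (\<xi> 1) (\<xi> 3) (\<xi> 2) (\<xi> 4) * e_form w 2 v
         + \<tau> (\<xi> 1) (\<xi> 3) (\<xi> 4) (\<xi> 2) * e_form w 4 v \<and>
     e_form z 2 v = e_form w 2 v + \<tau> (\<xi> 2) (\<xi> 4) (\<xi> 1) (\<xi> 3) * e_form w 1 v
         + \<tau> (\<xi> 2) (\<xi> 4) (\<xi> 3) (\<xi> 1) * e_form w 3 v \<and>
     e_form z 3 v = e_form w 3 v + \<tau> (\<xi> 3) (\<xi> 1) (\<xi> 2) (\<xi> 4) * e_form w 2 v
         + \<tau> (\<xi> 3) (\<xi> 1) (\<xi> 4) (\<xi> 2) * e_form w 4 v \<and>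
     e_form z 4 v = e_form w 4 v + \<tau> (\<xi> 4) (\<xi> 2) (\<xi> 1) (\<xi> 3) * e_form w 1 v
         + \<tau> (\<xi> 4) (\<xi> 2) (\<xi> 3) (\<xi> 1) * e_form w 3 v)"
proof -
  have entry: "of_real (\<tau> a c b d) = \<tau> (complex_of_real a) (of_real c) (of_real b) (of_real d)" for
      a b c d
    by (simp add: tau_def)
  define k where "k = 1 - 2 * h4 x / h3 x"
  define l where "l = 1 - 2 * h2 x / h3 x"
  have k_entries: "\<tau> (x 1) (x 3) (x 2) (x 4) = (x 2 - x 3) * k / (x 1 - x 3)"
    "\<tau> (x 3) (x 1) (x 4) (x 2) = (x 1 - x 4) * k / (x 1 - x 3)"
    "\<tau> (x 2) (x 4) (x 1) (x 3) = (x 1 - x 4) * k / (x 2 - x 4)"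
    "\<tau> (x 4) (x 2) (x 3) (x 1) = (x 2 - x 3) * k / (x 2 - x 4)"
    using ordered
    by (subst tau_eq_ratio[of k]; simp add: k_def h3_def h4_def mult.commute add.commute;
        simp add: divide_simps; simp add: algebra_simps)+
  have l_entries: "\<tau> (x 1) (x 3) (x 4) (x 2) = (x 4 - x 3) * l / (x 1 - x 3)"
    "\<tau> (x 3) (x 1) (x 2) (x 4) = (x 1 - x 2) * l / (x 1 - x 3)"
    "\<tau> (x 2) (x 4) (x 3) (x 1) = (x 3 - x 4) * l / (x 2 - x 4)"
    "\<tau> (x 4) (x 2) (x 1) (x 3) = (x 2 - x 1) * l / (x 2 - x 4)"
    using ordered
    by (subst tau_eq_ratio[of l]; simp add: l_def h3_def h2_def mult.commute add.commute;
        simp add: divide_simps; simp add: algebra_simps)+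
  have A: "alpha_star x $ 1 $ 1 = of_real (\<tau> (x 1) (x 3) (x 2) (x 4))"
    "alpha_star x $ 1 $ 2 = of_real (\<tau> (x 1) (x 3) (x 4) (x 2))"
    "alpha_star x $ 2 $ 1 = of_real (\<tau> (x 3) (x 1) (x 2) (x 4))"
    "alpha_star x $ 2 $ 2 = of_real (\<tau> (x 3) (x 1) (x 4) (x 2))"
    unfolding k_entries l_entries alpha_star_def
    by (simp_all add: scaleR_conv_of_real[where 'a=complex] flip: k_def l_def)
  have B: "alpha_tilde x $ 1 $ 1 = of_real (\<tau> (x 2) (x 4) (x 1) (x 3))"
    "alpha_tilde x $ 1 $ 2 = of_real (\<tau> (x 2) (x 4) (x 3) (x 1))"
    "alpha_tilde x $ 2 $ 1 = of_real (\<tau> (x 4) (x 2) (x 1) (x 3))"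
    "alpha_tilde x $ 2 $ 2 = of_real (\<tau> (x 4) (x 2) (x 3) (x 1))"
    unfolding alpha_tilde_def hat_matrix_def map_matrix_def
    using ordered by (simp_all add: A k_entries l_entries scaleR_conv_of_real[where 'a=complex] del:
        One_nat_def)
      (simp_all only: minus_divide_left mult_minus_left[symmetric] minus_diff_eq)
  have cnj_eq: "cnj u = v \<longleftrightarrow> u = cnj v" for u v by auto
  show ?thesis
    unfolding w_relation_def e_form_def conj_form_def xi_def
    by (simp add: Finite_Cartesian_Product.vec_eq_iff forall_2 matrix_vector_mult_def sum_2
        map_matrix_def A B entry[symmetric] cnj_eq add.assoc conj_ac
       del: complex_cnj_cancel_iff)
qed

lemma w_relation_iff_inverse:
  defines "\<delta> \<equiv> transition_scalar x"
  shows "\<delta> \<noteq> 0" and "w_relation x z w \<longleftrightarrow> (\<forall>v.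
     e_form w 1 v = (e_form z 1 v - \<tau> (\<xi> 1) (\<xi> 3) (\<xi> 2) (\<xi> 4) * e_form z 2 v
         - \<tau> (\<xi> 1) (\<xi> 3) (\<xi> 4) (\<xi> 2) * e_form z 4 v) / \<delta> \<and>
     e_form w 2 v = (e_form z 2 v - \<tau> (\<xi> 2) (\<xi> 4) (\<xi> 1) (\<xi> 3) * e_form z 1 v
         - \<tau> (\<xi> 2) (\<xi> 4) (\<xi> 3) (\<xi> 1) * e_form z 3 v) / \<delta> \<and>
     e_form w 3 v = (e_form z 3 v - \<tau> (\<xi> 3) (\<xi> 1) (\<xi> 2) (\<xi> 4) * e_form z 2 v
         - \<tau> (\<xi> 3) (\<xi> 1) (\<xi> 4) (\<xi> 2) * e_form z 4 v) / \<delta> \<and>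
     e_form w 4 v = (e_form z 4 v - \<tau> (\<xi> 4) (\<xi> 2) (\<xi> 1) (\<xi> 3) * e_form z 1 v
         - \<tau> (\<xi> 4) (\<xi> 2) (\<xi> 3) (\<xi> 1) * e_form z 3 v) / \<delta>)"
proof -
  show nz: "\<delta> \<noteq> 0" using ordered h3 by (simp add: \<delta>_def transition_scalar_def)
  have t: "\<xi> 1 * \<xi> 3 + \<xi> 2 * \<xi> 4 = of_real (h3 x)" by (simp add: xi_def h3_def)
  have \<delta>: "(of_real (h3 x))\<^sup>2 * \<delta> = - 4 * (\<xi> 1 - \<xi> 2) * (\<xi> 3 - \<xi> 4) * (\<xi> 1 - \<xi> 4) * (\<xi> 2 - \<xi> 3)"
    using h3 by (simp add: \<delta>_def transition_scalar_def xi_def)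
  have h: "complex_of_real (h3 x) \<noteq> 0" using h3 by simp
  have diag: "\<tau> a c b d * \<tau> b d a c + \<tau> a c d b * \<tau> d b a c = 1 - \<delta>"
    if "a \<noteq> c" "b \<noteq> d" "a * c + b * d = of_real (h3 x)"
      and eq: "(a - b) * (c - d) * (a - d) * (b - c)
          = (\<xi> 1 - \<xi> 2) * (\<xi> 3 - \<xi> 4) * (\<xi> 1 - \<xi> 4) * (\<xi> 2 - \<xi> 3)"
    for a b c d
  proof -
    have "(of_real (h3 x))\<^sup>2 * (1 - \<tau> a c b d * \<tau> b d a c - \<tau> a c d b * \<tau> d b a c)
        = (of_real (h3 x))\<^sup>2 * \<delta>"
      using tau_square_diag[OF that(1,2) that(3)[symmetric] h] eq unfolding \<delta> by Groebner_Basis.algebra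
    then have "\<delta> = 1 - \<tau> a c b d * \<tau> b d a c - \<tau> a c d b * \<tau> d b a c" using h by simp
    then show ?thesis by simp
  qed
  note off = tau_square_off_diag[OF _ _ sym h]
  have t': "\<xi> 1 * \<xi> 3 + \<xi> 2 * \<xi> 4 = of_real (h3 x)" "\<xi> 2 * \<xi> 4 + \<xi> 1 * \<xi> 3 = of_real (h3 x)"
    "\<xi> 3 * \<xi> 1 + \<xi> 2 * \<xi> 4 = of_real (h3 x)" "\<xi> 4 * \<xi> 2 + \<xi> 1 * \<xi> 3 = of_real (h3 x)"
    by (simp_all flip: t)
  note diag = diag[OF xi_neq(1,3) t'(1) refl] diag[OF xi_neq(3,1) t'(2)]
    diag[OF xi_neq(2,3) t'(3)] diag[OF xi_neq(4,1) t'(4)]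
  note off = off[OF xi_neq(1,3) t'(1)] off[OF xi_neq(2,3) t'(3)] off[OF xi_neq(3,1) t'(2)]
      off[OF xi_neq(4,1) t'(4)]
  note block = block_system[OF diag(1) diag(2) diag(3) diag(4) off nz]
  show "w_relation x z w \<longleftrightarrow> (\<forall>v.
     e_form w 1 v = (e_form z 1 v - \<tau> (\<xi> 1) (\<xi> 3) (\<xi> 2) (\<xi> 4) * e_form z 2 v
         - \<tau> (\<xi> 1) (\<xi> 3) (\<xi> 4) (\<xi> 2) * e_form z 4 v) / \<delta> \<and>
     e_form w 2 v = (e_form z 2 v - \<tau> (\<xi> 2) (\<xi> 4) (\<xi> 1) (\<xi> 3) * e_form z 1 v
         - \<tau> (\<xi> 2) (\<xi> 4) (\<xi> 3) (\<xi> 1) * e_form z 3 v) / \<delta> \<and>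
     e_form w 3 v = (e_form z 3 v - \<tau> (\<xi> 3) (\<xi> 1) (\<xi> 2) (\<xi> 4) * e_form z 2 v
         - \<tau> (\<xi> 3) (\<xi> 1) (\<xi> 4) (\<xi> 2) * e_form z 4 v) / \<delta> \<and>
     e_form w 4 v = (e_form z 4 v - \<tau> (\<xi> 4) (\<xi> 2) (\<xi> 1) (\<xi> 3) * e_form z 1 v
         - \<tau> (\<xi> 4) (\<xi> 2) (\<xi> 3) (\<xi> 1) * e_form z 3 v) / \<delta>)"
    unfolding w_relation_iff by (subst block) (Groebner_Basis.algebra | rule refl)+
qed

context
  fixes z w :: "nat \<Rightarrow> 'v \<Rightarrow> complex"
  assumes rel: "w_relation x z w"
begin

lemmas e_form_z =
  conjunct1[OF spec[OF iffD1[OF w_relation_iff rel]]]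
  conjunct1[OF conjunct2[OF spec[OF iffD1[OF w_relation_iff rel]]]]
  conjunct1[OF conjunct2[OF conjunct2[OF spec[OF iffD1[OF w_relation_iff rel]]]]]
  conjunct2[OF conjunct2[OF conjunct2[OF spec[OF iffD1[OF w_relation_iff rel]]]]]

lemma A_plus_eq_sum:
  "A_plus x z u v =
     (\<xi> 1 * \<xi> 2 + \<xi> 3 * \<xi> 4) * (\<xi> 1 - \<xi> 2) * wedge (e_form z 1) (e_form z 2) u v
   + (\<xi> 1 * \<xi> 2 + \<xi> 3 * \<xi> 4) * (\<xi> 3 - \<xi> 4) * wedge (e_form z 3) (e_form z 4) u v
   + (\<xi> 1 * \<xi> 3 + \<xi> 2 * \<xi> 4) * (\<xi> 1 - \<xi> 3) * wedge (e_form z 1) (e_form z 3) u v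
   + (\<xi> 1 * \<xi> 3 + \<xi> 2 * \<xi> 4) * (\<xi> 2 - \<xi> 4) * wedge (e_form z 2) (e_form z 4) u v
   + (\<xi> 1 * \<xi> 4 + \<xi> 2 * \<xi> 3) * (\<xi> 1 - \<xi> 4) * wedge (e_form z 1) (e_form z 4) u v
   + (\<xi> 1 * \<xi> 4 + \<xi> 2 * \<xi> 3) * (\<xi> 2 - \<xi> 3) * wedge (e_form z 2) (e_form z 3) u v"
proof -
  have I: "{1..4::nat} = {1, 2, 3, 4}" "{1<..4::nat} = {2, 3, 4}" "{2<..4::nat} = {3, 4}"
    "{3<..4::nat} = {4}" "{4<..4::nat} = {}" "{Suc 0<..4::nat} = {2, 3, 4}" by auto
  show ?thesis unfolding A_plus_def I by (simp add: I hh_def h2_def h3_def h4_def xi_def)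
qed

lemma mu_eq:
  "of_real (mu x 1) = (\<xi> 1 - \<xi> 2) * (\<xi> 1 - \<xi> 3) * (\<xi> 1 - \<xi> 4)"
  "of_real (mu x 2) = (\<xi> 2 - \<xi> 1) * (\<xi> 2 - \<xi> 3) * (\<xi> 2 - \<xi> 4)"
  "of_real (mu x 3) = (\<xi> 3 - \<xi> 1) * (\<xi> 3 - \<xi> 2) * (\<xi> 3 - \<xi> 4)"
  "of_real (mu x 4) = (\<xi> 4 - \<xi> 1) * (\<xi> 4 - \<xi> 2) * (\<xi> 4 - \<xi> 3)"
  by (simp_all add: mu_expand xi_def del: One_nat_def)

text \<open>The signs \<open>(-1)\<^sup>j\<^sup>+\<^sup>1\<close> disappear because conjugating both factors of \<open>dz\<^sub>j \<and> cnj dz\<^sub>j\<close> for even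
  \<open>j\<close> swaps them.\<close>
lemma omega_form_eq_sum:
  "of_real (disc x) / (\<i> * of_real (disc_sqrt x)) * omega_form x z u v =
     (\<xi> 1 - \<xi> 2) * (\<xi> 1 - \<xi> 3) * (\<xi> 1 - \<xi> 4) * wedge (e_form z 1) (conj_form (e_form z 1)) u v
   + (\<xi> 2 - \<xi> 1) * (\<xi> 2 - \<xi> 3) * (\<xi> 2 - \<xi> 4) * wedge (e_form z 2) (conj_form (e_form z 2)) u v
   + (\<xi> 3 - \<xi> 1) * (\<xi> 3 - \<xi> 2) * (\<xi> 3 - \<xi> 4) * wedge (e_form z 3) (conj_form (e_form z 3)) u v
   + (\<xi> 4 - \<xi> 1) * (\<xi> 4 - \<xi> 2) * (\<xi> 4 - \<xi> 3) * wedge (e_form z 4) (conj_form (e_form z 4)) u v"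
proof -
  have "disc_sqrt x \<noteq> 0" 
  proof -
    have "x i \<noteq> x j" if "i \<in> {1..4}" "j \<in> {i<..4}" for i j
    proof -
      have "i \<in> {1,2,3,4}" "j \<in> {1,2,3,4}" "i < j" using that by auto
      then show ?thesis using ordered by auto
    qed
    then show ?thesis by (auto simp: disc_sqrt_def)
  qed
  then have *: "of_real (disc x) / (\<i> * of_real (disc_sqrt x))
      * (\<i> * of_real (disc_sqrt x) / of_real (disc x) * s) = s" for s :: complex
    by (simp add: disc_def)
  have I: "{1..4::nat} = {1, 2, 3, 4}" by auto
  show ?thesis unfolding omega_form_def *
    by (simp add: I mu_eq del: One_nat_def)
       (simp add: e_form_def wedge_def conj_form_def algebra_simps)
qed

lemma A_plus_in_w:
  "of_real ((h3 x)\<^sup>2 / 4) * A_plus x z u v =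
     (\<xi> 1 - \<xi> 2)\<^sup>2 * (\<xi> 2 - \<xi> 3)\<^sup>2 * (\<xi> 1 - \<xi> 4)\<^sup>2 * (\<xi> 3 - \<xi> 4) * wedge (e_form w 1) (e_form w 2) u v
   - (\<xi> 1 - \<xi> 2)\<^sup>2 * (\<xi> 2 - \<xi> 3)\<^sup>2 * (\<xi> 1 - \<xi> 4) * (\<xi> 3 - \<xi> 4)\<^sup>2 * wedge (e_form w 2) (e_form w 3) u v
   + (\<xi> 1 - \<xi> 2) * (\<xi> 2 - \<xi> 3)\<^sup>2 * (\<xi> 1 - \<xi> 4)\<^sup>2 * (\<xi> 3 - \<xi> 4)\<^sup>2 * wedge (e_form w 3) (e_form w 4) u v
   + (\<xi> 1 - \<xi> 2)\<^sup>2 * (\<xi> 2 - \<xi> 3) * (\<xi> 1 - \<xi> 4)\<^sup>2 * (\<xi> 3 - \<xi> 4)\<^sup>2 * wedge (e_form w 4) (e_form w 1) u v"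
proof -
  define t where "t = complex_of_real (h3 x)"
  have t: "t = \<xi> 1 * \<xi> 3 + \<xi> 2 * \<xi> 4" by (simp add: t_def xi_def h3_def)
  have t': "t = \<xi> 1 * \<xi> 3 + \<xi> 4 * \<xi> 2" "t = \<xi> 3 * \<xi> 1 + \<xi> 2 * \<xi> 4" "t = \<xi> 3 * \<xi> 1 + \<xi> 4 * \<xi> 2"
    "t = \<xi> 2 * \<xi> 4 + \<xi> 1 * \<xi> 3" by (simp_all add: t)
  have h: "t \<noteq> 0" using h3 by (simp add: t_def)
  note c12 = mixed_coefficient[OF xi_neq(1,3) t h]
  note c14 = mixed_coefficient[OF xi_neq(1,4) t'(1) h]
  note c32 = mixed_coefficient[OF xi_neq(2,3) t'(2) h]
  note c34 = mixed_coefficient[OF xi_neq(2,4) t'(3) h]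
  note c13 = equal_parity_coefficient[OF xi_neq(1,3) t h]
  note c24 = equal_parity_coefficient[OF xi_neq(3,1) t'(4) h]
  have expand: "A_plus x z u v =
      mixed_coeff (\<xi> 1) (\<xi> 3) (\<xi> 2) (\<xi> 4) * wedge (e_form w 1) (e_form w 2) u v
    + mixed_coeff (\<xi> 1) (\<xi> 3) (\<xi> 4) (\<xi> 2) * wedge (e_form w 1) (e_form w 4) u v
    + mixed_coeff (\<xi> 3) (\<xi> 1) (\<xi> 2) (\<xi> 4) * wedge (e_form w 3) (e_form w 2) u v
    + mixed_coeff (\<xi> 3) (\<xi> 1) (\<xi> 4) (\<xi> 2) * wedge (e_form w 3) (e_form w 4) u v
    + equal_parity_coeff (\<xi> 1) (\<xi> 3) (\<xi> 2) (\<xi> 4) * wedge (e_form w 1) (e_form w 3) u v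
    + equal_parity_coeff (\<xi> 2) (\<xi> 4) (\<xi> 1) (\<xi> 3) * wedge (e_form w 2) (e_form w 4) u v"
    unfolding A_plus_eq_sum wedge_def e_form_z mixed_coeff_def equal_parity_coeff_def
    by Groebner_Basis.algebra
  have "4 * (of_real ((h3 x)\<^sup>2 / 4) * A_plus x z u v) = t\<^sup>2 * A_plus x z u v" by (simp add: t_def)
  also have "\<dots> =
      (t\<^sup>2 * mixed_coeff (\<xi> 1) (\<xi> 3) (\<xi> 2) (\<xi> 4)) * wedge (e_form w 1) (e_form w 2) u v
    + (t\<^sup>2 * mixed_coeff (\<xi> 1) (\<xi> 3) (\<xi> 4) (\<xi> 2)) * wedge (e_form w 1) (e_form w 4) u v
    + (t\<^sup>2 * mixed_coeff (\<xi> 3) (\<xi> 1) (\<xi> 2) (\<xi> 4)) * wedge (e_form w 3) (e_form w 2) u v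
    + (t\<^sup>2 * mixed_coeff (\<xi> 3) (\<xi> 1) (\<xi> 4) (\<xi> 2)) * wedge (e_form w 3) (e_form w 4) u v"
    unfolding expand c13 c24 by (simp add: algebra_simps)
  finally show ?thesis unfolding c12 c14 c32 c34 wedge_def by Groebner_Basis.algebra
qed

lemma omega_form_in_w:
  "of_real (disc x * (h3 x)\<^sup>2) / (4 * \<i> * of_real (disc_sqrt x)) * omega_form x z u v =
    - ((\<xi> 1 - \<xi> 2)\<^sup>2 * (\<xi> 1 - \<xi> 3) * (\<xi> 2 - \<xi> 3) * (\<xi> 1 - \<xi> 4)\<^sup>2 * (\<xi> 3 - \<xi> 4) * dwdwbar w 1 1 u v
     + (\<xi> 1 - \<xi> 2)\<^sup>2 * (\<xi> 2 - \<xi> 3)\<^sup>2 * (\<xi> 1 - \<xi> 4) * (\<xi> 2 - \<xi> 4) * (\<xi> 3 - \<xi> 4) * dwdwbar w 2 2 u v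
     + (\<xi> 1 - \<xi> 2) * (\<xi> 1 - \<xi> 3) * (\<xi> 2 - \<xi> 3)\<^sup>2 * (\<xi> 1 - \<xi> 4) * (\<xi> 3 - \<xi> 4)\<^sup>2 * dwdwbar w 3 3 u v
     + (\<xi> 1 - \<xi> 2) * (\<xi> 2 - \<xi> 3) * (\<xi> 1 - \<xi> 4)\<^sup>2 * (\<xi> 2 - \<xi> 4) * (\<xi> 3 - \<xi> 4)\<^sup>2 * dwdwbar w 4 4 u v)"
proof -
  define t where "t = complex_of_real (h3 x)"
  have t: "t = \<xi> 1 * \<xi> 3 + \<xi> 2 * \<xi> 4" by (simp add: t_def xi_def h3_def)
  have t': "t = \<xi> 1 * \<xi> 3 + \<xi> 4 * \<xi> 2" "t = \<xi> 3 * \<xi> 1 + \<xi> 2 * \<xi> 4" "t = \<xi> 3 * \<xi> 1 + \<xi> 4 * \<xi> 2"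
    "t = \<xi> 2 * \<xi> 4 + \<xi> 1 * \<xi> 3" "t = \<xi> 4 * \<xi> 2 + \<xi> 1 * \<xi> 3" by (simp_all add: t)
  have h: "t \<noteq> 0" using h3 by (simp add: t_def)
  have cnj_tau: "cnj (\<tau> (\<xi> i) (\<xi> j) (\<xi> k) (\<xi> l)) = \<tau> (\<xi> i) (\<xi> j) (\<xi> k) (\<xi> l)" for i j k l
    by (simp add: tau_def xi_def)
  define H where "H p q = wedge (e_form w p) (conj_form (e_form w q)) u v" for p q
  note d1 = hermitian_diag[OF xi_neq(1,3) t h]
  note d2 = hermitian_diag[OF xi_neq(3,1) t'(4) h]
  note d3 = hermitian_diag[OF xi_neq(2,3) t'(2) h]
  note d4 = hermitian_diag[OF xi_neq(4,1) t'(5) h]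
  note o13 = hermitian_equal_parity[OF xi_neq(1,3) t h]
  note o24 = hermitian_equal_parity[OF xi_neq(3,1) t'(4) h]
  note m12 = hermitian_mixed[OF xi_neq(1,3) t h]
  note m14 = hermitian_mixed[OF xi_neq(1,4) t'(1) h]
  note m32 = hermitian_mixed[OF xi_neq(2,3) t'(2) h]
  note m34 = hermitian_mixed[OF xi_neq(2,4) t'(3) h]
  let ?d = "\<lambda>a c b d. (a - b) * (a - c) * (a - d) + (b - a) * (b - c) * (b - d) * \<tau> b d a c * \<tau> b d a c
    + (d - a) * (d - b) * (d - c) * \<tau> d b a c * \<tau> d b a c"
  let ?o = "\<lambda>a c b d. (b - a) * (b - c) * (b - d) * \<tau> b d a c * \<tau> b d c a
    + (d - a) * (d - b) * (d - c) * \<tau> d b a c * \<tau> d b c a"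
  let ?m = "\<lambda>a c b d. (a - b) * (a - c) * (a - d) * \<tau> a c b d + (b - a) * (b - c) * (b - d) * \<tau> b d a c"
  have expand: "of_real (disc x) / (\<i> * of_real (disc_sqrt x)) * omega_form x z u v =
      ?d (\<xi> 1) (\<xi> 3) (\<xi> 2) (\<xi> 4) * H 1 1 + ?d (\<xi> 2) (\<xi> 4) (\<xi> 1) (\<xi> 3) * H 2 2
    + ?d (\<xi> 3) (\<xi> 1) (\<xi> 2) (\<xi> 4) * H 3 3 + ?d (\<xi> 4) (\<xi> 2) (\<xi> 1) (\<xi> 3) * H 4 4
    + ?o (\<xi> 1) (\<xi> 3) (\<xi> 2) (\<xi> 4) * (H 1 3 + H 3 1) + ?o (\<xi> 2) (\<xi> 4) (\<xi> 1) (\<xi> 3) * (H 2 4 + H 4 2)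
    + ?m (\<xi> 1) (\<xi> 3) (\<xi> 2) (\<xi> 4) * (H 1 2 + H 2 1) + ?m (\<xi> 1) (\<xi> 3) (\<xi> 4) (\<xi> 2) * (H 1 4 + H 4 1)
    + ?m (\<xi> 3) (\<xi> 1) (\<xi> 2) (\<xi> 4) * (H 2 3 + H 3 2) + ?m (\<xi> 3) (\<xi> 1) (\<xi> 4) (\<xi> 2) * (H 3 4 + H 4 3)"
    unfolding omega_form_eq_sum H_def wedge_def conj_form_def e_form_z complex_cnj_add
        complex_cnj_mult cnj_tau
    by Groebner_Basis.algebra
  have "4 * (of_real (disc x * (h3 x)\<^sup>2) / (4 * \<i> * of_real (disc_sqrt x)) * omega_form x z u v)
    = t\<^sup>2 * (of_real (disc x) / (\<i> * of_real (disc_sqrt x)) * omega_form x z u v)"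
    by (simp add: t_def)
  also have "\<dots> = (t\<^sup>2 * ?d (\<xi> 1) (\<xi> 3) (\<xi> 2) (\<xi> 4)) * H 1 1 + (t\<^sup>2 * ?d (\<xi> 2) (\<xi> 4) (\<xi> 1) (\<xi> 3)) * H 2 2
    + (t\<^sup>2 * ?d (\<xi> 3) (\<xi> 1) (\<xi> 2) (\<xi> 4)) * H 3 3 + (t\<^sup>2 * ?d (\<xi> 4) (\<xi> 2) (\<xi> 1) (\<xi> 3)) * H 4 4"
    unfolding expand o13 o24 m12 m14 m32 m34 by Groebner_Basis.algebra
  also have "\<dots> = 4 * (- ((\<xi> 1 - \<xi> 2)\<^sup>2 * (\<xi> 1 - \<xi> 3) * (\<xi> 2 - \<xi> 3) * (\<xi> 1 - \<xi> 4)\<^sup>2 * (\<xi> 3 - \<xi> 4) * H 1 1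
     - (\<xi> 1 - \<xi> 2)\<^sup>2 * (\<xi> 2 - \<xi> 3)\<^sup>2 * (\<xi> 1 - \<xi> 4) * (\<xi> 2 - \<xi> 4) * (\<xi> 3 - \<xi> 4) * H 2 2
     + (\<xi> 1 - \<xi> 2) * (\<xi> 1 - \<xi> 3) * (\<xi> 2 - \<xi> 3)\<^sup>2 * (\<xi> 1 - \<xi> 4) * (\<xi> 3 - \<xi> 4)\<^sup>2 * H 3 3
     - (\<xi> 1 - \<xi> 2) * (\<xi> 2 - \<xi> 3) * (\<xi> 1 - \<xi> 4)\<^sup>2 * (\<xi> 2 - \<xi> 4) * (\<xi> 3 - \<xi> 4)\<^sup>2 * H 4 4))"
    unfolding d1 d2 d3 d4 by Groebner_Basis.algebra
  finally have "of_real (disc x * (h3 x)\<^sup>2) / (4 * \<i> * of_real (disc_sqrt x)) * omega_form x z u v =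
    - ((\<xi> 1 - \<xi> 2)\<^sup>2 * (\<xi> 1 - \<xi> 3) * (\<xi> 2 - \<xi> 3) * (\<xi> 1 - \<xi> 4)\<^sup>2 * (\<xi> 3 - \<xi> 4) * H 1 1
     - (\<xi> 1 - \<xi> 2)\<^sup>2 * (\<xi> 2 - \<xi> 3)\<^sup>2 * (\<xi> 1 - \<xi> 4) * (\<xi> 2 - \<xi> 4) * (\<xi> 3 - \<xi> 4) * H 2 2
     + (\<xi> 1 - \<xi> 2) * (\<xi> 1 - \<xi> 3) * (\<xi> 2 - \<xi> 3)\<^sup>2 * (\<xi> 1 - \<xi> 4) * (\<xi> 3 - \<xi> 4)\<^sup>2 * H 3 3
     - (\<xi> 1 - \<xi> 2) * (\<xi> 2 - \<xi> 3) * (\<xi> 1 - \<xi> 4)\<^sup>2 * (\<xi> 2 - \<xi> 4) * (\<xi> 3 - \<xi> 4)\<^sup>2 * H 4 4)"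
    by (simp only: mult_left_cancel[of "4::complex"] zero_neq_numeral[symmetric] not_False_eq_True)
  moreover have "H 1 1 = dwdwbar w 1 1 u v" "H 2 2 = - dwdwbar w 2 2 u v"
    "H 3 3 = dwdwbar w 3 3 u v" "H 4 4 = - dwdwbar w 4 4 u v"
    by (auto simp: H_def dwdwbar_def e_form_def wedge_def conj_form_def)
  ultimately show ?thesis by (simp only: mult_minus_right diff_minus_eq_add)
qed

end
end


section \<open>The quartic and its roots\<close>

abbreviation (input) rat_poly_eval :: "rat poly \<Rightarrow> real \<Rightarrow> real" where
  "rat_poly_eval f r \<equiv> poly (map_poly of_rat f) r"

lemma rat_poly_eval_pCons [simp]: "rat_poly_eval (pCons c f) r = of_rat c + r * rat_poly_eval f r"
  by (simp add: Polynomial.map_poly_pCons[of of_rat, OF of_rat_0])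

lemma rat_poly_eval_add [simp]: "rat_poly_eval (f + g) r = rat_poly_eval f r + rat_poly_eval g r"
proof (induction f arbitrary: g)
  case (pCons c f)
  show ?case by (cases g rule: pCons_cases) (simp add: pCons.IH of_rat_add distrib_left add.assoc
      add.left_commute)
qed simp

lemma rat_poly_eval_smult [simp]: "rat_poly_eval (Polynomial.smult c f) r
    = of_rat c * rat_poly_eval f r"
  by (induction f) (simp_all add: of_rat_mult algebra_simps)

lemma rat_poly_eval_mult [simp]: "rat_poly_eval (f * g) r = rat_poly_eval f r * rat_poly_eval g r"
  by (induction f) (simp_all add: algebra_simps)

lemma rat_poly_eval_1 [simp]: "rat_poly_eval 1 r = 1"
  using rat_poly_eval_pCons[of 1 0 r] by (simp add: one_pCons)

lemma rat_poly_eval_uminus [simp]: "rat_poly_eval (- f) r = - rat_poly_eval f r"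
  using rat_poly_eval_smult[of "- 1" f r] by simp

lemma rat_poly_eval_diff [simp]: "rat_poly_eval (f - g) r = rat_poly_eval f r - rat_poly_eval g r"
  using rat_poly_eval_add[of f "- g" r] by simp

lemma rat_poly_eval_altdef:
  assumes "Polynomial.degree f < n"
  shows "rat_poly_eval f r = (\<Sum>k<n. of_rat (Polynomial.coeff f k) * r ^ k)"
proof -
  have "rat_poly_eval f r = (\<Sum>k\<le>Polynomial.degree f. of_rat (Polynomial.coeff f k) * r ^ k)"
    by (simp add: poly_altdef degree_map_poly coeff_map_poly)
  also have "\<dots> = (\<Sum>k<n. of_rat (Polynomial.coeff f k) * r ^ k)"
    using assms by (intro sum.mono_neutral_left) (auto simp: coeff_eq_0)
  finally show ?thesis .
qed

lemma interpolating_poly_exists: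
  fixes t :: "real \<Rightarrow> real"
  assumes "finite A"
  shows "\<exists>f. \<forall>a\<in>A. poly f a = t a"
  using assms
proof (induction A)
  case (insert a A)
  then obtain f where f: "\<And>b. b \<in> A \<Longrightarrow> poly f b = t b" by blast
  define g where "g = (\<Prod>b\<in>A. [:- b, 1:])"
  have g: "poly g b = (\<Prod>c\<in>A. b - c)" for b by (simp add: g_def poly_prod)
  then have "poly g a \<noteq> 0" using insert by auto
  moreover have "poly g b = 0" if "b \<in> A" for b using that insert by (auto simp: g)
  ultimately have "\<forall>b\<in>insert a A. poly (f + Polynomial.smult ((t a - poly f a) / poly g a) g) b = t b"
    using f by auto
  then show ?case by blast
qed auto

lemma index_cases:
  assumes "j \<in> {1..4::nat}"
  obtains "j = 1" | "j = 2" | "j = 3" | "j = 4"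
proof -
  have "j = 1 \<or> j = 2 \<or> j = 3 \<or> j = 4" using assms by (simp; arith)
  then show ?thesis using that by blast
qed

locale quartic_roots =
  fixes p0 p1 p2 p4 :: rat and x :: "nat \<Rightarrow> real"
  assumes lead_nz: "p4 \<noteq> 0" and irred: "Factorial_Ring.irreducible [:p0, p1, p2, 0, p4:]"
    and roots: "\<And>j. j \<in> {1..4} \<Longrightarrow> rat_poly_eval [:p0, p1, p2, 0, p4:] (x j) = 0"
    and ordered: "x 1 > x 2" "x 2 > x 3" "x 3 > x 4"
begin

lemma inj_x: "inj_on x {1..4}"
proof -
  have "{1..4::nat} = {1, 2, 3, 4}" by auto
  then show ?thesis using ordered by (auto simp: inj_on_def)
qed

lemma root_eq:
  assumes "j \<in> {1..4}"
  shows "of_rat p4 * x j ^ 4 = - (of_rat p2 * x j ^ 2 + of_rat p1 * x j + of_rat p0)"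
  using roots[OF assms] by (simp add: algebra_simps power2_eq_square power4_eq_xxxx)

lemma elementary_symmetric:
  "x 1 + x 2 + x 3 + x 4 = 0"
  "x 1 * x 2 + x 1 * x 3 + x 1 * x 4 + x 2 * x 3 + x 2 * x 4 + x 3 * x 4 = of_rat (p2 / p4)"
  "x 1 * x 2 * x 3 + x 1 * x 2 * x 4 + x 1 * x 3 * x 4 + x 2 * x 3 * x 4 = - of_rat (p1 / p4)"
  "x 1 * x 2 * x 3 * x 4 = of_rat (p0 / p4)"
proof -
  define e1 e2 e3 e4 where "e1 = x 1 + x 2 + x 3 + x 4"
    and "e2 = x 1 * x 2 + x 1 * x 3 + x 1 * x 4 + x 2 * x 3 + x 2 * x 4 + x 3 * x 4"
    and "e3 = x 1 * x 2 * x 3 + x 1 * x 2 * x 4 + x 1 * x 3 * x 4 + x 2 * x 3 * x 4"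
    and "e4 = x 1 * x 2 * x 3 * x 4"
  let ?p4 = "real_of_rat p4"
  \<comment> \<open>The difference of \<open>P\<close> and \<open>p4 * (\<Prod>j. [:- x j, 1:])\<close>.\<close>
  define q where "q = [:of_rat p0 - ?p4 * e4, of_rat p1 + ?p4 * e3, of_rat p2 - ?p4 * e2, ?p4 * e1:]"
  have "q = 0"
  proof (rule poly_eqI_degree[of "x ` {1..4}"])
    fix r assume "r \<in> x ` {1..4}"
    then obtain j where j: "j \<in> {1..4}" "r = x j" by blast
    then have "(r - x 1) * (r - x 2) * (r - x 3) * (r - x 4) = 0"
    proof -
      from j show ?thesis by (elim index_cases) auto
    qed
    then have "?p4 * r ^ 4 = ?p4 * (e1 * r ^ 3 - e2 * r ^ 2 + e3 * r - e4)"
      unfolding e1_def e2_def e3_def e4_def by Groebner_Basis.algebra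
    with root_eq[OF j(1)] show "poly q r = poly 0 r"
      by (simp add: q_def j(2) algebra_simps power2_eq_square power3_eq_cube)
  next
    have "card (x ` {1..4}) = 4" using inj_x by (simp add: card_image)
    moreover have "Polynomial.degree q \<le> 3" unfolding q_def by
        (intro degree_pCons_le[THEN order_trans]) auto
    ultimately show "Polynomial.degree q < card (x ` {1..4})"
        "Polynomial.degree (0 :: real poly) < card (x ` {1..4})" by auto
  qed
  then have *: "?p4 * e1 = 0" "?p4 * e2 = of_rat p2" "?p4 * e3 = - of_rat p1" "?p4 * e4 = of_rat p0"
    by (simp_all add: q_def)
  show "x 1 + x 2 + x 3 + x 4 = 0"
    "x 1 * x 2 + x 1 * x 3 + x 1 * x 4 + x 2 * x 3 + x 2 * x 4 + x 3 * x 4 = of_rat (p2 / p4)"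
    "x 1 * x 2 * x 3 + x 1 * x 2 * x 4 + x 1 * x 3 * x 4 + x 2 * x 3 * x 4 = - of_rat (p1 / p4)"
    "x 1 * x 2 * x 3 * x 4 = of_rat (p0 / p4)"
    using * lead_nz unfolding e1_def[symmetric] e2_def[symmetric] e3_def[symmetric] e4_def[symmetric]
    by (simp_all add: of_rat_divide field_simps)
qed

lemma sum_1_4: "(\<Sum>j\<in>{1..4}. f j) = f 1 + f 2 + f 3 + f (4 :: nat)" for f :: "nat \<Rightarrow> 'b::comm_monoid_add"
proof -
  have "{1..4::nat} = {1, 2, 3, 4}" by auto
  then show ?thesis by (simp add: add.assoc)
qed

text \<open>Small exponents are covered by the elementary symmetric functions; the equation of the roots
  expresses each further power sum through earlier ones.\<close>
lemma power_sum_rational: "(\<Sum>j\<in>{1..4}. x j ^ n) \<in> \<rat>"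
proof (induction n rule: less_induct)
  case (less n)
  consider "n = 0" | "n = 1" | "n = 2" | "n = 3" | m where "n = m + 4"
  proof -
    have "n = 0 \<or> n = 1 \<or> n = 2 \<or> n = 3 \<or> n = (n - 4) + 4" by linarith
    then show ?thesis using that by blast
  qed
  then show ?case
  proof cases
    case 3
    have "(\<Sum>j\<in>{1..4}. x j ^ 2) = - 2 * of_rat (p2 / p4)"
      using elementary_symmetric(1,2) unfolding sum_1_4 by Groebner_Basis.algebra
    then show ?thesis using 3 by simp
  next
    case 4
    have "(\<Sum>j\<in>{1..4}. x j ^ 3) = - 3 * of_rat (p1 / p4)"
      using elementary_symmetric(1,3) unfolding sum_1_4 by Groebner_Basis.algebra
    then show ?thesis using 4 by simp
  next
    case (5 m)
    have "x j ^ n = - of_rat (p2 / p4) * x j ^ (m + 2) - of_rat (p1 / p4) * x j ^ (m + 1)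
        - of_rat (p0 / p4) * x j ^ m"
      if "j \<in> {1..4}" for j
    proof -
      have "of_rat p4 * x j ^ n = x j ^ m * (of_rat p4 * x j ^ 4)"
        by (simp add: 5 power_add)
      also have "\<dots> = of_rat p4 * (- of_rat (p2 / p4) * x j ^ (m + 2)
          - of_rat (p1 / p4) * x j ^ (m + 1) - of_rat (p0 / p4) * x j ^ m)"
        unfolding root_eq[OF that] using lead_nz by
            (simp add: of_rat_divide field_simps power2_eq_square)
      finally show ?thesis using lead_nz by simp
    qed
    then have "(\<Sum>j\<in>{1..4}. x j ^ n) = - of_rat (p2 / p4) * (\<Sum>j\<in>{1..4}. x j ^ (m + 2))
        - of_rat (p1 / p4) * (\<Sum>j\<in>{1..4}. x j ^ (m + 1)) - of_rat (p0 / p4) * (\<Sum>j\<in>{1..4}. x j ^ m)"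
      by (simp add: sum_subtractf sum_distrib_left sum_negf)
    then show ?thesis using less[of m] less[of "m + 1"] less[of "m + 2"] 5
      by (simp del: power_Suc)
  qed (use elementary_symmetric(1) in \<open>auto simp: sum_1_4 simp del: One_nat_def\<close>)
qed

lemma sum_rat_poly_eval_rational: "(\<Sum>j\<in>{1..4}. rat_poly_eval f (x j)) \<in> \<rat>"
proof -
  have "(\<Sum>j\<in>{1..4}. rat_poly_eval f (x j))
      = (\<Sum>j\<in>{1..4}. \<Sum>k<Suc (Polynomial.degree f). of_rat (Polynomial.coeff f k) * x j ^ k)"
    by (intro sum.cong refl rat_poly_eval_altdef) simp
  also have "\<dots> = (\<Sum>k<Suc (Polynomial.degree f). of_rat (Polynomial.coeff f k) * (\<Sum>j\<in>{1..4}. x j ^ k))"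
    unfolding sum_distrib_left by (rule sum.swap)
  also have "\<dots> \<in> \<rat>" by (rule Rats_sum, rule Rats_mult[OF Rats_of_rat power_sum_rational])
  finally show ?thesis .
qed

text \<open>The polynomial is the derivative of the quartic divided by its leading coefficient.\<close>
lemma mu_rational_poly:
  obtains m where "\<And>j. j \<in> {1..4} \<Longrightarrow> mu x j = rat_poly_eval m (x j)"
proof -
  define e where "e = p2 / p4"
  have "mu x j = rat_poly_eval [:p1 / p4, 2 * e, 0, 4:] (x j)" if "j \<in> {1..4}" for j
  proof -
    have "mu x j = 4 * x j ^ 3 + 2 * of_rat (p2 / p4) * x j + of_rat (p1 / p4)"
      using that
    proof (cases rule: index_cases)
      case 1
      show ?thesis unfolding 1 mu_expand using elementary_symmetric(1-3) by Groebner_Basis.algebra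
    next
      case 2
      show ?thesis unfolding 2 mu_expand using elementary_symmetric(1-3) by Groebner_Basis.algebra
    next
      case 3
      show ?thesis unfolding 3 mu_expand using elementary_symmetric(1-3) by Groebner_Basis.algebra
    next
      case 4
      show ?thesis unfolding 4 mu_expand using elementary_symmetric(1-3) by Groebner_Basis.algebra
    qed
    then show ?thesis unfolding e_def[symmetric] by (simp add: power3_eq_cube of_rat_mult algebra_simps)
  qed
  then show ?thesis by (rule that)
qed

lemma root_iff: "rat_poly_eval [:p0, p1, p2, 0, p4:] r = 0 \<longleftrightarrow> r \<in> x ` {1..4}"
proof
  assume "rat_poly_eval [:p0, p1, p2, 0, p4:] r = 0"
  then have "of_rat p4 * r ^ 4 + of_rat p2 * r ^ 2 + of_rat p1 * r + of_rat p0 = 0"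
    by (simp add: algebra_simps power2_eq_square power4_eq_xxxx)
  moreover have "of_rat p2 = of_rat p4 * real_of_rat (p2 / p4)"
      "of_rat p1 = of_rat p4 * real_of_rat (p1 / p4)"
    "of_rat p0 = of_rat p4 * real_of_rat (p0 / p4)"
    using lead_nz by (simp_all add: of_rat_divide)
  ultimately have "of_rat p4 * ((r - x 1) * (r - x 2) * (r - x 3) * (r - x 4)) = 0"
    using elementary_symmetric by Groebner_Basis.algebra
  then have "r = x 1 \<or> r = x 2 \<or> r = x 3 \<or> r = x 4" using lead_nz by simp
  then show "r \<in> x ` {1..4}" by (auto simp del: One_nat_def)
qed (use roots in auto)

text \<open>An automorphism that exchanges \<open>x\<^sub>3\<close> and \<open>x\<^sub>4\<close> maps \<open>h\<^sub>3\<close> to \<open>h\<^sub>4\<close>, but the two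
  differ by \<open>(x\<^sub>1 - x\<^sub>2) (x\<^sub>3 - x\<^sub>4)\<close>.\<close>
lemma h3_nonzero:
  assumes "galois_group (rat_adjoin (x ` {1..4})) \<cong> sym_group 4"
  shows "h3 x \<noteq> 0"
proof
  assume h3: "h3 x = 0"
  let ?K = "rat_adjoin (x ` {1..4})"
  have incl: "x j \<in> ?K" if "j \<in> {1..4}" for j using that by (intro rat_adjoin_incl) auto
  have stable: "\<sigma> r \<in> x ` {1..4}" if \<sigma>: "\<sigma> \<in> carrier (galois_group ?K)" and r: "r \<in> x ` {1..4}" for \<sigma> r
  proof -
    have rK: "r \<in> ?K" using r by (rule rat_adjoin_incl)
    have "rat_poly_eval f r \<in> ?K \<and> \<sigma> (rat_poly_eval f r) = rat_poly_eval f (\<sigma> r)" for f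
    proof (induction f)
      case 0
      then show ?case using galois_groupD(4)[OF \<sigma>, of 0] by (simp add: rat_adjoin_0)
    next
      case (pCons c f)
      have c: "of_rat c \<in> ?K" by (simp add: rat_adjoin_Rats)
      from pCons rK have rf: "r * rat_poly_eval f r \<in> ?K" by (simp add: rat_adjoin_mult)
      have "rat_poly_eval (pCons c f) r \<in> ?K" using rat_adjoin_add[OF c rf] by simp
      moreover have "\<sigma> (rat_poly_eval (pCons c f) r) = rat_poly_eval (pCons c f) (\<sigma> r)"
        using pCons galois_groupD(2)[OF \<sigma> c rf] galois_groupD(3)[OF \<sigma> rK] galois_groupD(4)[OF \<sigma>] by simp
      ultimately show ?case ..
    qed
    from this[of "[:p0, p1, p2, 0, p4:]"] have "rat_poly_eval [:p0, p1, p2, 0, p4:] (\<sigma> r) = 0"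
      using r root_iff[of r] galois_groupD(4)[OF \<sigma>, of 0] by simp
    then show ?thesis by (simp only: root_iff)
  qed
  have "card (x ` {1..4}) = 4" using inj_x by (simp add: card_image)
  then have iso: "galois_group ?K \<cong> sym_group (card (x ` {1..4}))" using assms by simp
  have "Transposition.transpose (x 3) (x 4) permutes x ` {1..4}" by (rule permutes_swap_id) auto
  then obtain \<sigma> where \<sigma>: "\<sigma> \<in> carrier (galois_group ?K)" and
    "\<And>r. r \<in> x ` {1..4} \<Longrightarrow> \<sigma> r = Transposition.transpose (x 3) (x 4) r"
    using full_galois_group_realises_permutations[of "x ` {1..4}"] stable iso by auto
  then have perm: "\<sigma> (x 1) = x 1" "\<sigma> (x 2) = x 2" "\<sigma> (x 3) = x 4" "\<sigma> (x 4) = x 3"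
    using ordered by (auto simp: Transposition.transpose_def)
  have "\<sigma> (x 1 * x 3 + x 2 * x 4) = x 1 * x 4 + x 2 * x 3"
    using perm by (simp add: galois_groupD(2,3)[OF \<sigma>] incl rat_adjoin_mult del: One_nat_def)
  then have "x 1 * x 4 + x 2 * x 3 = 0"
    using h3 galois_groupD(4)[OF \<sigma>, of 0] by (simp add: h3_def)
  with h3 have "(x 1 - x 2) * (x 3 - x 4) = 0" by (simp add: h3_def algebra_simps)
  then show False using ordered by simp
qed

end


section \<open>The octic field\<close>

lemma field_embedding_rational:
  assumes emb: "field_embedding (rat_adjoin S) \<psi>" and "q \<in> \<rat>"
  shows "\<psi> q = q"
proof -
  have one: "\<psi> 1 = 1" and add: "\<And>a b. a \<in> rat_adjoin S \<Longrightarrow> b \<in> rat_adjoin S \<Longrightarrow> \<psi> (a + b) = \<psi> a + \<psi> b"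
    and mult: "\<And>a b. a \<in> rat_adjoin S \<Longrightarrow> b \<in> rat_adjoin S \<Longrightarrow> \<psi> (a * b) = \<psi> a * \<psi> b"
    using emb by (auto simp: field_embedding_def)
  have zero: "\<psi> 0 = 0" using add[OF rat_adjoin_0 rat_adjoin_0] by simp
  have nat: "\<psi> (of_nat n) = of_nat n" for n
    by (induction n) (simp_all add: zero one add rat_adjoin_1 rat_adjoin_of_nat)
  have int: "\<psi> (of_int k) = of_int k" for k
  proof (cases "k \<ge> 0")
    case True
    then show ?thesis using nat[of "nat k"] by simp
  next
    case False
    have "\<psi> (of_int k + of_nat (nat (- k))) = \<psi> (of_int k) + of_nat (nat (- k))"
      by (simp only: add rat_adjoin_of_int rat_adjoin_of_nat nat)
    moreover have "of_int k + of_nat (nat (- k)) = (0 :: complex)" using False by simp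
    ultimately have "\<psi> (of_int k) = - of_nat (nat (- k))" by (simp add: zero eq_neg_iff_add_eq_0)
    then show ?thesis using False by simp
  qed
  from \<open>q \<in> \<rat>\<close> obtain a b where ab: "b > 0" "q = of_int a / of_int b"
    by (auto elim: Rats_cases')
  then have "\<psi> q * of_int b = of_int a"
    using mult[OF rat_adjoin_Rats[OF \<open>q \<in> \<rat>\<close>] rat_adjoin_of_int[of b]] by (simp add: int)
  then have "\<psi> q = of_int a / of_int b" using \<open>b > 0\<close> by (intro eq_divide_imp) auto
  then show ?thesis by (simp only: ab(2))
qed

lemma field_embedding_poly:
  assumes emb: "field_embedding (rat_adjoin S) \<psi>" and "a \<in> rat_adjoin S"
    and "\<forall>k. Polynomial.coeff f k \<in> \<rat>"
  shows "poly f a \<in> rat_adjoin S \<and> \<psi> (poly f a) = poly f (\<psi> a)"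
  using assms(3)
proof (induction f)
  case 0
  then show ?case using field_embedding_rational[OF emb, of 0] by (simp add: rat_adjoin_0)
next
  case (pCons c f)
  have c: "c \<in> \<rat>" using pCons.prems[rule_format, of 0] by simp
  have "\<forall>k. Polynomial.coeff f k \<in> \<rat>" using pCons.prems[rule_format, of "Suc _"] by simp
  with pCons have IH: "poly f a \<in> rat_adjoin S" "\<psi> (poly f a) = poly f (\<psi> a)" by auto
  have "\<psi> (c + a * poly f a) = \<psi> c + \<psi> a * \<psi> (poly f a)"
    using emb rat_adjoin_Rats[OF c, of S] IH(1) assms(2)
    by (simp add: field_embedding_def rat_adjoin_mult)
  then show ?case
    using IH field_embedding_rational[OF emb c]
    by (simp add: rat_adjoin_add rat_adjoin_mult rat_adjoin_Rats c assms(2))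
qed

lemma field_embedding_algebraic_int:
  assumes emb: "field_embedding (rat_adjoin S) \<psi>" and "a \<in> rat_adjoin S" and "algebraic_int a"
  shows "algebraic_int (\<psi> a)"
proof -
  from \<open>algebraic_int a\<close> obtain f where f: "Polynomial.lead_coeff f = 1"
      "\<forall>i. Polynomial.coeff f i \<in> \<int>" "poly f a = 0"
    by (auto elim: algebraic_int.cases)
  then have "poly f (\<psi> a) = \<psi> 0"
    using field_embedding_poly[OF emb assms(2), of f] by (auto simp: Ints_subset_Rats[THEN subsetD])
  also have "\<dots> = 0" by (rule field_embedding_rational[OF emb]) simp
  finally show ?thesis using f by (intro algebraic_int.intros)
qed

lemma field_embedding_power:
  assumes emb: "field_embedding (rat_adjoin S) \<psi>" and "a \<in> rat_adjoin S"
  shows "\<psi> (a ^ k) = \<psi> a ^ k"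
  using field_embedding_poly[OF assms, of "Polynomial.monom 1 k"] by (simp add: poly_monom)

lemma of_real_of_rat: "complex_of_real (of_rat q) = of_rat q"
  by (cases q) (simp add: of_rat_rat)

lemma of_real_rat_poly_eval:
  "of_real (rat_poly_eval f r) = poly (map_poly of_rat f) (of_real r :: complex)"
  by (induction f) (simp_all add: Polynomial.map_poly_pCons[of of_rat, OF of_rat_0] of_real_of_rat)

lemma span_image_lessThan:
  fixes f :: "nat \<Rightarrow> 'v::real_vector"
  assumes "v \<in> span (f ` {..<n})"
  obtains c where "v = (\<Sum>k<n. c k *\<^sub>R f k)"
proof -
  let ?U = "{v. \<exists>c. v = (\<Sum>k<n. c k *\<^sub>R f k)}"
  have "span (f ` {..<n}) \<subseteq> ?U"
  proof (rule span_minimal)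
    show "f ` {..<n} \<subseteq> ?U"
    proof safe
      fix i assume "i < n"
      then have "f i = (\<Sum>k<n. (if k = i then 1 else 0) *\<^sub>R f k)"
        by (simp add: if_distrib if_distribR cong: if_cong)
      then show "\<exists>c. f i = (\<Sum>k<n. c k *\<^sub>R f k)" by (intro exI[of _ "\<lambda>k. if k = i then 1 else 0"])
    qed
    show "subspace ?U"
    proof (rule subspaceI)
      show "0 \<in> ?U" by (auto intro!: exI[of _ "\<lambda>_. 0"])
      show "u + v \<in> ?U" if "u \<in> ?U" "v \<in> ?U" for u v
      proof -
        from that obtain c d where "u = (\<Sum>k<n. c k *\<^sub>R f k)" "v = (\<Sum>k<n. d k *\<^sub>R f k)" by blast
        then have "u + v = (\<Sum>k<n. (c k + d k) *\<^sub>R f k)" by (simp add: scaleR_add_left sum.distrib)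
        then show ?thesis by (intro CollectI exI[of _ "\<lambda>k. c k + d k"])
      qed
      show "r *\<^sub>R v \<in> ?U" if "v \<in> ?U" for r v
      proof -
        from that obtain c where "v = (\<Sum>k<n. c k *\<^sub>R f k)" by blast
        then have "r *\<^sub>R v = (\<Sum>k<n. (r * c k) *\<^sub>R f k)" by (simp add: scaleR_sum_right)
        then show ?thesis by (intro CollectI exI[of _ "\<lambda>k. r * c k"])
      qed
    qed
  qed
  with assms that show ?thesis by blast
qed

lemma disc_sqrt_pos:
  assumes "x 1 > x 2" "x 2 > x 3" "x 3 > x 4"
  shows "disc_sqrt x > 0"
proof -
  have "x i > x j" if "i \<in> {1..4}" "j \<in> {i<..4}" for i j
  proof -
    have "j \<in> {1..4}" "i < j" using that by auto
    with that(1) show ?thesis using assms by (elim index_cases) (auto simp del: One_nat_def)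
  qed
  then show ?thesis unfolding disc_sqrt_def by (intro prod_pos ballI) simp
qed

context quartic_roots
begin

lemma rat_poly_eval_inverse:
  assumes j: "j \<in> {1..4}" and "rat_poly_eval h (x j) \<noteq> 0"
  obtains v where "rat_poly_eval v (x j) * rat_poly_eval h (x j) = 1"
proof -
  let ?P = "[:p0, p1, p2, 0, p4:]"
  have "\<not> ?P dvd h"
  proof
    assume "?P dvd h"
    then obtain g where "h = ?P * g" by (elim dvdE)
    then have "rat_poly_eval h (x j) = 0" using roots[OF j] by
        (simp only: rat_poly_eval_mult mult_zero_left)
    with assms(2) show False by simp
  qed
  moreover have "prime_elem ?P" using irred by (rule irreducible_imp_prime_elem)
  ultimately have "Rings.coprime ?P h" by (intro prime_elem_imp_coprime) auto
  then have "gcd ?P h = 1" by (rule coprime_imp_gcd_eq_1)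
  then obtain u v where "u * ?P + v * h = 1" using bezout_coefficients_fst_snd[of ?P h] by metis
  then have "rat_poly_eval (u * ?P + v * h) (x j) = 1" by (simp only: rat_poly_eval_1)
  then have "rat_poly_eval v (x j) * rat_poly_eval h (x j) = 1"
    unfolding rat_poly_eval_add rat_poly_eval_mult roots[OF j] by simp
  then show ?thesis by (rule that)
qed

lemma rat_poly_eval_reduce:
  assumes "j \<in> {1..4}"
  obtains g where "Polynomial.degree g < 4" "rat_poly_eval g (x j) = rat_poly_eval f (x j)"
proof -
  let ?P = "[:p0, p1, p2, 0, p4:]"
  have "?P \<noteq> 0" "Polynomial.degree ?P = 4" using lead_nz by simp_all
  then have "Polynomial.degree (f mod ?P) < 4" using degree_mod_less[of ?P f] by auto
  moreover have "rat_poly_eval f (x j) = rat_poly_eval (f div ?P * ?P + f mod ?P) (x j)"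
    by (simp only: div_mult_mod_eq)
  then have "rat_poly_eval (f mod ?P) (x j) = rat_poly_eval f (x j)"
    unfolding rat_poly_eval_add rat_poly_eval_mult roots[OF assms] by simp
  ultimately show ?thesis by (rule that)
qed

text \<open>Such expressions form a field: the inverse of \<open>f + g \<i> D\<close> is \<open>f - g \<i> D\<close> divided by the norm
  \<open>f\<^sup>2 + \<Delta> g\<^sup>2\<close>, a rational polynomial in \<open>x\<^sub>1\<close>, which is invertible because the quartic is
  irreducible.\<close>
lemma octic_field_elem:
  assumes disc: "disc x \<in> \<int>" and "a \<in> octic_field x"
  obtains f g where "Polynomial.degree f < 4" "Polynomial.degree g < 4"
    "a = of_real (rat_poly_eval f (x 1)) + \<i> * of_real (disc_sqrt x) * of_real (rat_poly_eval g (x 1))"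
proof -
  define D where "D = disc_sqrt x"
  obtain n where n: "disc x = of_int n" using disc by (auto elim: Ints_cases)
  then have D2: "D\<^sup>2 = of_rat (of_int n)" by (simp add: D_def disc_def)
  then have DD: "real_of_int n = D * D" by (simp add: power2_eq_square)
  have D: "D > 0" using ordered disc_sqrt_pos by (simp add: D_def)
  have "\<exists>f g. a = Complex (rat_poly_eval f (x 1)) (D * rat_poly_eval g (x 1))"
    using assms(2) unfolding octic_field_def
  proof (induction rule: rat_adjoin_induct)
    case one
    show ?case by (rule exI[of _ 1], rule exI[of _ 0]) (simp add: complex_eq_iff)
  next
    case (incl a)
    then consider "a = of_real (x 1)" | "a = \<i> * of_real (disc_sqrt x)" by blast
    then show ?case
    proof cases
      case 1
      show ?thesis by (rule exI[of _ "[:0, 1:]"], rule exI[of _ 0]) (simp add: 1 complex_eq_iff)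
    next
      case 2
      show ?thesis by (rule exI[of _ 0], rule exI[of _ 1]) (simp add: 2 complex_eq_iff D_def)
    qed
  next
    case (uminus a)
    then obtain f g where "a = Complex (rat_poly_eval f (x 1)) (D * rat_poly_eval g (x 1))" by blast
    then have "- a = Complex (rat_poly_eval (- f) (x 1)) (D * rat_poly_eval (- g) (x 1))"
      by (simp add: complex_eq_iff)
    then show ?case by blast
  next
    case (inverse a)
    then obtain f g where a: "a = Complex (rat_poly_eval f (x 1)) (D * rat_poly_eval g (x 1))" by blast
    define h where "h = f * f + Polynomial.smult (of_int n) (g * g)"
    have h: "rat_poly_eval h (x 1) = (rat_poly_eval f (x 1))\<^sup>2 + (D * rat_poly_eval g (x 1))\<^sup>2"
      by (simp add: h_def power_mult_distrib power2_eq_square DD)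
    have "rat_poly_eval h (x 1) \<noteq> 0"
      using \<open>a \<noteq> 0\<close> unfolding h a by (auto simp: sum_power2_eq_zero_iff complex_eq_iff)
    then obtain v where v: "rat_poly_eval v (x 1) * rat_poly_eval h (x 1) = 1"
      using rat_poly_eval_inverse[of 1] by auto
    have "inverse a = Complex (rat_poly_eval (v * f) (x 1)) (D * rat_poly_eval (- (v * g)) (x 1))"
    proof (rule inverse_unique)
      show "a * Complex (rat_poly_eval (v * f) (x 1)) (D * rat_poly_eval (- (v * g)) (x 1)) = 1"
        using v unfolding h by (simp add: a complex_eq_iff power2_eq_square algebra_simps)
    qed
    then show ?case by blast
  next
    case (add a b)
    then obtain f g f' g' where "a = Complex (rat_poly_eval f (x 1)) (D * rat_poly_eval g (x 1))"
      "b = Complex (rat_poly_eval f' (x 1)) (D * rat_poly_eval g' (x 1))" by blast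
    then have "a + b = Complex (rat_poly_eval (f + f') (x 1)) (D * rat_poly_eval (g + g') (x 1))"
      by (simp add: complex_eq_iff algebra_simps)
    then show ?case by blast
  next
    case (mult a b)
    then obtain f g f' g' where ab: "a = Complex (rat_poly_eval f (x 1)) (D * rat_poly_eval g (x 1))"
      "b = Complex (rat_poly_eval f' (x 1)) (D * rat_poly_eval g' (x 1))" by blast
    show ?case unfolding ab
      by (rule exI[of _ "f * f' - Polynomial.smult (of_int n) (g * g')"], rule
          exI[of _ "f * g' + g * f'"])
         (simp add: complex_eq_iff algebra_simps DD)
  qed
  then obtain f' g' where a: "a = Complex (rat_poly_eval f' (x 1)) (D * rat_poly_eval g' (x 1))" by
      blast
  obtain f where f: "Polynomial.degree f < 4" "rat_poly_eval f (x 1) = rat_poly_eval f' (x 1)"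
    using rat_poly_eval_reduce[of 1 f'] by auto
  obtain g where g: "Polynomial.degree g < 4" "rat_poly_eval g (x 1) = rat_poly_eval g' (x 1)"
    using rat_poly_eval_reduce[of 1 g'] by auto
  show ?thesis
    by (rule that[OF f(1) g(1)]) (simp add: a f(2) g(2) complex_eq_iff D_def del: One_nat_def)
qed

text \<open>If \<open>n\<close> clears the denominators of the monic quartic, then \<open>n x\<^sub>j\<close> is a root of the monic
  quartic whose coefficients are multiplied by powers of \<open>n\<close>.\<close>
lemma integral_multiple_of_roots:
  obtains n :: int where "n > 0" "\<And>j. j \<in> {1..4} \<Longrightarrow> algebraic_int (complex_of_real (of_int n * x j))"
proof -
  define d where "d q = snd (quotient_of q)" for q :: rat
  have d: "d q > 0" "of_int (d q) * real_of_rat q \<in> \<int>" for q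
  proof -
    obtain a b where ab: "quotient_of q = (a, b)" by (cases "quotient_of q")
    then have "b > 0" "q = of_int a / of_int b" using quotient_of_denom_pos quotient_of_div by blast+
    moreover have "d q = b" by (simp add: d_def ab)
    ultimately show "d q > 0" "of_int (d q) * real_of_rat q \<in> \<int>" by (simp_all add: of_rat_divide)
  qed
  define n where "n = d (p0 / p4) * d (p1 / p4) * d (p2 / p4)"
  have "n > 0" using d by (simp add: n_def)
  have mult: "of_int n * real_of_rat q \<in> \<int>" if "n = m * d q" for m q
    using Ints_mult[OF Ints_of_int[of m] d(2)[of q]] that by (simp add: mult.assoc)
  have n: "of_int n * real_of_rat (p0 / p4) \<in> \<int>" "of_int n * real_of_rat (p1 / p4) \<in> \<int>"
    "of_int n * real_of_rat (p2 / p4) \<in> \<int>"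
    by (rule mult[of "d (p1 / p4) * d (p2 / p4)"], simp add: n_def,
        rule mult[of "d (p0 / p4) * d (p2 / p4)"], simp add: n_def,
        rule mult[of "d (p0 / p4) * d (p1 / p4)"], simp add: n_def)
  have "algebraic_int (of_int n * x j)" if j: "j \<in> {1..4}" for j
  proof (rule algebraic_int.intros)
    let ?n = "real_of_int n"
    let ?q = "[:?n ^ 3 * (?n * of_rat (p0 / p4)), ?n ^ 2 * (?n * of_rat (p1 / p4)), ?n
        * (?n * of_rat (p2 / p4)), 0, 1:]"
    show "Polynomial.lead_coeff ?q = 1" by simp
    show "\<forall>i. Polynomial.coeff ?q i \<in> \<int>"
      using n by (auto simp: coeff_pCons split: nat.splits)
    have "x j ^ 4 = - (of_rat (p2 / p4) * x j ^ 2 + of_rat (p1 / p4) * x j + of_rat (p0 / p4))"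
      using root_eq[OF j] lead_nz by (simp add: of_rat_divide field_simps)
    then show "poly ?q (?n * x j) = 0"
      unfolding poly_pCons poly_0 by Groebner_Basis.algebra
  qed
  then show ?thesis by (intro that[OF \<open>n > 0\<close>] algebraic_int_of_real)
qed

end


section \<open>The coordinates \<open>z\<close> on the torus\<close>

(* The index 1 of a root or coordinate shall not be rewritten to Suc 0. *)
declare One_nat_def [simp del]

locale octic_torus = quartic_roots +
  fixes \<iota> :: "complex \<Rightarrow> 'v::real_vector" and \<phi> :: "nat \<Rightarrow> complex \<Rightarrow> complex" and z ::
      "nat \<Rightarrow> 'v \<Rightarrow> complex"
  assumes disc_int: "disc x \<in> \<int>"
    and tensor: "is_real_extension (octic_field x) \<iota>"
    and embedding: "\<And>j. j \<in> {1..4} \<Longrightarrow> field_embedding (octic_field x) (\<phi> j)"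
    and embedding_root: "\<And>j. j \<in> {1..4} \<Longrightarrow> \<phi> j (of_real (x 1)) = of_real (x j)"
    and embedding_disc: "\<And>j. j \<in> {1..4} \<Longrightarrow>
         \<phi> j (\<i> * of_real (disc_sqrt x)) = (- 1) ^ (j + 1) * (\<i> * of_real (disc_sqrt x))"
    and z_linear: "\<And>j. j \<in> {1..4} \<Longrightarrow> linear (z j)"
    and z_extends: "\<And>j a. j \<in> {1..4} \<Longrightarrow> a \<in> octic_field x \<Longrightarrow> z j (\<iota> a) = \<phi> j a"
begin

definition y :: complex where "y = \<i> * of_real (disc_sqrt x)"

text \<open>The sign by which the embedding \<open>\<phi>\<^sub>j\<close> changes \<open>y\<close>.\<close>
definition disc_sign :: "nat \<Rightarrow> real" where "disc_sign j = (- 1) ^ (j + 1)"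

lemma disc_sign_square: "disc_sign j * disc_sign j = 1"
  by (simp add: disc_sign_def flip: power_mult_distrib)

lemma D_pos: "disc_sqrt x > 0"
  using disc_sqrt_pos ordered .

lemma field_closed:
  "of_real (x 1) \<in> octic_field x" "y \<in> octic_field x"
  "a \<in> octic_field x \<Longrightarrow> b \<in> octic_field x \<Longrightarrow> a + b \<in> octic_field x"
  "a \<in> octic_field x \<Longrightarrow> b \<in> octic_field x \<Longrightarrow> a * b \<in> octic_field x"
  "a \<in> octic_field x \<Longrightarrow> - a \<in> octic_field x"
  "a \<in> octic_field x \<Longrightarrow> a ^ k \<in> octic_field x"
  "of_rat q \<in> octic_field x" "of_int m \<in> octic_field x" "0 \<in> octic_field x"
  unfolding octic_field_def y_def
  by (simp_all add: rat_adjoin_incl rat_adjoin_add rat_adjoin_mult rat_adjoin_uminus rat_adjoin_power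
      rat_adjoin_Rats rat_adjoin_of_int rat_adjoin_0)

lemmas embedding' = embedding[unfolded octic_field_def]

lemma embedding_mult:
  "j \<in> {1..4} \<Longrightarrow> a \<in> octic_field x \<Longrightarrow> b \<in> octic_field x \<Longrightarrow> \<phi> j (a * b) = \<phi> j a * \<phi> j b"
  and embedding_add:
  "j \<in> {1..4} \<Longrightarrow> a \<in> octic_field x \<Longrightarrow> b \<in> octic_field x \<Longrightarrow> \<phi> j (a + b) = \<phi> j a + \<phi> j b"
  using embedding by (auto simp: field_embedding_def)

lemma embedding_y: "j \<in> {1..4} \<Longrightarrow> \<phi> j y = of_real (disc_sign j) * y"
  using embedding_disc by (simp add: y_def disc_sign_def)

lemma embedding_power: "j \<in> {1..4} \<Longrightarrow> a \<in> octic_field x \<Longrightarrow> \<phi> j (a ^ k) = \<phi> j a ^ k"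
  using field_embedding_power[OF embedding'] by (simp add: octic_field_def)

lemma embedding_rat_poly_eval:
  assumes "j \<in> {1..4}"
  shows "of_real (rat_poly_eval f (x 1)) \<in> octic_field x"
    "\<phi> j (of_real (rat_poly_eval f (x 1))) = of_real (rat_poly_eval f (x j))"
proof -
  have "poly (map_poly of_rat f) (of_real (x 1)) \<in> octic_field x \<and>
      \<phi> j (poly (map_poly of_rat f) (of_real (x 1))) = poly (map_poly of_rat f) (\<phi> j (of_real (x 1)))"
    using field_embedding_poly[OF embedding'[OF assms], of "of_real (x 1)" "map_poly of_rat f"]
        field_closed(1)
    by (simp add: coeff_map_poly octic_field_def)
  then show "of_real (rat_poly_eval f (x 1)) \<in> octic_field x"
    "\<phi> j (of_real (rat_poly_eval f (x 1))) = of_real (rat_poly_eval f (x j))"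
    by (simp_all add: of_real_rat_poly_eval embedding_root[OF assms])
qed

lemma embedding_elem:
  assumes "j \<in> {1..4}"
  shows "\<phi> j (of_real (rat_poly_eval f (x 1)) + y * of_real (rat_poly_eval g (x 1)))
    = of_real (rat_poly_eval f (x j)) + of_real (disc_sign j) * y * of_real (rat_poly_eval g (x j))"
  using assms by (simp add: embedding_add embedding_mult embedding_rat_poly_eval embedding_y
      field_closed)

lemma iota_add: "a \<in> octic_field x \<Longrightarrow> b \<in> octic_field x \<Longrightarrow> \<iota> (a + b) = \<iota> a + \<iota> b"
  and iota_rat: "a \<in> octic_field x \<Longrightarrow> \<iota> (of_rat q * a) = of_rat q *\<^sub>R \<iota> a"
  and iota_span: "span (\<iota> ` octic_field x) = UNIV"
  using tensor by (auto simp: is_real_extension_def)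

lemma iota_0: "\<iota> 0 = 0"
  using iota_add[OF field_closed(9) field_closed(9)] by simp

lemma iota_uminus: "a \<in> octic_field x \<Longrightarrow> \<iota> (- a) = - \<iota> a"
  using iota_rat[of a "- 1"] by (simp add: of_rat_minus)

text \<open>The \<open>\<rat>\<close>-basis \<open>(N x\<^sub>1)\<^sup>k, y (N x\<^sub>1)\<^sup>k\<close>, \<open>k < 4\<close>.\<close>
definition basis_elem :: "int \<Rightarrow> nat \<Rightarrow> complex" where
  "basis_elem N k = of_real (of_int N * x 1) ^ (k mod 4) * y ^ (k div 4)"

lemma basis_elem_in_field: "basis_elem N k \<in> octic_field x"
proof -
  have "of_real (of_int N * x 1) \<in> octic_field x" using
      field_closed(4)[OF field_closed(8)[of N] field_closed(1)] by simp
  then show ?thesis by (simp add: basis_elem_def field_closed)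
qed

lemma span_basis:
  assumes "N > 0"
  shows "span ((\<lambda>k. \<iota> (basis_elem N k)) ` {..<8}) = UNIV"
proof -
  let ?S = "span ((\<lambda>k. \<iota> (basis_elem N k)) ` {..<8})"
  define good where "good a \<longleftrightarrow> a \<in> octic_field x \<and> \<iota> a \<in> ?S" for a
  have good_basis: "good (of_rat q * basis_elem N k)" if "k < 8" for q k
    using that by (auto simp: good_def iota_rat basis_elem_in_field field_closed intro: span_scale
        span_base)
  have good_sum: "good (\<Sum>k\<in>I. a k)" if "\<And>k. k \<in> I \<Longrightarrow> good (a k)" for a and I :: "nat set"
    using that by (induction I rule: infinite_finite_induct)
      (auto simp: good_def iota_0 iota_add field_closed intro: span_zero span_add)
  have "good a" if aF: "a \<in> octic_field x" for a
  proof -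
    obtain f g where deg: "Polynomial.degree f < 4" "Polynomial.degree g < 4"
      and a: "a = of_real (rat_poly_eval f (x 1)) + y * of_real (rat_poly_eval g (x 1))"
      using octic_field_elem[OF disc_int aF] unfolding y_def .
    define b where "b f' k = (of_rat (Polynomial.coeff f' k / of_int N ^ k) :: complex)" for f' k
    have b: "b f' k * of_real (of_int N * x 1) ^ k
        = of_rat (Polynomial.coeff f' k) * of_real (x 1) ^ k" for f' k
      using \<open>N > 0\<close> by (simp add: b_def of_rat_divide of_rat_power power_mult_distrib)
    have "a = (\<Sum>k<4. b f k * basis_elem N k) + (\<Sum>k<4. b g k * basis_elem N (k + 4))"
    proof -
      have "of_real (rat_poly_eval f' (x 1)) = (\<Sum>k<4. b f' k * of_real (of_int N * x 1) ^ k)"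
        if "Polynomial.degree f' < 4" for f'
        unfolding rat_poly_eval_altdef[OF that] b by (simp add: of_real_of_rat)
      moreover have "(\<Sum>k<4. b f k * basis_elem N k) = (\<Sum>k<4. b f k * of_real (of_int N * x 1) ^ k)"
        "(\<Sum>k<4. b g k * basis_elem N (k + 4)) = y * (\<Sum>k<4. b g k * of_real (of_int N * x 1) ^ k)"
        unfolding sum_distrib_left by (intro sum.cong refl; simp add: basis_elem_def)+
      ultimately show ?thesis using deg by (simp only: a)
    qed
    moreover have "good (\<Sum>k<4. b f k * basis_elem N k)" "good (\<Sum>k<4. b g k * basis_elem N (k + 4))"
      unfolding b_def by (intro good_sum good_basis; simp)+
    ultimately show ?thesis by (auto simp: good_def iota_add field_closed intro: span_add)
  qed
  then have "\<iota> ` octic_field x \<subseteq> ?S" by (auto simp: good_def)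
  then have "span (\<iota> ` octic_field x) \<subseteq> ?S" by (rule span_minimal) simp
  then show ?thesis using iota_span by auto
qed

lemma z_basis:
  assumes "j \<in> {1..4}"
  shows "z j (\<iota> (basis_elem N k)) = of_real (of_int N * x j) ^ (k mod 4)
      * (of_real (disc_sign j) * y) ^ (k div 4)"
proof -
  have N: "of_real (of_int N * x 1) \<in> octic_field x" using
      field_closed(4)[OF field_closed(8)[of N] field_closed(1)] by simp
  have "\<phi> j (of_int N * of_real (x 1)) = of_int N * of_real (x j)"
    using field_embedding_rational[OF embedding'[OF assms], of "of_int N"]
    by (simp add: embedding_mult[OF assms] field_closed embedding_root[OF assms])
  then show ?thesis
    using N by (simp add: z_extends[OF assms] basis_elem_in_field) 
      (simp add: basis_elem_def embedding_mult[OF assms] embedding_power[OF assms]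
          embedding_y[OF assms] field_closed)
qed

text \<open>The real and the imaginary part of \<open>z\<^sub>j v\<close> are, up to nonzero factors, values at \<open>x\<^sub>j\<close> of two
  real polynomials of degree at most 3 made of the coordinates of \<open>v\<close>. Four zeros are too many.\<close>
lemma z_eq_0_imp:
  assumes "\<And>j. j \<in> {1..4} \<Longrightarrow> z j v = 0"
  shows "v = 0"
proof -
  obtain c where c: "v = (\<Sum>k<8. c k *\<^sub>R \<iota> (basis_elem 1 k))"
    using span_image_lessThan[of v "\<lambda>k. \<iota> (basis_elem 1 k)" 8] span_basis[of 1] by auto
  have sum8: "(\<Sum>k<8. f k) = f 0 + f 1 + f 2 + f 3 + f 4 + f 5 + f 6 + f 7" for f ::
      "nat \<Rightarrow> 'b::comm_monoid_add"
  proof -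
    have "{..<8::nat} = {0, 1, 2, 3, 4, 5, 6, 7}" by auto
    then show ?thesis by (simp add: add.assoc)
  qed
  have roots: "poly [:c 0, c 1, c 2, c 3:] (x j) = 0" "poly [:c 4, c 5, c 6, c 7:] (x j) = 0" if j:
      "j \<in> {1..4}" for j
  proof -
    have "0 = (\<Sum>k<8. c k *\<^sub>R (of_real (x j) ^ (k mod 4) * (of_real (disc_sign j) * y) ^ (k div 4)))"
      using assms[OF j] z_linear[OF j] by (simp add: c linear_sum linear_scale z_basis[OF j])
    also have "\<dots> = Complex (poly [:c 0, c 1, c 2, c 3:] (x j)) (disc_sign j * disc_sqrt x
        * poly [:c 4, c 5, c 6, c 7:] (x j))"
      unfolding sum8 by (simp add: complex_eq_iff y_def algebra_simps power2_eq_square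
          power3_eq_cube flip: of_real_power)
    finally have "poly [:c 0, c 1, c 2, c 3:] (x j) = 0
        \<and> disc_sign j * disc_sqrt x * poly [:c 4, c 5, c 6, c 7:] (x j) = 0"
      by (simp add: complex_eq_iff)
    moreover have "disc_sign j \<noteq> 0" using disc_sign_square[of j] by auto
    ultimately show "poly [:c 0, c 1, c 2, c 3:] (x j) = 0" "poly [:c 4, c 5, c 6, c 7:] (x j) = 0"
      using D_pos by auto
  qed
  have "[:c', c'', c''', c'''':] = 0" if "\<And>j. j \<in> {1..4} \<Longrightarrow> poly [:c', c'', c''', c'''':] (x j) = 0"
      for c' c'' c''' c''''
  proof (rule poly_eqI_degree[of "x ` {1..4}"])
    have "card (x ` {1..4}) = 4" using inj_x by (simp add: card_image)
    moreover have "Polynomial.degree [:c', c'', c''', c'''':] \<le> 3" by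
        (intro degree_pCons_le[THEN order_trans]) auto
    ultimately show "Polynomial.degree [:c', c'', c''', c'''':] < card (x ` {1..4})"
      "Polynomial.degree (0 :: real poly) < card (x ` {1..4})" by auto
  qed (use that in auto)
  from this[of "c 0" "c 1" "c 2" "c 3"] this[of "c 4" "c 5" "c 6" "c 7"] roots
  have "c 0 = 0 \<and> c 1 = 0 \<and> c 2 = 0 \<and> c 3 = 0 \<and> c 4 = 0 \<and> c 5 = 0 \<and> c 6 = 0 \<and> c 7 = 0"
    by (simp del: One_nat_def poly_pCons)
  then show ?thesis unfolding c sum8 by (simp del: One_nat_def)
qed

text \<open>By interpolation at the four roots, separately for real and imaginary parts.\<close>
lemma z_surj:
  fixes t :: "nat \<Rightarrow> complex"
  obtains v where "\<And>j. j \<in> {1..4} \<Longrightarrow> z j v = t j"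
proof -
  let ?i = "inv_into {1..4} x"
  obtain f where f: "\<forall>a\<in>x ` {1..4}. poly f a = Re (t (?i a))"
    using interpolating_poly_exists[of "x ` {1..4}" "\<lambda>a. Re (t (?i a))"] by blast
  obtain g where g: "\<forall>a\<in>x ` {1..4}. poly g a = disc_sign (?i a) * Im (t (?i a)) / disc_sqrt x"
    using interpolating_poly_exists[of "x ` {1..4}"
        "\<lambda>a. disc_sign (?i a) * Im (t (?i a)) / disc_sqrt x"] by blast
  define v where "v = (\<Sum>k\<le>Polynomial.degree f. Polynomial.coeff f k *\<^sub>R \<iota> (of_real (x 1) ^ k))
    + (\<Sum>k\<le>Polynomial.degree g. Polynomial.coeff g k *\<^sub>R \<iota> (y * of_real (x 1) ^ k))"
  have "z j v = t j" if j: "j \<in> {1..4}" for j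
  proof -
    have z1: "z j (\<iota> (of_real (x 1) ^ k)) = of_real (x j) ^ k"
        "z j (\<iota> (y * of_real (x 1) ^ k)) = of_real (disc_sign j) * y * of_real (x j) ^ k" for k
      using j by (simp_all add: z_extends field_closed embedding_mult embedding_power embedding_y
          embedding_root)
    have "z j v = of_real (poly f (x j)) + of_real (disc_sign j) * y * of_real (poly g (x j))"
      unfolding v_def poly_altdef
      by (simp add: linear_add[OF z_linear[OF j]] linear_sum[OF z_linear[OF j]]
          linear_scale[OF z_linear[OF j]] z1
          scaleR_conv_of_real sum_distrib_left mult.left_commute mult.assoc)
    also have "poly f (x j) = Re (t j)" using f j inj_x by simp
    also have "poly g (x j) = disc_sign j * Im (t j) / disc_sqrt x" using g j inj_x by simp
    also have "of_real (Re (t j)) + of_real (disc_sign j) * y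
        * of_real (disc_sign j * Im (t j) / disc_sqrt x)
        = of_real (Re (t j)) + of_real (disc_sign j * disc_sign j) * \<i> * of_real (Im (t j))"
      using D_pos by (simp add: y_def)
    also have "\<dots> = t j" by (simp add: disc_sign_square complex_eq_iff)
    finally show ?thesis .
  qed
  then show ?thesis by (rule that)
qed

end


section \<open>Kaehler forms and polarizations\<close>

lemma four_indices: "{1..4::nat} = {1, 2, 3, 4}" by auto

lemma kaehler_form_from_coordinates:
  fixes w :: "nat \<Rightarrow> 'v::real_vector \<Rightarrow> complex" and c :: "nat \<Rightarrow> real"
  assumes lin: "linear (\<lambda>v. (w 1 v, w 2 v, w 3 v, w 4 v))" and bij:
      "bij (\<lambda>v. (w 1 v, w 2 v, w 3 v, w 4 v))"
    and pos: "\<And>p. p \<in> {1..4} \<Longrightarrow> c p > 0"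
    and \<Omega>: "\<And>u v. \<Omega> u v = of_real (\<Sum>p\<in>{1..4}. c p * Im (w p v * cnj (w p u)))"
  obtains J where "\<forall>j\<in>{1..4}. \<forall>v. w j (J v) = \<i> * w j v" "is_invariant_kaehler_form J \<Omega>"
proof -
  define W where "W v = (w 1 v, w 2 v, w 3 v, w 4 v)" for v
  have W: "linear W" "bij W" using lin bij by (simp_all add: W_def[abs_def])
  have lin_w: "linear (w 1)" "linear (w 2)" "linear (w 3)" "linear (w 4)"
    using W(1) by (auto simp: linear_iff W_def)
  have inj: "u = v" if "\<And>j. j \<in> {1..4} \<Longrightarrow> w j u = w j v" for u v
    using that bij_is_inj[OF W(2)] by (auto simp: inj_def W_def four_indices simp del: One_nat_def)
  define J where "J v = (THE u. W u = (\<i> * w 1 v, \<i> * w 2 v, \<i> * w 3 v, \<i> * w 4 v))" for v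
  have J_eq: "W (J v) = (\<i> * w 1 v, \<i> * w 2 v, \<i> * w 3 v, \<i> * w 4 v)" for v
    unfolding J_def by (rule theI') (use W(2) in \<open>auto simp: bij_iff\<close>)
  then have J: "w j (J v) = \<i> * w j v" if "j \<in> {1..4}" for j v
    using that J_eq[of v] by (auto simp: W_def four_indices simp del: One_nat_def)
  have lin_w': "linear (w j)" if "j \<in> {1..4}" for j
    using that lin_w by (auto simp: four_indices simp del: One_nat_def)
  have linJ: "linear J"
  proof (rule linearI)
    show "J (u + v) = J u + J v" for u v
      by (rule inj) (simp add: J lin_w' linear_add distrib_left)
    show "J (r *\<^sub>R v) = r *\<^sub>R J v" for r v
      by (rule inj) (simp add: J lin_w' linear_scale)
  qed
  have JJ: "J (J v) = - v" for v
    by (rule inj) (simp add: J lin_w' linear_neg)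
  define S where "S u v = (\<Sum>p\<in>{1..4}. c p * Im (w p v * cnj (w p u)))" for u v
  have \<Omega>': "\<Omega> u v = of_real (S u v)" for u v by (simp add: \<Omega> S_def)
  have S_add: "S (u + u') v = S u v + S u' v" for u u' v
    unfolding S_def sum.distrib[symmetric]
    by (intro sum.cong refl) (simp add: lin_w' linear_add algebra_simps)
  have S_scale: "S (r *\<^sub>R u) v = r * S u v" for r u v
    unfolding S_def sum_distrib_left
    by (intro sum.cong refl) (simp add: lin_w' linear_scale algebra_simps)
  have S_skew: "S u v = - S v u" for u v
    unfolding S_def sum_negf[symmetric] by (intro sum.cong refl) (simp add: algebra_simps)
  have "is_invariant_kaehler_form J \<Omega>"
    unfolding is_invariant_kaehler_form_def is_complex_structure_def
  proof (intro conjI allI impI)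
    show "linear J" by (rule linJ)
    show "J (J v) = - v" for v by (rule JJ)
    show "linear (\<lambda>u. \<Omega> u v)" for v
      by (rule linearI) (simp_all only: \<Omega>' S_add S_scale of_real_add of_real_mult scaleR_conv_of_real)
    show "\<Omega> u v = - \<Omega> v u" for u v
      unfolding \<Omega>' by (subst S_skew) simp
    show "\<Omega> u v \<in> \<real>" for u v by (simp add: \<Omega>)
    show "\<Omega> (J u) (J v) = \<Omega> u v" for u v
    proof -
      have "w p (J v) * cnj (w p (J u)) = w p v * cnj (w p u)" if "p \<in> {1..4}" for p
        unfolding J[OF that] by (simp add: complex_eq_iff algebra_simps)
      then show ?thesis unfolding \<Omega> by (intro arg_cong[where f = of_real] sum.cong refl) simp
    qed
    show "0 < Re (\<Omega> v (J v))" if "v \<noteq> 0" for v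
    proof -
      have "\<exists>q\<in>{1..4}. w q v \<noteq> 0"
      proof (rule ccontr)
        assume "\<not> ?thesis"
        then have "v = 0" by (intro inj) (metis lin_w' linear_0)
        with that show False by simp
      qed
      then obtain q where q: "q \<in> {1..4}" "w q v \<noteq> 0" by blast
      have *: "Im (w p (J v) * cnj (w p v)) = (cmod (w p v))\<^sup>2" if "p \<in> {1..4}" for p
      proof -
        have "w p (J v) * cnj (w p v) = \<i> * of_real ((cmod (w p v))\<^sup>2)"
          unfolding J[OF that] by (simp only: complex_norm_square mult.assoc)
        then show ?thesis by simp
      qed
      have "0 < (\<Sum>p\<in>{1..4}. c p * (cmod (w p v))\<^sup>2)"
      proof (rule sum_pos2[OF _ q(1)])
        show "0 < c q * (cmod (w q v))\<^sup>2" using q pos by simp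
        show "0 \<le> c p * (cmod (w p v))\<^sup>2" if "p \<in> {1..4}" for p using pos[OF that] by simp
      qed simp
      also have "\<dots> = Re (\<Omega> v (J v))"
        unfolding \<Omega> Re_complex_of_real by (intro sum.cong refl) (simp only: *)
      finally show ?thesis .
    qed
  qed
  with J show ?thesis using that by blast
qed

text \<open>The polarization is \<open>H u v = E (J u) v + \<i> E u v\<close> with \<open>E = - N \<Omega>\<close>.\<close>
lemma abelian_variety_if_integral_kaehler_form:
  assumes K: "is_invariant_kaehler_form J \<Omega>" and "is_lattice \<Lambda>" and "N > 0"
    and integral: "\<And>a b. a \<in> \<Lambda> \<Longrightarrow> b \<in> \<Lambda> \<Longrightarrow> of_real N * \<Omega> a b \<in> \<int>"
  shows "is_abelian_variety J \<Lambda>"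
proof -
  have lin: "linear J" and JJ: "\<And>v. J (J v) = - v" and lin1: "\<And>v. linear (\<lambda>u. \<Omega> u v)"
    and skew: "\<And>u v. \<Omega> u v = - \<Omega> v u" and real: "\<And>u v. \<Omega> u v \<in> \<real>"
    and inv: "\<And>u v. \<Omega> (J u) (J v) = \<Omega> u v" and pos: "\<And>v. v \<noteq> 0 \<Longrightarrow> Re (\<Omega> v (J v)) > 0"
    using K unfolding is_invariant_kaehler_form_def is_complex_structure_def by blast+
  have neg1: "\<Omega> (- u) v = - \<Omega> u v" for u v using linear_neg[OF lin1] .
  have J_left: "\<Omega> (J v) u = \<Omega> (J u) v" for u v
  proof -
    have "\<Omega> (J v) u = \<Omega> (J (J v)) (J u)" by (rule inv[symmetric])
    also have "\<dots> = - \<Omega> v (J u)" unfolding JJ neg1 ..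
    also have "\<dots> = \<Omega> (J u) v" by (rule skew[symmetric])
    finally show ?thesis .
  qed
  define H where "H u v = - of_real N * (\<Omega> (J u) v + \<i> * \<Omega> u v)" for u v
  have "is_polarization J \<Lambda> H"
    unfolding is_polarization_def
  proof (intro conjI allI impI ballI)
    show "linear (\<lambda>u. H u v)" for v
      by (rule linearI)
         (simp_all add: H_def linear_add[OF lin] linear_scale[OF lin] linear_add[OF lin1]
             linear_scale[OF lin1]
           scaleR_conv_of_real algebra_simps)
    show "H (J u) v = \<i> * H u v" for u v
      by (simp add: H_def JJ neg1 algebra_simps)
    show "H v u = cnj (H u v)" for u v
    proof -
      have cnj: "cnj (\<Omega> u v) = \<Omega> u v" for u v using real[of u v] by (simp add: Reals_cnj_iff)
      show ?thesis using skew[of v u] J_left[of v u] by (simp add: H_def cnj)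
    qed
    show "0 < Re (H v v)" if "v \<noteq> 0" for v
    proof -
      have "\<Omega> v v = 0" using skew[of v v] by simp
      then show ?thesis using pos[OF that] skew[of "J v" v] \<open>N > 0\<close> by (simp add: H_def)
    qed
    show "Im (H a b) \<in> \<int>" if "a \<in> \<Lambda>" "b \<in> \<Lambda>" for a b
    proof -
      have "Im (\<Omega> (J a) b) = 0" "Im (\<Omega> a b) = 0" using real by (simp_all add: complex_is_Real_iff)
      moreover have "of_real N * \<Omega> a b \<in> \<int>" using integral[OF that] .
      then obtain k where "of_real N * \<Omega> a b = of_int k" by (auto elim: Ints_cases)
      then have "Re (of_real N * \<Omega> a b) = of_int k" by simp
      then have "N * Re (\<Omega> a b) = of_int k" by simp
      ultimately have "Im (H a b) = of_int (- k)" by (simp add: H_def)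
      then show ?thesis by simp
    qed
  qed
  then show ?thesis
    using \<open>is_lattice \<Lambda>\<close> lin JJ unfolding is_abelian_variety_def is_complex_structure_def by blast
qed


section \<open>Integrality of \<open>\<omega>\<close>\<close>

context octic_torus
begin

lemma y_square: "y * y = - of_real (disc x)"
  by (simp add: complex_eq_iff y_def disc_def power2_eq_square)

lemma disc_pos: "disc x > 0"
  using D_pos by (simp add: disc_def)

text \<open>The factor \<open>y\<close> in front of \<open>\<omega>\<close>, the sign \<open>(-1)\<^sup>j\<^sup>+\<^sup>1\<close> and the antisymmetry of the wedge product
  leave only the mixed products of the two components, with the signs and \<open>y\<^sup>2 = - \<Delta>\<close> cancelled.\<close>
lemma omega_iota:
  assumes a: "a = of_real (rat_poly_eval f (x 1)) + y * of_real (rat_poly_eval g (x 1))"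
    and b: "b = of_real (rat_poly_eval f' (x 1)) + y * of_real (rat_poly_eval g' (x 1))"
  shows "omega_form x z (\<iota> a) (\<iota> b) =
    of_real (- 2 * (\<Sum>j\<in>{1..4}. mu x j * (rat_poly_eval g (x j) * rat_poly_eval f' (x j)
        - rat_poly_eval f (x j) * rat_poly_eval g' (x j))))"
proof -
  have cnj_y: "cnj y = - y" by (simp add: y_def)
  have aF: "a \<in> octic_field x" "b \<in> octic_field x"
    using embedding_rat_poly_eval(1)[of 1] by (simp_all add: a b field_closed)
  let ?t = "\<lambda>j. rat_poly_eval g (x j) * rat_poly_eval f' (x j)
      - rat_poly_eval f (x j) * rat_poly_eval g' (x j)"
  have summand: "(- 1) ^ (j + 1) * of_real (mu x j) * wedge (z j) (conj_form (z j)) (\<iota> a) (\<iota> b)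
      = 2 * y * of_real (mu x j * ?t j)"
    if j: "j \<in> {1..4}" for j
  proof -
    have zab: "z j (\<iota> a) = of_real (rat_poly_eval f (x j))
        + of_real (disc_sign j) * y * of_real (rat_poly_eval g (x j))"
      "z j (\<iota> b) = of_real (rat_poly_eval f' (x j))
          + of_real (disc_sign j) * y * of_real (rat_poly_eval g' (x j))"
      using aF by (simp_all add: z_extends[OF j]) (simp_all add: a b embedding_elem[OF j])
    have disc_sign: "(- 1) ^ (j + 1) = complex_of_real (disc_sign j)" by (simp add: disc_sign_def)
    have sq: "complex_of_real (disc_sign j) * of_real (disc_sign j) = 1" by
        (simp add: disc_sign_square flip: of_real_mult)
    show ?thesis
      unfolding wedge_def conj_form_def zab disc_sign complex_cnj_add complex_cnj_mult cnj_y
          complex_cnj_complex_of_real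
        of_real_mult of_real_diff
      using sq by Groebner_Basis.algebra
  qed
  have "omega_form x z (\<iota> a) (\<iota> b) = y / of_real (disc x)
      * (\<Sum>j\<in>{1..4}. 2 * y * of_real (mu x j * ?t j))"
  proof -
    have "(\<Sum>j\<in>{1..4}. (- 1) ^ (j + 1) * of_real (mu x j) * wedge (z j) (conj_form (z j)) (\<iota> a) (\<iota> b))
      = (\<Sum>j\<in>{1..4}. 2 * y * of_real (mu x j * ?t j))" by (intro sum.cong refl summand)
    then show ?thesis by (simp only: omega_form_def y_def)
  qed
  also have "\<dots> = 2 * (y * y) / of_real (disc x) * of_real (\<Sum>j\<in>{1..4}. mu x j * ?t j)"
    by (simp add: sum_distrib_left mult_ac)
  also have "\<dots> = of_real (- 2 * (\<Sum>j\<in>{1..4}. mu x j * ?t j))"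
    unfolding y_square using disc_pos by simp
  finally show ?thesis .
qed

lemma omega_rational:
  assumes "a \<in> octic_field x" "b \<in> octic_field x"
  shows "omega_form x z (\<iota> a) (\<iota> b) \<in> \<rat>"
proof -
  obtain f g where a: "a = of_real (rat_poly_eval f (x 1)) + y * of_real (rat_poly_eval g (x 1))"
    using octic_field_elem[OF disc_int assms(1)] unfolding y_def by metis
  obtain f' g' where b: "b = of_real (rat_poly_eval f' (x 1)) + y * of_real (rat_poly_eval g' (x 1))"
    using octic_field_elem[OF disc_int assms(2)] unfolding y_def by metis
  obtain m where m: "\<And>j. j \<in> {1..4} \<Longrightarrow> mu x j = rat_poly_eval m (x j)"
    using mu_rational_poly by blast
  have "(\<Sum>j\<in>{1..4}. mu x j * (rat_poly_eval g (x j) * rat_poly_eval f' (x j)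
      - rat_poly_eval f (x j) * rat_poly_eval g' (x j)))
    = (\<Sum>j\<in>{1..4}. rat_poly_eval (m * (g * f' - f * g')) (x j))"
    by (intro sum.cong refl) (simp add: m)
  then have "(\<Sum>j\<in>{1..4}. mu x j * (rat_poly_eval g (x j) * rat_poly_eval f' (x j)
      - rat_poly_eval f (x j) * rat_poly_eval g' (x j))) \<in> \<rat>"
    by (simp only: sum_rat_poly_eval_rational)
  then obtain q where q: "(\<Sum>j\<in>{1..4}. mu x j * (rat_poly_eval g (x j) * rat_poly_eval f' (x j)
      - rat_poly_eval f (x j) * rat_poly_eval g' (x j))) = of_rat q"
    by (elim Rats_cases)
  show ?thesis unfolding omega_iota[OF a b] q by (simp add: of_real_of_rat)
qed

lemma algebraic_int_y: "algebraic_int y"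
proof (rule algebraic_int.intros)
  obtain d where "disc x = of_int d" using disc_int by (elim Ints_cases)
  then have "\<forall>i. Polynomial.coeff [:complex_of_real (disc x), 0, 1:] i \<in> \<int>"
    by (auto simp: coeff_pCons split: nat.splits)
  then show "\<forall>i. Polynomial.coeff [:complex_of_real (disc x), 0, 1:] i \<in> \<int>" .
qed (simp_all add: y_square)

text \<open>The factor \<open>N\<^sup>3\<close> makes \<open>\<mu>\<^sub>j\<close>, a product of three differences of roots, integral, and \<open>\<Delta>\<close>
  removes the denominator of \<open>\<omega>\<close>. A rational algebraic integer is an integer.\<close>
lemma omega_integral:
  assumes N: "\<And>j. j \<in> {1..4} \<Longrightarrow> algebraic_int (complex_of_real (of_int N * x j))"
    and "a \<in> ring_of_integers (octic_field x)" "b \<in> ring_of_integers (octic_field x)"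
  shows "of_real (disc x * of_int N ^ 3) * omega_form x z (\<iota> a) (\<iota> b) \<in> \<int>"
proof (rule rational_algebraic_int_is_int)
  have aF: "a \<in> octic_field x" "b \<in> octic_field x" and ai: "algebraic_int a" "algebraic_int b"
    using assms(2,3) by (simp_all add: ring_of_integers_def)
  have "algebraic_int (of_real (of_int N ^ 3 * mu x j) :: complex)" if j: "j \<in> {1..4}" for j
  proof -
    have "of_int N ^ 3 * mu x j = (\<Prod>k\<in>{1..4} - {j}. of_int N * x j - of_int N * x k)"
      using j by (simp add: mu_def prod.distrib flip: right_diff_distrib)
    then have "complex_of_real (of_int N ^ 3 * mu x j)
        = (\<Prod>k\<in>{1..4} - {j}. of_real (of_int N * x j) - of_real (of_int N * x k))"
      by simp
    moreover have "algebraic_int \<dots>" using N j by (intro algebraic_int_prod algebraic_int_diff) auto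
    ultimately show ?thesis by simp
  qed
  moreover have "algebraic_int (z j (\<iota> a))" "algebraic_int (z j (\<iota> b))" if j: "j \<in> {1..4}" for j
    using field_embedding_algebraic_int[OF embedding'[OF j]] aF ai
    by (simp_all add: z_extends[OF j] octic_field_def)
  moreover have "algebraic_int ((- 1) ^ k :: complex)" for k by (intro algebraic_int_power) auto
  ultimately have "algebraic_int (y * (\<Sum>j\<in>{1..4}. (- 1) ^ (j + 1) * of_real (of_int N ^ 3 * mu x j)
      * wedge (z j) (conj_form (z j)) (\<iota> a) (\<iota> b)))"
    unfolding wedge_def conj_form_def
    by (intro algebraic_int_mult algebraic_int_sum algebraic_int_y algebraic_int_diff
        algebraic_int_cnj) auto
  also have "y * (\<Sum>j\<in>{1..4}. (- 1) ^ (j + 1) * of_real (of_int N ^ 3 * mu x j)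
      * wedge (z j) (conj_form (z j)) (\<iota> a) (\<iota> b))
    = of_real (disc x * of_int N ^ 3) * omega_form x z (\<iota> a) (\<iota> b)"
    using disc_pos by (simp add: omega_form_def y_def sum_distrib_left mult_ac)
  finally show "algebraic_int (of_real (disc x * of_int N ^ 3) * omega_form x z (\<iota> a) (\<iota> b))" .
  have "of_real (disc x * of_int N ^ 3) \<in> (\<rat> :: complex set)"
    using disc_int by (auto elim!: Ints_cases)
  then show "of_real (disc x * of_int N ^ 3) * omega_form x z (\<iota> a) (\<iota> b) \<in> \<rat>"
    using omega_rational[OF aF] by (rule Rats_mult)
qed

lemma omega_skew: "omega_form x z u v = - omega_form x z v u"
proof -
  have "(\<Sum>j\<in>{1..4}. (- 1) ^ (j + 1) * of_real (mu x j) * wedge (z j) (conj_form (z j)) u v)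
    = - (\<Sum>j\<in>{1..4}. (- 1) ^ (j + 1) * of_real (mu x j) * wedge (z j) (conj_form (z j)) v u)"
    unfolding sum_negf[symmetric] by (intro sum.cong refl) (simp add: wedge_def algebra_simps)
  then show ?thesis by (simp add: omega_form_def)
qed

lemma omega_linear: "linear (\<lambda>u. omega_form x z u v)"
proof (rule linearI)
  show "omega_form x z (u + u') v = omega_form x z u v + omega_form x z u' v" for u u'
    unfolding omega_form_def distrib_left[symmetric] sum.distrib[symmetric]
    by (intro arg_cong[where f = "(*) _"] sum.cong refl)
       (simp add: wedge_def conj_form_def linear_add[OF z_linear] algebra_simps)
  show "omega_form x z (r *\<^sub>R u) v = r *\<^sub>R omega_form x z u v" for r u
    unfolding omega_form_def scaleR_conv_of_real mult.left_commute[of "of_real r"]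
        sum_distrib_left[of "of_real r"]
    by (intro arg_cong[where f = "(*) _"] sum.cong refl)
       (simp add: wedge_def conj_form_def linear_scale[OF z_linear] scaleR_conv_of_real algebra_simps)
qed

lemma omega_real: "omega_form x z u v \<in> \<real>"
proof -
  have "cnj (omega_form x z u v) = omega_form x z u v"
    by (simp add: omega_form_def wedge_def conj_form_def sum_negf[symmetric] algebra_simps flip:
        mult_minus_right)
  then show ?thesis by (simp add: Reals_cnj_iff)
qed

text \<open>Pairing with eight algebraic integers that span \<open>V\<close> gives functionals with integer values
  on the image of the ring of integers; a common zero lies in the radical of \<open>\<omega>\<close>.\<close>
lemma ring_of_integers_is_lattice:
  assumes nondeg: "\<And>v. (\<And>u. omega_form x z v u = 0) \<Longrightarrow> v = 0"
  shows "is_lattice (\<iota> ` ring_of_integers (octic_field x))" (is "is_lattice ?\<Lambda>")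
proof -
  obtain N where "N > 0" and N: "\<And>j. j \<in> {1..4} \<Longrightarrow> algebraic_int (complex_of_real (of_int N * x j))"
    using integral_multiple_of_roots by blast
  have basis: "\<iota> (basis_elem N k) \<in> ?\<Lambda>" for k
  proof -
    have "algebraic_int (basis_elem N k)"
      unfolding basis_elem_def using N[of 1] by
          (intro algebraic_int_mult algebraic_int_power algebraic_int_y) auto
    then show ?thesis by (simp add: ring_of_integers_def basis_elem_in_field)
  qed
  show ?thesis
  proof (rule is_lattice_if_integer_functionals[where m = 8 and
      f = "\<lambda>k v. Re (of_real (disc x * of_int N ^ 3) * omega_form x z v (\<iota> (basis_elem N k)))"])
    show "0 \<in> ?\<Lambda>"
      using iota_0 by (intro image_eqI[where x = 0]) (simp_all add: ring_of_integers_def field_closed)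
    show "u - v \<in> ?\<Lambda>" if uv: "u \<in> ?\<Lambda>" "v \<in> ?\<Lambda>" for u v
    proof -
      from uv obtain a b where ab: "a \<in> octic_field x" "b \<in> octic_field x" "algebraic_int a"
          "algebraic_int b"
        "u = \<iota> a" "v = \<iota> b" by (auto simp: ring_of_integers_def)
      then have "u - v = \<iota> (a + - b)" by (simp only: iota_add iota_uminus field_closed) simp
      moreover have "a + - b \<in> ring_of_integers (octic_field x)"
        using ab by (simp only: ring_of_integers_def mem_Collect_eq field_closed)
            (auto intro: algebraic_int_diff)
      ultimately show ?thesis by blast
    qed
    show "span ?\<Lambda> = UNIV"
    proof -
      have "(\<lambda>k. \<iota> (basis_elem N k)) ` {..<8} \<subseteq> ?\<Lambda>" using basis by blast
      from span_mono[OF this] show ?thesis using span_basis[OF \<open>N > 0\<close>] by auto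
    qed
    show "linear (\<lambda>v. Re (of_real (disc x * of_int N ^ 3) * omega_form x z v (\<iota> (basis_elem N k))))"
        for k
      by (rule linearI) (simp_all add: linear_add[OF omega_linear] linear_scale[OF omega_linear]
          algebra_simps)
    show "Re (of_real (disc x * of_int N ^ 3) * omega_form x z v (\<iota> (basis_elem N k))) \<in> \<int>" if v:
        "v \<in> ?\<Lambda>" for k v
    proof -
      from v basis[of k] have "of_real (disc x * of_int N ^ 3)
          * omega_form x z v (\<iota> (basis_elem N k)) \<in> \<int>"
        using omega_integral[OF N] by auto
      then show ?thesis by (elim Ints_cases) simp
    qed
    show "v = 0" if zero: "\<And>k. k < 8 \<Longrightarrow> Re (of_real (disc x * of_int N ^ 3)
        * omega_form x z v (\<iota> (basis_elem N k))) = 0" for v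
    proof (rule nondeg)
      fix u
      have "of_real (disc x * of_int N ^ 3) * omega_form x z v (\<iota> (basis_elem N k)) = 0" if "k < 8"
          for k
        using zero[OF that] omega_real[of v "\<iota> (basis_elem N k)"]
        by (simp add: complex_is_Real_iff complex_eq_iff)
      then have "omega_form x z b v = 0" if "b \<in> (\<lambda>k. \<iota> (basis_elem N k)) ` {..<8}" for b
        using that disc_pos \<open>N > 0\<close> omega_skew[of b v] by auto
      moreover have "u \<in> span ((\<lambda>k. \<iota> (basis_elem N k)) ` {..<8})" using span_basis[OF \<open>N > 0\<close>] by simp
      ultimately have "omega_form x z u v = 0"
        using linear_eq_0_on_span[OF omega_linear] by blast
      then show "omega_form x z v u = 0" using omega_skew[of v u] by simp
    qed
  qed
qed

end


section \<open>The coordinates \<open>w\<close> and the abelian variety\<close>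

context octic_torus
begin

context
  assumes h3: "h3 x \<noteq> 0"
begin

lemmas w_relation_formula = w_relation_iff_inverse(2)[OF ordered h3]

lemma e_form_e_form: "e_form (e_form u) j = u j"
  by (simp add: e_form_def conj_form_def fun_eq_iff)

lemma e_form_eq_iff: "e_form a j u = e_form b j v \<longleftrightarrow> a j u = b j v"
  by (simp add: e_form_def conj_form_def)

lemma w_relation_exists: "\<exists>w. w_relation x z w"
proof -
  define E where "E j v = (if j = 1 then (e_form z 1 v
      - \<tau> (of_real (x 1)) (of_real (x 3)) (of_real (x 2)) (of_real (x 4)) * e_form z 2 v
        - \<tau> (of_real (x 1)) (of_real (x 3)) (of_real (x 4)) (of_real (x 2))
            * e_form z 4 v) / transition_scalar x
    else if j = 2 then (e_form z 2 v - \<tau> (of_real (x 2)) (of_real (x 4)) (of_real (x 1))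
        (of_real (x 3)) * e_form z 1 v
        - \<tau> (of_real (x 2)) (of_real (x 4)) (of_real (x 3)) (of_real (x 1))
            * e_form z 3 v) / transition_scalar x
    else if j = 3 then (e_form z 3 v - \<tau> (of_real (x 3)) (of_real (x 1)) (of_real (x 2))
        (of_real (x 4)) * e_form z 2 v
        - \<tau> (of_real (x 3)) (of_real (x 1)) (of_real (x 4)) (of_real (x 2))
            * e_form z 4 v) / transition_scalar x
    else (e_form z 4 v - \<tau> (of_real (x 4)) (of_real (x 2)) (of_real (x 1)) (of_real (x 3))
        * e_form z 1 v
        - \<tau> (of_real (x 4)) (of_real (x 2)) (of_real (x 3)) (of_real (x 1))
            * e_form z 3 v) / transition_scalar x)" for j :: nat and v
  have "w_relation x z (e_form E)"
    unfolding w_relation_formula e_form_e_form by (simp add: E_def)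
  then show ?thesis by blast
qed

text \<open>Used with constant families \<open>w\<close>, to find the values of \<open>z\<close> that belong to prescribed values
  of \<open>w\<close>.\<close>
lemma w_relation_exists_z: "\<exists>z'. w_relation x z' (w :: nat \<Rightarrow> 'v \<Rightarrow> complex)"
proof -
  let ?x = "\<lambda>i. complex_of_real (x i)"
  define E where "E j v = (if j = 1 then e_form w 1 v + \<tau> (?x 1) (?x 3) (?x 2) (?x 4) * e_form w 2 v
      + \<tau> (?x 1) (?x 3) (?x 4) (?x 2) * e_form w 4 v
    else if j = 2 then e_form w 2 v + \<tau> (?x 2) (?x 4) (?x 1) (?x 3) * e_form w 1 v
        + \<tau> (?x 2) (?x 4) (?x 3) (?x 1) * e_form w 3 v
    else if j = 3 then e_form w 3 v + \<tau> (?x 3) (?x 1) (?x 2) (?x 4) * e_form w 2 v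
        + \<tau> (?x 3) (?x 1) (?x 4) (?x 2) * e_form w 4 v
    else e_form w 4 v + \<tau> (?x 4) (?x 2) (?x 1) (?x 3) * e_form w 1 v
        + \<tau> (?x 4) (?x 2) (?x 3) (?x 1) * e_form w 3 v)" for j :: nat and v
  have "w_relation x (e_form E) w"
    unfolding w_relation_iff[OF ordered h3] e_form_e_form by (simp add: E_def)
  then show ?thesis by blast
qed

lemma w_relation_unique:
  assumes "w_relation x z w" "w_relation x z w'" "j \<in> {1..4}"
  shows "w' j = w j"
proof -
  have "e_form w' j = e_form w j"
    using assms(1,2) unfolding w_relation_formula using assms(3) by (elim index_cases)
        (auto simp: fun_eq_iff)
  then show ?thesis by (simp add: fun_eq_iff e_form_eq_iff)
qed

lemma e_form_z_linear: "j \<in> {1..4} \<Longrightarrow> linear (e_form z j)"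
  by (rule linearI)
     (auto simp: e_form_def conj_form_def linear_add[OF z_linear] linear_scale[OF z_linear])

lemma w_linear:
  assumes w: "w_relation x z w" and j: "j \<in> {1..4}"
  shows "linear (w j)"
proof -
  note L = e_form_z_linear[of 1, simplified] e_form_z_linear[of 2, simplified]
    e_form_z_linear[of 3, simplified] e_form_z_linear[of 4, simplified]
  have "e_form w j (u + v) = e_form w j u + e_form w j v \<and> e_form w j (r *\<^sub>R v)
      = r *\<^sub>R e_form w j v" for u v r
    using w j unfolding w_relation_formula
    by (elim index_cases)
       (simp_all add: L[THEN linear_add] L[THEN linear_scale] scaleR_conv_of_real
          ring_distribs diff_divide_distrib add_divide_distrib mult.left_commute)
  then have "w j (u + v) = w j u + w j v \<and> w j (r *\<^sub>R v) = r *\<^sub>R w j v" for u v r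
    by (cases "even j")
       (simp_all add: e_form_def conj_form_def flip: complex_cnj_add complex_cnj_scaleR)
  then show ?thesis by (intro linearI) auto
qed

lemma w_bij:
  assumes w: "w_relation x z w"
  shows "linear (\<lambda>v. (w 1 v, w 2 v, w 3 v, w 4 v))" "bij (\<lambda>v. (w 1 v, w 2 v, w 3 v, w 4 v))"
proof -
  show "linear (\<lambda>v. (w 1 v, w 2 v, w 3 v, w 4 v))"
    using w_linear[OF w, of 1] w_linear[OF w, of 2] w_linear[OF w, of 3] w_linear[OF w, of 4]
    by (simp add: linear_iff)
  have "inj (\<lambda>v. (w 1 v, w 2 v, w 3 v, w 4 v))"
  proof (rule injI)
    fix u v assume "(w 1 u, w 2 u, w 3 u, w 4 u) = (w 1 v, w 2 v, w 3 v, w 4 v)"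
    then have "e_form w j u = e_form w j v" if "j \<in> {1..4}" for j
      using that by (elim index_cases) (auto simp: e_form_def conj_form_def)
    then have "e_form z j u = e_form z j v" if "j \<in> {1..4}" for j
      using that w unfolding w_relation_iff[OF ordered h3] by (elim index_cases) auto
    then have "z j u = z j v" if "j \<in> {1..4}" for j
      using that by (simp only: e_form_eq_iff)
    then have "z j (u - v) = 0" if "j \<in> {1..4}" for j
      using that by (simp add: linear_diff[OF z_linear])
    then show "u = v" using z_eq_0_imp[of "u - v"] by simp
  qed
  moreover have "surj (\<lambda>v. (w 1 v, w 2 v, w 3 v, w 4 v))"
  proof (rule surjI)
    fix s :: "complex \<times> complex \<times> complex \<times> complex"
    define s' where "s' j = (if j = 1 then fst s else if j = 2 then fst (snd s)
      else if j = 3 then fst (snd (snd s)) else snd (snd (snd s)))" for j :: nat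
    obtain z' :: "nat \<Rightarrow> 'v \<Rightarrow> complex" where z': "w_relation x z' (\<lambda>j _. s' j)"
      using w_relation_exists_z by blast
    have "\<exists>v. \<forall>j\<in>{1..4}. z j v = z' j 0" by (rule z_surj[of "\<lambda>j. z' j 0"]) blast
    then obtain v where v: "\<forall>j\<in>{1..4}. z j v = z' j 0" by blast
    have "e_form z j v = e_form z' j 0" if "j \<in> {1..4}" for j using v that by (simp only: e_form_eq_iff)
    then have "e_form w j v = e_form (\<lambda>j _. s' j) j (0 :: 'v)" if "j \<in> {1..4}" for j
      using w z' that unfolding w_relation_formula by (elim index_cases)
          (simp_all only: atLeastAtMost_iff, auto)
    then have "w j v = s' j" if "j \<in> {1..4}" for j using that by (simp only: e_form_eq_iff)
    then have "\<exists>v. s = (w 1 v, w 2 v, w 3 v, w 4 v)"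
      by (intro exI[of _ v]) (simp add: s'_def)
    then show "(w 1 (SOME v. s = (w 1 v, w 2 v, w 3 v, w 4 v)), w 2 (SOME v. s
        = (w 1 v, w 2 v, w 3 v, w 4 v)),
        w 3 (SOME v. s = (w 1 v, w 2 v, w 3 v, w 4 v)), w 4 (SOME v. s
            = (w 1 v, w 2 v, w 3 v, w 4 v))) = s"
      by (metis (mono_tags, lifting) someI_ex)
  qed
  ultimately show "bij (\<lambda>v. (w 1 v, w 2 v, w 3 v, w 4 v))" by (rule bijI)
qed

text \<open>The explicit expansion reads \<open>- \<omega> = \<i> K / 2 * (\<Sum>C\<^sub>p dw\<^sub>p \<and> cnj dw\<^sub>p)\<close> with \<open>K > 0\<close>, and
  \<open>\<i> dw\<^sub>p \<and> cnj dw\<^sub>p\<close> takes the value \<open>2 Im (w\<^sub>p(v) cnj w\<^sub>p(u))\<close> at \<open>(u, v)\<close>.\<close>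
lemma kaehler:
  assumes w: "w_relation x z w"
  obtains J where "\<forall>j\<in>{1..4}. \<forall>v. w j (J v) = \<i> * w j v"
    "is_invariant_kaehler_form J (\<lambda>u v. - omega_form x z u v)"
proof -
  define K where "K = 8 * disc_sqrt x / (disc x * (h3 x)\<^sup>2)"
  define C where "C p = (if p = 1 then (x 1 - x 2)\<^sup>2 * (x 1 - x 3) * (x 2 - x 3) * (x 1 - x 4)\<^sup>2
      * (x 3 - x 4)
    else if p = 2 then (x 1 - x 2)\<^sup>2 * (x 2 - x 3)\<^sup>2 * (x 1 - x 4) * (x 2 - x 4) * (x 3 - x 4)
    else if p = 3 then (x 1 - x 2) * (x 1 - x 3) * (x 2 - x 3)\<^sup>2 * (x 1 - x 4) * (x 3 - x 4)\<^sup>2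
    else (x 1 - x 2) * (x 2 - x 3) * (x 1 - x 4)\<^sup>2 * (x 2 - x 4) * (x 3 - x 4)\<^sup>2)" for p :: nat
  have "K > 0" using D_pos disc_pos h3 by (simp add: K_def)
  then have pos: "K * C p > 0" for p using ordered by (simp add: C_def)
  have dw: "dwdwbar w p p u v = - 2 * \<i> * of_real (Im (w p v * cnj (w p u)))" for p u v
    by (simp add: dwdwbar_def wedge_def conj_form_def complex_eq_iff)
  have expansion: "- omega_form x z u v = of_real (\<Sum>p\<in>{1..4}. K * C p * Im (w p v * cnj (w p u)))"
      for u v
  proof -
    let ?k = "of_real (disc x * (h3 x)\<^sup>2) / (4 * \<i> * of_real (disc_sqrt x)) :: complex"
    have k: "?k \<noteq> 0" using D_pos disc_pos h3 by simp
    have kK: "?k * of_real K = - 2 * \<i>"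
      using D_pos disc_pos h3 by (simp add: K_def complex_eq_iff field_simps)
    have "?k * omega_form x z u v = - (of_real (C 1) * dwdwbar w 1 1 u v
        + of_real (C 2) * dwdwbar w 2 2 u v
      + of_real (C 3) * dwdwbar w 3 3 u v + of_real (C 4) * dwdwbar w 4 4 u v)"
      unfolding omega_form_in_w[OF ordered h3 w] by (simp add: C_def)
    then have "?k * (- omega_form x z u v) = (- 2 * \<i>)
        * of_real (\<Sum>p\<in>{1..4}. C p * Im (w p v * cnj (w p u)))"
      unfolding sum_1_4 dw mult_minus_right of_real_add of_real_mult by Groebner_Basis.algebra
    also have "\<dots> = ?k * of_real (\<Sum>p\<in>{1..4}. K * C p * Im (w p v * cnj (w p u)))"
      unfolding kK[symmetric] mult.assoc sum_distrib_left[symmetric] of_real_mult ..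
    finally show ?thesis using k mult_left_cancel by blast
  qed
  show ?thesis by (rule kaehler_form_from_coordinates[OF w_bij[OF w] pos expansion]) (rule that)
qed

end
end

theorem theorem6p2:
  fixes p0 p1 p2 p4 :: rat
    and x :: "nat \<Rightarrow> real"
    and c :: int
    and \<iota> :: "complex \<Rightarrow> 'v::real_vector"
    and \<phi> :: "nat \<Rightarrow> complex \<Rightarrow> complex"
    and z :: "nat \<Rightarrow> 'v \<Rightarrow> complex"
    and \<Lambda> :: "'v set"
    and xd :: "nat \<Rightarrow> nat \<Rightarrow> complex"
    and p q r s :: complex
  assumes quartic: "p4 \<noteq> 0" "Factorial_Ring.irreducible [:p0, p1, p2, 0, p4:]"
    and roots: "\<And>j. j \<in> {1..4} \<Longrightarrow> poly (map_poly of_rat [:p0, p1, p2, 0, p4:]) (x j) = 0"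
    and ordered: "x 1 > x 2" "x 2 > x 3" "x 3 > x 4"
    and galois: "galois_group (rat_adjoin (x ` {1..4})) \<cong> sym_group 4"
    and disc_int: "disc x \<in> \<int>"
    and c_nonzero: "c \<noteq> 0"
    and tensor: "is_real_extension (octic_field x) \<iota>"
    and embeddings: "\<And>j. j \<in> {1..4} \<Longrightarrow> field_embedding (octic_field x) (\<phi> j)"
      "\<And>j. j \<in> {1..4} \<Longrightarrow> \<phi> j (of_real (x 1)) = of_real (x j)"
      "\<And>j. j \<in> {1..4} \<Longrightarrow>
         \<phi> j (\<i> * of_real (disc_sqrt x)) = (- 1) ^ (j + 1) * (\<i> * of_real (disc_sqrt x))"
    and z_linear: "\<And>j. j \<in> {1..4} \<Longrightarrow> linear (z j)"
    and z_extends: "\<And>j a. j \<in> {1..4} \<Longrightarrow> a \<in> octic_field x \<Longrightarrow> z j (\<iota> a) = \<phi> j a"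
    and \<Lambda>: "\<Lambda> = \<iota> ` ring_of_integers (octic_field x)"
  defines "xd \<equiv> \<lambda>i j. of_real (x i - x j)"
    and "p \<equiv> (xd 1 2)\<^sup>2 * (xd 2 3)\<^sup>2 * (xd 1 4)\<^sup>2 * xd 3 4"
    and "q \<equiv> (xd 1 2)\<^sup>2 * (xd 2 3)\<^sup>2 * xd 1 4 * (xd 3 4)\<^sup>2"
    and "r \<equiv> xd 1 2 * (xd 2 3)\<^sup>2 * (xd 1 4)\<^sup>2 * (xd 3 4)\<^sup>2"
    and "s \<equiv> (xd 1 2)\<^sup>2 * xd 2 3 * (xd 1 4)\<^sup>2 * (xd 3 4)\<^sup>2"
  shows "\<exists>w. w_relation x z w \<and>
    (\<forall>w'. w_relation x z w' \<longrightarrow> (\<forall>j\<in>{1..4}. w' j = w j)) \<and>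
    linear (\<lambda>v. (w 1 v, w 2 v, w 3 v, w 4 v)) \<and>
    bij (\<lambda>v. (w 1 v, w 2 v, w 3 v, w 4 v)) \<and>
    (\<forall>u v. of_real ((x 1 * x 3 + x 2 * x 4)\<^sup>2 / 4) * A_1 x z u v =
       p * dwdwbar w 1 2 u v - q * dwdwbar w 2 3 u v
       + r * dwdwbar w 3 4 u v + s * dwdwbar w 4 1 u v
       + p * dwbardw w 1 2 u v - q * dwbardw w 2 3 u v
       + r * dwbardw w 3 4 u v + s * dwbardw w 4 1 u v) \<and>
    (\<forall>u v. of_real ((x 1 * x 3 + x 2 * x 4)\<^sup>2) / (4 * \<i> * of_int c * of_real (disc_sqrt x)) *
         A_2 c x z u v =
       p * dwdwbar w 1 2 u v + q * dwdwbar w 2 3 u v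
       + r * dwdwbar w 3 4 u v - s * dwdwbar w 4 1 u v
       - p * dwbardw w 1 2 u v - q * dwbardw w 2 3 u v
       - r * dwbardw w 3 4 u v + s * dwbardw w 4 1 u v) \<and>
    (\<forall>u v. of_real (disc x * (x 1 * x 3 + x 2 * x 4)\<^sup>2) / (4 * \<i> * of_real (disc_sqrt x)) *
         omega_form x z u v =
       - ((xd 1 2)\<^sup>2 * xd 1 3 * xd 2 3 * (xd 1 4)\<^sup>2 * xd 3 4 * dwdwbar w 1 1 u v
          + (xd 1 2)\<^sup>2 * (xd 2 3)\<^sup>2 * xd 1 4 * xd 2 4 * xd 3 4 * dwdwbar w 2 2 u v
          + xd 1 2 * xd 1 3 * (xd 2 3)\<^sup>2 * xd 1 4 * (xd 3 4)\<^sup>2 * dwdwbar w 3 3 u v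
          + xd 1 2 * xd 2 3 * (xd 1 4)\<^sup>2 * xd 2 4 * (xd 3 4)\<^sup>2 * dwdwbar w 4 4 u v)) \<and>
    (\<exists>J. (\<forall>j\<in>{1..4}. \<forall>v. w j (J v) = \<i> * w j v) \<and>
       is_invariant_kaehler_form J (\<lambda>u v. - omega_form x z u v) \<and>
       is_abelian_variety J \<Lambda>)"
proof -
  interpret octic_torus p0 p1 p2 p4 x \<iota> \<phi> z
    by (intro octic_torus.intro quartic_roots.intro octic_torus_axioms.intro)
      (fact quartic roots ordered disc_int tensor embeddings z_linear z_extends)+
  have h3: "h3 x \<noteq> 0" using h3_nonzero[OF galois] .
  obtain w where w: "w_relation x z w" using w_relation_exists[OF h3] by blast
  obtain J where J: "\<forall>j\<in>{1..4}. \<forall>v. w j (J v) = \<i> * w j v"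
    and kaehler: "is_invariant_kaehler_form J (\<lambda>u v. - omega_form x z u v)"
    by (rule kaehler[OF h3 w])
  have D: "disc_sqrt x > 0" by (rule D_pos)

  have wedges: "wedge (e_form w 1) (e_form w 2) = dwdwbar w 1 2"
      "wedge (e_form w 2) (e_form w 3) = dwbardw w 2 3"
    "wedge (e_form w 3) (e_form w 4) = dwdwbar w 3 4" "wedge (e_form w 4) (e_form w 1) = dwbardw w 4 1"
    by (simp_all add: e_form_def dwdwbar_def dwbardw_def)
  have cnj_dw: "cnj (dwdwbar w i j u v) = dwbardw w i j u v"
      "cnj (dwbardw w i j u v) = dwdwbar w i j u v" for i j u v
    by (simp_all add: dwdwbar_def dwbardw_def wedge_def conj_form_def)
  have cnj_pqrs: "cnj p = p" "cnj q = q" "cnj r = r" "cnj s = s"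
    by (simp_all add: p_def q_def r_def s_def xd_def)
  have A_plus: "of_real ((x 1 * x 3 + x 2 * x 4)\<^sup>2 / 4) * A_plus x z u v =
      p * dwdwbar w 1 2 u v - q * dwbardw w 2 3 u v + r * dwdwbar w 3 4 u v + s * dwbardw w 4 1 u v"
          for u v
    using A_plus_in_w[OF ordered h3 w, of u v]
    unfolding wedges h3_def p_def q_def r_def s_def xd_def of_real_diff .
  have A_plus_cnj: "of_real ((x 1 * x 3 + x 2 * x 4)\<^sup>2 / 4) * cnj (A_plus x z u v) =
      p * dwbardw w 1 2 u v - q * dwdwbar w 2 3 u v + r * dwbardw w 3 4 u v + s * dwdwbar w 4 1 u v"
          for u v
    using arg_cong[OF A_plus[of u v], of cnj] by (simp add: cnj_dw cnj_pqrs)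

  have A1: "of_real ((x 1 * x 3 + x 2 * x 4)\<^sup>2 / 4) * A_1 x z u v =
       p * dwdwbar w 1 2 u v - q * dwdwbar w 2 3 u v
       + r * dwdwbar w 3 4 u v + s * dwdwbar w 4 1 u v
       + p * dwbardw w 1 2 u v - q * dwbardw w 2 3 u v
       + r * dwbardw w 3 4 u v + s * dwbardw w 4 1 u v" for u v
    unfolding A_1_def distrib_left A_plus A_plus_cnj by simp
  have A2: "of_real ((x 1 * x 3 + x 2 * x 4)\<^sup>2) / (4 * \<i> * of_int c * of_real (disc_sqrt x))
      * A_2 c x z u v =
       p * dwdwbar w 1 2 u v + q * dwdwbar w 2 3 u v
       + r * dwdwbar w 3 4 u v - s * dwdwbar w 4 1 u v
       - p * dwbardw w 1 2 u v - q * dwbardw w 2 3 u v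
       - r * dwbardw w 3 4 u v + s * dwbardw w 4 1 u v" for u v
  proof -
    have "of_real ((x 1 * x 3 + x 2 * x 4)\<^sup>2) / (4 * \<i> * of_int c * of_real (disc_sqrt x))
        * A_2 c x z u v
      = of_real ((x 1 * x 3 + x 2 * x 4)\<^sup>2 / 4) * (A_plus x z u v - cnj (A_plus x z u v))"
      using c_nonzero D by (simp add: A_2_def)
    then show ?thesis unfolding right_diff_distrib A_plus A_plus_cnj by simp
  qed
  have omega: "of_real (disc x * (x 1 * x 3 + x 2 * x 4)\<^sup>2) / (4 * \<i> * of_real (disc_sqrt x))
      * omega_form x z u v =
       - ((xd 1 2)\<^sup>2 * xd 1 3 * xd 2 3 * (xd 1 4)\<^sup>2 * xd 3 4 * dwdwbar w 1 1 u v
          + (xd 1 2)\<^sup>2 * (xd 2 3)\<^sup>2 * xd 1 4 * xd 2 4 * xd 3 4 * dwdwbar w 2 2 u v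
          + xd 1 2 * xd 1 3 * (xd 2 3)\<^sup>2 * xd 1 4 * (xd 3 4)\<^sup>2 * dwdwbar w 3 3 u v
          + xd 1 2 * xd 2 3 * (xd 1 4)\<^sup>2 * xd 2 4 * (xd 3 4)\<^sup>2 * dwdwbar w 4 4 u v)" for u v
    using omega_form_in_w[OF ordered h3 w, of u v] unfolding h3_def xd_def of_real_diff .

  obtain N where "N > 0" and N: "\<And>j. j \<in> {1..4} \<Longrightarrow> algebraic_int (complex_of_real (of_int N * x j))"
    using integral_multiple_of_roots by blast
  have "is_lattice \<Lambda>"
    unfolding \<Lambda>
  proof (rule ring_of_integers_is_lattice)
    fix v assume zero: "\<And>u. omega_form x z v u = 0"
    show "v = 0"
    proof (rule ccontr)
      assume "v \<noteq> 0"
      then have "0 < Re (- omega_form x z v (J v))"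
        using kaehler unfolding is_invariant_kaehler_form_def by blast
      then show False by (simp add: zero)
    qed
  qed
  moreover have "of_real (disc x * of_int N ^ 3) * - omega_form x z a b \<in> \<int>" if ab: "a \<in> \<Lambda>" "b \<in> \<Lambda>"
      for a b
    using omega_integral[OF N] ab unfolding \<Lambda> by auto
  moreover have "disc x * of_int N ^ 3 > 0" using disc_pos \<open>N > 0\<close> by simp
  ultimately have abelian: "is_abelian_variety J \<Lambda>"
    using abelian_variety_if_integral_kaehler_form[OF kaehler] by blast
  show ?thesis
  proof (rule exI[of _ w], intro conjI)
    show "w_relation x z w" by (rule w)
    show "\<forall>w'. w_relation x z w' \<longrightarrow> (\<forall>j\<in>{1..4}. w' j = w j)"
      using w_relation_unique[OF h3 w] by blast
    show "linear (\<lambda>v. (w 1 v, w 2 v, w 3 v, w 4 v))" "bij (\<lambda>v. (w 1 v, w 2 v, w 3 v, w 4 v))"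
      by (rule w_bij[OF h3 w])+
    show "\<exists>J. (\<forall>j\<in>{1..4}. \<forall>v. w j (J v) = \<i> * w j v) \<and>
       is_invariant_kaehler_form J (\<lambda>u v. - omega_form x z u v) \<and> is_abelian_variety J \<Lambda>"
      using J kaehler abelian by (intro exI[of _ J] conjI)
  qed (intro allI A1 A2 omega)+
qed

end
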